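(* Let $F$ be a minimally unsatisfiable 2-CNF clause-set with deficiency $\delta(F)=1$ and $\bot\notin F$. Let $n:=n(F)$ and let $u(F)\in\{0,1,2\}$ be the number of unit-clauses of $F$. Then exactly one of the following four cases applies: (i) $u(F)=2$, and $F\cong \mathrm{U}^2_n$; (ii) $u(F)=1$, and $F\cong \mathrm{U}^1_{n,i}$ for some $1\le i\le n-1$; (iii) $u(F)=0$, $F$ has a variable occurring in four clauses, and $F\cong \mathrm{U}^0_{n,i}$ for some $2\le i\le \frac{n+1}{2}$; (iv) $u(F)=0$, no variable of $F$ occurs in four clauses, and $F\cong\mathrm{U}^0_{n,x,y}$ for some $2\le x<y\le n-1$ with $x+y\le n+1$. Moreover the parameter list $L(F)$ (empty, $(i)$, or $(x,y)$ respectively) is unique and computable from $F$ in polynomial time. Writing $\mathrm{canon}(F):=\mathrm{U}^{u(F)}_{n(F),L(F)}$, the map $\mathrm{canon}$ is a polynomial-time computable canonisation: for all such $F,F'$ we have $F\cong F'$ iff $\mathrm{canon}(F)=\mathrm{canon}(F')$. Furthermore the map $F\mapsto \mathrm{canon}'(F):=\mathrm{ig}(\mathrm{canon}(F))$ is a polynomial-time computable graph-canonisation, i.e., $F\cong F'$ iff $\mathrm{canon}'(F)=\mathrm{canon}'(F')$, and from $\mathrm{canon}'(F)$ one can reconstruct $F$ up to isomorphism in polynomial time.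
   Context: Literals are variables $v$ and their complements $\overline v$; integers are used as variables with $\overline v=-v$. A clause is a finite set of literals containing no complementary pair; a clause-set is a finite set of clauses; $\bot$ denotes the empty clause. A 2-CNF is a clause-set all of whose clauses have at most two literals. $n(F)$ is the number of variables occurring in $F$, $c(F)=|F|$, and the deficiency is $\delta(F)=c(F)-n(F)$. $F$ is minimally unsatisfiable if it is unsatisfiable and removing any clause makes it satisfiable. Clause-sets $F,G$ are isomorphic ($F\cong G$) if there is a bijection $f$ from the literals of $F$ to the literals of $G$ with $f(\overline x)=\overline{f(x)}$ and $\{f(C):C\in F\}=G$. For $n\in\mathbb N$ let $M:=\{\{-1,2\},\{-2,3\},\dots,\{-(n-1),n\}\}$ and define: $\mathrm{U}^2_n:=M\cup\{\{1\},\{-n\}\}$ ($n\ge1$); $\mathrm{U}^1_{n,i}:=M\cup\{\{1\},\{-n,-i\}\}$ ($n\ge 2$, $1\le i\le n-1$); $\mathrm{U}^0_{n,i}:=M\cup\{\{1,i\},\{-n,-i\}\}$ ($n\ge3$, $2\le i\le\frac{n+1}2$); $\mathrm{U}^0_{n,x,y}:=M\cup\{\{1,x\},\{-n,-y\}\}$ ($n\ge4$, $2\le x<y\le n-1$, $x+y\le n+1$). The implication digraph $\mathrm{idg}(F)$ of a 2-CNF $F$ without empty clause has vertex set the literals over variables of $F$, arcs $(\overline x,x)$ for each unit-clause $\{x\}\in F$, and arcs $(\overline x,y),(\overline y,x)$ for each clause $\{x,y\}\in F$ with $x\neq y$. The implication graph $\mathrm{ig}(F)$ is the underlying undirected simple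 graph of $\mathrm{idg}(F)$ (directions forgotten, antiparallel arcs merged into one edge). *)

theory Defs
  imports "HOL-Computational_Algebra.Polynomial"
begin

section \<open>Clause-sets\<close>

text \<open>
  Literals are the nonzero integers, complementation is negation, and the variables are the
  positive integers.
\<close>

type_synonym clause = "int set"
type_synonym clause_set = "clause set"

definition is_clause :: "clause \<Rightarrow> bool" where
  "is_clause C \<longleftrightarrow> finite C \<and> 0 \<notin> C \<and> (\<forall>x\<in>C. - x \<notin> C)"

definition is_clause_set :: "clause_set \<Rightarrow> bool" where
  "is_clause_set F \<longleftrightarrow> finite F \<and> (\<forall>C\<in>F. is_clause C)"

definition two_cnf :: "clause_set \<Rightarrow> bool" where
  "two_cnf F \<longleftrightarrow> is_clause_set F \<and> (\<forall>C\<in>F. card C \<le> 2)"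

definition vars :: "clause_set \<Rightarrow> int set" where
  "vars F = abs ` \<Union>F"

definition lits :: "clause_set \<Rightarrow> int set" where
  "lits F = vars F \<union> uminus ` vars F"

definition nvars :: "clause_set \<Rightarrow> nat" where
  "nvars F = card (vars F)"

definition deficiency :: "clause_set \<Rightarrow> int" where
  "deficiency F = int (card F) - int (nvars F)"

definition nunits :: "clause_set \<Rightarrow> nat" where
  "nunits F = card {C \<in> F. card C = 1}"

definition var_occ :: "clause_set \<Rightarrow> int \<Rightarrow> nat" where
  "var_occ F v = card {C \<in> F. v \<in> C \<or> - v \<in> C}"

definition lit_true :: "(int \<Rightarrow> bool) \<Rightarrow> int \<Rightarrow> bool" where
  "lit_true \<phi> x \<longleftrightarrow> (if x > 0 then \<phi> x else \<not> \<phi> (- x))"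

definition satisfiable :: "clause_set \<Rightarrow> bool" where
  "satisfiable F \<longleftrightarrow> (\<exists>\<phi>. \<forall>C\<in>F. \<exists>x\<in>C. lit_true \<phi> x)"

definition min_unsat :: "clause_set \<Rightarrow> bool" where
  "min_unsat F \<longleftrightarrow> \<not> satisfiable F \<and> (\<forall>C\<in>F. satisfiable (F - {C}))"

definition cls_iso :: "clause_set \<Rightarrow> clause_set \<Rightarrow> bool" (infix \<open>\<cong>\<close> 50) where
  "F \<cong> G \<longleftrightarrow> (\<exists>f. bij_betw f (lits F) (lits G) \<and> (\<forall>x\<in>lits F. f (- x) = - f x) \<and>
                  (\<lambda>C. f ` C) ` F = G)"

definition mu2_def1 :: "clause_set set" where
  "mu2_def1 = {F. two_cnf F \<and> min_unsat F \<and> deficiency F = 1 \<and> {} \<notin> F}"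


section \<open>The canonical clause-sets\<close>

definition chain_clauses :: "nat \<Rightarrow> clause_set" where
  "chain_clauses n = {{- int j, int (j + 1)} | j. 1 \<le> j \<and> j < n}"

definition U2 :: "nat \<Rightarrow> clause_set" where
  "U2 n = chain_clauses n \<union> {{1}, {- int n}}"

definition U1 :: "nat \<Rightarrow> nat \<Rightarrow> clause_set" where
  "U1 n i = chain_clauses n \<union> {{1}, {- int n, - int i}}"

definition U0 :: "nat \<Rightarrow> nat \<Rightarrow> clause_set" where
  "U0 n i = chain_clauses n \<union> {{1, int i}, {- int n, - int i}}"

definition U0' :: "nat \<Rightarrow> nat \<Rightarrow> nat \<Rightarrow> clause_set" where
  "U0' n x y = chain_clauses n \<union> {{1, int x}, {- int n, - int y}}"

definition U_fam :: "nat \<Rightarrow> nat \<Rightarrow> nat list \<Rightarrow> clause_set" where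
  "U_fam k n L = (case L of
      [] \<Rightarrow> U2 n
    | [i] \<Rightarrow> if k = 1 then U1 n i else U0 n i
    | x # y # _ \<Rightarrow> U0' n x y)"

definition is_params :: "clause_set \<Rightarrow> nat list \<Rightarrow> bool" where
  "is_params F L \<longleftrightarrow>
     (L = [] \<and> nunits F = 2 \<and> F \<cong> U2 (nvars F)) \<or>
     (\<exists>i. L = [i] \<and> nunits F = 1 \<and> 1 \<le> i \<and> i \<le> nvars F - 1 \<and> F \<cong> U1 (nvars F) i) \<or>
     (\<exists>i. L = [i] \<and> nunits F = 0 \<and> (\<exists>v\<in>vars F. var_occ F v = 4) \<and>
          2 \<le> i \<and> 2 * i \<le> nvars F + 1 \<and> F \<cong> U0 (nvars F) i) \<or>
     (\<exists>x y. L = [x, y] \<and> nunits F = 0 \<and> \<not> (\<exists>v\<in>vars F. var_occ F v = 4) \<and>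
          2 \<le> x \<and> x < y \<and> y \<le> nvars F - 1 \<and> x + y \<le> nvars F + 1 \<and> F \<cong> U0' (nvars F) x y)"

definition params :: "clause_set \<Rightarrow> nat list" where
  "params F = (THE L. is_params F L)"

definition canon :: "clause_set \<Rightarrow> clause_set" where
  "canon F = U_fam (nunits F) (nvars F) (params F)"

definition exactly_one :: "bool list \<Rightarrow> bool" where
  "exactly_one Ps \<longleftrightarrow> (\<exists>!k. k < length Ps \<and> Ps ! k)"


section \<open>Implication graphs\<close>

type_synonym digraph = "int set \<times> (int \<times> int) set"
type_synonym graph = "int set \<times> int set set"

definition idg :: "clause_set \<Rightarrow> digraph" where
  "idg F = (lits F,
            {(- x, x) | x. {x} \<in> F} \<union> {(- x, y) | x y. {x, y} \<in> F \<and> x \<noteq> y})"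

definition underlying_graph :: "digraph \<Rightarrow> graph" where
  "underlying_graph D = (fst D, {{a, b} | a b. (a, b) \<in> snd D})"

definition ig :: "clause_set \<Rightarrow> graph" where
  "ig F = underlying_graph (idg F)"

definition canon' :: "clause_set \<Rightarrow> graph" where
  "canon' F = ig (canon F)"


section \<open>Polynomial-time computability\<close>

text \<open>
  The model of computation is first-order recursive programs over binary trees (pure LISP
  without atoms, evaluated call-by-value).  A program is a list of function bodies; function k
  is called by \<^term>\<open>Call k es\<close>, its formal parameters are \<^term>\<open>Arg 0\<close>, \<^term>\<open>Arg 1\<close>, and so on,
  and function 0 is the main function.  \<^term>\<open>Leaf\<close> serves as the truth value false.

  Evaluating a variable, a constructor, a selector or an equality test costs one more than the
  size of the tree it yields; a conditional and a call cost one plus the cost of their parts.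
  Without charging for sizes, iterating a tree-doubling function would build trees of
  exponential size in linear time.  With it, every tree arising in a computation of cost t on
  input w has size at most t + size w (cf. lemma eval_size), so a Turing machine that stores
  trees as strings simulates the computation in time polynomial in t + size w; conversely these
  programs simulate Turing machines with polynomial overhead, keeping tapes as lists.  Hence
  polynomial time has its usual meaning.
\<close>

datatype tree = Leaf | Node tree tree

fun left :: "tree \<Rightarrow> tree" where
  "left Leaf = Leaf"
| "left (Node a b) = a"

fun right :: "tree \<Rightarrow> tree" where
  "right Leaf = Leaf"
| "right (Node a b) = b"

datatype exp =
    Arg nat
  | Empty
  | Join exp exp
  | Left exp
  | Right exp
  | Equal exp exp
  | Cond exp exp exp
  | Call nat "exp list"

type_synonym program = "exp list"

text \<open>
  \<^term>\<open>eval P env e v t\<close>: in program P, with actual parameters env, the expression e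
  evaluates to v at cost t.
\<close>

inductive
  eval :: "program \<Rightarrow> tree list \<Rightarrow> exp \<Rightarrow> tree \<Rightarrow> nat \<Rightarrow> bool" and
  evals :: "program \<Rightarrow> tree list \<Rightarrow> exp list \<Rightarrow> tree list \<Rightarrow> nat \<Rightarrow> bool"
  for P :: program
where
  eval_Arg: "i < length env \<Longrightarrow> eval P env (Arg i) (env ! i) (size (env ! i) + 1)"
| eval_Empty: "eval P env Empty Leaf 1"
| eval_Join: "eval P env a v s \<Longrightarrow> eval P env b w t \<Longrightarrow>
    eval P env (Join a b) (Node v w) (s + t + size (Node v w) + 1)"
| eval_Left: "eval P env a v s \<Longrightarrow> eval P env (Left a) (left v) (s + size (left v) + 1)"
| eval_Right: "eval P env a v s \<Longrightarrow> eval P env (Right a) (right v) (s + size (right v) + 1)"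
| eval_Equal: "eval P env a v s \<Longrightarrow> eval P env b w t \<Longrightarrow>
    r = (if v = w then Node Leaf Leaf else Leaf) \<Longrightarrow>
    eval P env (Equal a b) r (s + t + size r + 1)"
| eval_Cond_true: "eval P env c u r \<Longrightarrow> u \<noteq> Leaf \<Longrightarrow> eval P env a v s \<Longrightarrow>
    eval P env (Cond c a b) v (r + s + 1)"
| eval_Cond_false: "eval P env c Leaf r \<Longrightarrow> eval P env b v s \<Longrightarrow>
    eval P env (Cond c a b) v (r + s + 1)"
| eval_Call: "evals P env es vs s \<Longrightarrow> k < length P \<Longrightarrow> eval P vs (P ! k) v t \<Longrightarrow>
    eval P env (Call k es) v (s + t + 1)"
| evals_Nil: "evals P env [] [] 0"
| evals_Cons: "eval P env e v s \<Longrightarrow> evals P env es vs t \<Longrightarrow>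
    evals P env (e # es) (v # vs) (s + t)"

lemma eval_size:
  "eval P env e v t \<Longrightarrow> size v < t"
  "evals P env es vs t \<Longrightarrow> sum_list (map size vs) \<le> t"
  by (induction rule: eval_evals.inducts) auto

inductive_cases eval_ArgE: "eval P env (Arg i) v t"
inductive_cases eval_EmptyE: "eval P env Empty v t"
inductive_cases eval_JoinE: "eval P env (Join a b) v t"
inductive_cases eval_LeftE: "eval P env (Left a) v t"
inductive_cases eval_RightE: "eval P env (Right a) v t"
inductive_cases eval_EqualE: "eval P env (Equal a b) v t"
inductive_cases eval_CondE: "eval P env (Cond c a b) v t"
inductive_cases eval_CallE: "eval P env (Call k es) v t"
inductive_cases evals_NilE: "evals P env [] vs t"
inductive_cases evals_ConsE: "evals P env (e # es) vs t"

lemma eval_deterministic: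
  "eval P env e v t \<Longrightarrow> eval P env e v' t' \<Longrightarrow> v' = v \<and> t' = t"
  "evals P env es vs t \<Longrightarrow> evals P env es vs' t' \<Longrightarrow> vs' = vs \<and> t' = t"
proof (induction arbitrary: v' t' and vs' t' rule: eval_evals.inducts)
  case eval_Arg
  from eval_Arg.prems show ?case by (rule eval_ArgE) simp_all
next
  case eval_Empty
  from eval_Empty.prems show ?case by (rule eval_EmptyE) simp_all
next
  case eval_Join
  from eval_Join.prems show ?case by (rule eval_JoinE) (auto dest!: eval_Join(2,4))
next
  case eval_Left
  from eval_Left.prems show ?case by (rule eval_LeftE) (auto dest!: eval_Left(2))
next
  case eval_Right
  from eval_Right.prems show ?case by (rule eval_RightE) (auto dest!: eval_Right(2))
next
  case eval_Equal
  from eval_Equal.prems show ?case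
    by (rule eval_EqualE) (auto dest!: eval_Equal(2,4) simp: eval_Equal(5))
next
  case eval_Cond_true
  from eval_Cond_true.prems show ?case
    by (rule eval_CondE) (auto dest!: eval_Cond_true(2,4) simp: eval_Cond_true(5))
next
  case eval_Cond_false
  from eval_Cond_false.prems show ?case by (rule eval_CondE) (auto dest!: eval_Cond_false(2,4))
next
  case eval_Call
  from eval_Call.prems show ?case by (rule eval_CallE) (auto dest!: eval_Call(2,5))
next
  case evals_Nil
  from evals_Nil.prems show ?case by (rule evals_NilE) simp_all
next
  case evals_Cons
  from evals_Cons.prems show ?case by (rule evals_ConsE) (auto dest!: evals_Cons(2,4))
qed

definition runs :: "program \<Rightarrow> tree \<Rightarrow> tree \<Rightarrow> nat \<Rightarrow> bool" where
  "runs P w w' t \<longleftrightarrow> P \<noteq> [] \<and> eval P [w] (P ! 0) w' t"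

text \<open>
  Inputs and outputs are represented by trees through relations between trees and objects, since
  a finite set is represented by any of its enumerations.  A function f is polynomial-time
  computable on a domain D if some program transforms every representation of every a in D into
  a representation of f a, in time polynomial in the size of the given representation.
\<close>

definition polytime_on ::
  "(tree \<Rightarrow> 'a \<Rightarrow> bool) \<Rightarrow> (tree \<Rightarrow> 'b \<Rightarrow> bool) \<Rightarrow> 'a set \<Rightarrow> ('a \<Rightarrow> 'b) \<Rightarrow> bool"
where
  "polytime_on R S D f \<longleftrightarrow>
     (\<exists>P (p :: nat poly). \<forall>a\<in>D. \<forall>w. R w a \<longrightarrow>
        (\<exists>w' t. runs P w w' t \<and> t \<le> poly p (size w) \<and> S w' (f a)))"

text \<open>Numbers are represented in binary, least significant bit first.\<close>

fun nat_tree :: "nat \<Rightarrow> tree" where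
  "nat_tree n = (if n = 0 then Leaf
     else Node (if odd n then Node Leaf Leaf else Leaf) (nat_tree (n div 2)))"

declare nat_tree.simps [simp del]

definition int_tree :: "int \<Rightarrow> tree" where
  "int_tree x = Node (if x < 0 then Node Leaf Leaf else Leaf) (nat_tree (nat \<bar>x\<bar>))"

fun list_tree :: "tree list \<Rightarrow> tree" where
  "list_tree [] = Leaf"
| "list_tree (w # ws) = Node w (list_tree ws)"

definition int_rep :: "tree \<Rightarrow> int \<Rightarrow> bool" where
  "int_rep w x \<longleftrightarrow> w = int_tree x"

definition set_rep :: "(tree \<Rightarrow> 'a \<Rightarrow> bool) \<Rightarrow> tree \<Rightarrow> 'a set \<Rightarrow> bool" where
  "set_rep R w A \<longleftrightarrow>
     (\<exists>xs ws. distinct xs \<and> set xs = A \<and> list_all2 R ws xs \<and> w = list_tree ws)"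

definition nat_list_rep :: "tree \<Rightarrow> nat list \<Rightarrow> bool" where
  "nat_list_rep w L \<longleftrightarrow> w = list_tree (map nat_tree L)"

definition cls_rep :: "tree \<Rightarrow> clause_set \<Rightarrow> bool" where
  "cls_rep = set_rep (set_rep int_rep)"

definition graph_rep :: "tree \<Rightarrow> graph \<Rightarrow> bool" where
  "graph_rep w G \<longleftrightarrow>
     (\<exists>w1 w2. w = Node w1 w2 \<and> set_rep int_rep w1 (fst G) \<and>
              set_rep (set_rep int_rep) w2 (snd G))"

end

theory Submission
  imports Defs
begin

text \<open>
  Counting occurrences shows that a minimally unsatisfiable 2-CNF F of deficiency 1 with at least two
  variables has a variable occurring exactly once in each sign.  Resolving it away keeps F in the class;
  undoing this step inserts one literal into a chain of implications, so by induction F is a chain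
  a1, ..., an closed by two clauses {a1, ax} and {-an, -ay}, that is, F is isomorphic to U0' n x y.
  Unsatisfiability gives x \<le> y, and reversing the chain gives x + y \<le> n + 1.  Conversely x and y are
  invariants: x and -y are the only literals (the roots) occurring in two clauses or in a unit clause,
  and all walks in the implication digraph from the complement of a root to that root have the same
  length, namely x and n + 1 - y, respectively.

  The programs compute these two lengths by following arbitrary walks from the complements of the roots.
  In the graph of the canonical form, y is read off the edge joining n to a negative literal, and then
  x off the edge joining -1 to a positive literal.
\<close>


section \<open>Cost of programs\<close>

text \<open>Counting alone only yields 3n <= 2(n + 1), that is n <= 2; the case n = 2 is excluded
  separately, since four clauses would be needed. A variable in at most two clauses occurs once in
  each sign because minimality forces the complement of every occurring literal to occur.
  Elimination removes one clause and one variable, so the deficiency stays 1. Reversing the chain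
  exchanges the two walk lengths, so only the unordered pair {x, n + 1 - y} is invariant; x + y <= n
  + 1 says that x is the smaller one, which makes the pair decode uniquely. A program receives an
  arbitrary enumeration with arbitrary names. It never constructs an isomorphism: it needs only two
  numbers, and since all walks to a root have the same length, it may take the first successor it
  finds. The cost model charges for tree sizes. Specifications therefore fix a cap B on all sizes
  and count only calls; the cost is then at most a constant times (calls + 1) times (B + 2). In the
  end B is quadratic and the number of calls cubic in the input size.\<close>

fun nodes :: "exp \<Rightarrow> nat" where
  "nodes (Arg i) = 1"
| "nodes Empty = 1"
| "nodes (Join a b) = nodes a + nodes b + 1"
| "nodes (Left a) = nodes a + 1"
| "nodes (Right a) = nodes a + 1"
| "nodes (Equal a b) = nodes a + nodes b + 1"
| "nodes (Cond c a b) = nodes c + nodes a + nodes b + 1"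
| "nodes (Call k es) = sum_list (map nodes es) + 1"

text \<open>
  If all trees have size at most B, then every node of an expression costs at most B + 2, so that
  the cost is controlled by the number c of calls.
\<close>

definition computes :: "program \<Rightarrow> nat \<Rightarrow> tree list \<Rightarrow> exp \<Rightarrow> tree \<Rightarrow> nat \<Rightarrow> bool" where
  "computes P B env e v c \<longleftrightarrow> size v \<le> B \<and>
     (\<exists>t. eval P env e v t \<and> t \<le> (nodes e + c * sum_list (map nodes P)) * (B + 2))"

definition computes_list ::
  "program \<Rightarrow> nat \<Rightarrow> tree list \<Rightarrow> exp list \<Rightarrow> tree list \<Rightarrow> nat \<Rightarrow> bool" where
  "computes_list P B env es vs c \<longleftrightarrow> (\<forall>v\<in>set vs. size v \<le> B) \<and>
     (\<exists>t. evals P env es vs t \<and>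
        t \<le> (sum_list (map nodes es) + c * sum_list (map nodes P)) * (B + 2))"

text \<open>The budget c covers the calls made inside the body; the call of k itself is charged by
  the caller, as the extra 1 in \<open>computes_Call\<close>.\<close>

definition fn :: "program \<Rightarrow> nat \<Rightarrow> nat \<Rightarrow> tree list \<Rightarrow> tree \<Rightarrow> nat \<Rightarrow> bool" where
  "fn P B k vs v c \<longleftrightarrow> k < length P \<and> computes P B vs (P ! k) v c"

lemma computes_mono:
  assumes "computes P B env e v c" "c \<le> d"
  shows "computes P B env e v d"
proof -
  have "(nodes e + c * sum_list (map nodes P)) * (B + 2)
      \<le> (nodes e + d * sum_list (map nodes P)) * (B + 2)"
    using assms(2) by (intro mult_right_mono add_left_mono) auto
  then show ?thesis
    using assms(1) unfolding computes_def by (meson order_trans)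
qed

lemma fn_mono: "fn P B k vs v c \<Longrightarrow> c \<le> d \<Longrightarrow> fn P B k vs v d"
  unfolding fn_def using computes_mono by blast

lemma size_left: "size (left v) \<le> size v"
  by (cases v) auto

lemma size_right: "size (right v) \<le> size v"
  by (cases v) auto

lemma computes_Arg:
  assumes "i < length env" "size (env ! i) \<le> B"
  shows "computes P B env (Arg i) (env ! i) 0"
  using assms eval_Arg[OF assms(1), of P] unfolding computes_def by fastforce

lemma computes_Empty: "computes P B env Empty Leaf 0"
  using eval_Empty[of P env] unfolding computes_def by fastforce

lemma computes_Join:
  assumes "computes P B env a v c" "computes P B env b w d" "size (Node v w) \<le> B"
  shows "computes P B env (Join a b) (Node v w) (c + d)"
proof -
  from assms obtain s t where st:
    "eval P env a v s" "s \<le> (nodes a + c * sum_list (map nodes P)) * (B + 2)"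
    "eval P env b w t" "t \<le> (nodes b + d * sum_list (map nodes P)) * (B + 2)"
    unfolding computes_def by blast
  have "s + t + size (Node v w) + 1
    \<le> (nodes (Join a b) + (c + d) * sum_list (map nodes P)) * (B + 2)"
    using st(2,4) assms(3) by (simp add: algebra_simps)
  with eval_Join[OF st(1,3)] assms(3) show ?thesis
    unfolding computes_def by blast
qed

lemma computes_Left:
  assumes "computes P B env a v c"
  shows "computes P B env (Left a) (left v) c"
proof -
  from assms obtain s where s:
    "eval P env a v s" "s \<le> (nodes a + c * sum_list (map nodes P)) * (B + 2)" "size v \<le> B"
    unfolding computes_def by blast
  have "s + size (left v) + 1
    \<le> (nodes (Left a) + c * sum_list (map nodes P)) * (B + 2)"
    using s(2,3) size_left[of v] by (simp add: algebra_simps)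
  with eval_Left[OF s(1)] s(3) size_left[of v] show ?thesis
    unfolding computes_def using order_trans by blast
qed

lemma computes_Right:
  assumes "computes P B env a v c"
  shows "computes P B env (Right a) (right v) c"
proof -
  from assms obtain s where s:
    "eval P env a v s" "s \<le> (nodes a + c * sum_list (map nodes P)) * (B + 2)" "size v \<le> B"
    unfolding computes_def by blast
  have "s + size (right v) + 1
    \<le> (nodes (Right a) + c * sum_list (map nodes P)) * (B + 2)"
    using s(2,3) size_right[of v] by (simp add: algebra_simps)
  with eval_Right[OF s(1)] s(3) size_right[of v] show ?thesis
    unfolding computes_def using order_trans by blast
qed

lemma computes_Equal:
  assumes "computes P B env a v c" "computes P B env b w d" "0 < B"
  shows "computes P B env (Equal a b) (if v = w then Node Leaf Leaf else Leaf) (c + d)"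
proof -
  let ?r = "if v = w then Node Leaf Leaf else Leaf"
  from assms obtain s t where st:
    "eval P env a v s" "s \<le> (nodes a + c * sum_list (map nodes P)) * (B + 2)"
    "eval P env b w t" "t \<le> (nodes b + d * sum_list (map nodes P)) * (B + 2)"
    unfolding computes_def by blast
  have r: "size ?r \<le> B" using assms(3) by simp
  have "s + t + size ?r + 1
    \<le> (nodes (Equal a b) + (c + d) * sum_list (map nodes P)) * (B + 2)"
    using st(2,4) r by (simp add: algebra_simps)
  with eval_Equal[OF st(1,3) refl] r show ?thesis
    unfolding computes_def by blast
qed

lemma computes_Cond:
  assumes "computes P B env e u c" "computes P B env (if u = Leaf then b else a) v d"
  shows "computes P B env (Cond e a b) v (c + d)"
proof -
  from assms obtain s t where st:
    "eval P env e u s" "s \<le> (nodes e + c * sum_list (map nodes P)) * (B + 2)"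
    "eval P env (if u = Leaf then b else a) v t"
    "t \<le> (nodes (if u = Leaf then b else a) + d * sum_list (map nodes P)) * (B + 2)" "size v \<le> B"
    unfolding computes_def by blast
  have "t \<le> (nodes a + nodes b + d * sum_list (map nodes P)) * (B + 2)"
    using st(4) by (rule order_trans) (intro mult_right_mono add_right_mono, auto)
  then have "s + t + 1 \<le> (nodes (Cond e a b) + (c + d) * sum_list (map nodes P)) * (B + 2)"
    using st(2) by (simp add: algebra_simps)
  moreover have "eval P env (Cond e a b) v (s + t + 1)"
    using st(1,3) eval_Cond_true[of P env e u s a v t b] eval_Cond_false[of P env e s b v t a]
    by (cases "u = Leaf") auto
  ultimately show ?thesis using st(5) unfolding computes_def by blast
qed

text \<open>The body of the callee has at most as many nodes as the whole program, so raising the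
  number of calls by one pays for it.\<close>

lemma computes_Call:
  assumes "computes_list P B env es vs c" "fn P B k vs v d"
  shows "computes P B env (Call k es) v (c + d + 1)"
proof -
  let ?K = "sum_list (map nodes P)"
  from assms obtain s t where st:
    "evals P env es vs s" "s \<le> (sum_list (map nodes es) + c * ?K) * (B + 2)"
    "eval P vs (P ! k) v t" "t \<le> (nodes (P ! k) + d * ?K) * (B + 2)" "size v \<le> B" "k < length P"
    unfolding computes_def fn_def computes_list_def by blast
  have "nodes (P ! k) \<le> ?K"
    using st(6) by (intro member_le_sum_list) auto
  then have "t \<le> (?K + d * ?K) * (B + 2)"
    using st(4) by (elim order_trans) (intro mult_right_mono add_right_mono, auto)
  then have "s + t + 1 \<le> (nodes (Call k es) + (c + d + 1) * ?K) * (B + 2)"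
    using st(2) by (simp add: algebra_simps)
  with eval_Call[OF st(1,6,3)] st(5) show ?thesis
    unfolding computes_def by blast
qed

lemma computes_list_Nil: "computes_list P B env [] [] 0"
  using evals_Nil[of P env] unfolding computes_list_def by fastforce

lemma computes_list_Cons:
  assumes "computes P B env e v c" "computes_list P B env es vs d"
  shows "computes_list P B env (e # es) (v # vs) (c + d)"
proof -
  let ?K = "sum_list (map nodes P)"
  from assms obtain s t where st:
    "eval P env e v s" "s \<le> (nodes e + c * ?K) * (B + 2)" "size v \<le> B"
    "evals P env es vs t" "t \<le> (sum_list (map nodes es) + d * ?K) * (B + 2)"
    "\<forall>v\<in>set vs. size v \<le> B"
    unfolding computes_def computes_list_def by blast
  have "s + t \<le> (sum_list (map nodes (e # es)) + (c + d) * ?K) * (B + 2)"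
    using st(2,5) by (simp add: algebra_simps)
  with evals_Cons[OF st(1,4)] st(3,6) show ?thesis
    unfolding computes_list_def by auto
qed

text \<open>Weakest preconditions: e evaluates to some v with some number c of calls such that Q v c.\<close>

fun vc :: "program \<Rightarrow> nat \<Rightarrow> tree list \<Rightarrow> exp \<Rightarrow> (tree \<Rightarrow> nat \<Rightarrow> bool) \<Rightarrow> bool" and
    vcs :: "program \<Rightarrow> nat \<Rightarrow> tree list \<Rightarrow> exp list \<Rightarrow> (tree list \<Rightarrow> nat \<Rightarrow> bool) \<Rightarrow> bool" where
  "vc P B env (Arg i) Q \<longleftrightarrow> i < length env \<and> Q (env ! i) 0"
| "vc P B env Empty Q \<longleftrightarrow> Q Leaf 0"
| "vc P B env (Join a b) Q \<longleftrightarrow> vc P B env a (\<lambda>v c. vc P B env b (\<lambda>w d.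
     size v + size w < B \<and> Q (Node v w) (c + d)))"
| "vc P B env (Left a) Q \<longleftrightarrow> vc P B env a (\<lambda>v c. Q (left v) c)"
| "vc P B env (Right a) Q \<longleftrightarrow> vc P B env a (\<lambda>v c. Q (right v) c)"
| "vc P B env (Equal a b) Q \<longleftrightarrow> vc P B env a (\<lambda>v c. vc P B env b (\<lambda>w d.
     0 < B \<and> (v = w \<longrightarrow> Q (Node Leaf Leaf) (c + d)) \<and> (v \<noteq> w \<longrightarrow> Q Leaf (c + d))))"
| "vc P B env (Cond e a b) Q \<longleftrightarrow> vc P B env e (\<lambda>u c.
     (u \<noteq> Leaf \<longrightarrow> vc P B env a (\<lambda>v d. Q v (c + d))) \<and>
     (u = Leaf \<longrightarrow> vc P B env b (\<lambda>v d. Q v (c + d))))"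
| "vc P B env (Call k es) Q \<longleftrightarrow> vcs P B env es (\<lambda>vs c.
     (\<forall>v\<in>set vs. size v \<le> B) \<longrightarrow> (\<exists>v d. fn P B k vs v d \<and> Q v (c + d + 1)))"
| "vcs P B env [] Q \<longleftrightarrow> Q [] 0"
| "vcs P B env (e # es) Q \<longleftrightarrow> vc P B env e (\<lambda>v c. vcs P B env es (\<lambda>vs d. Q (v # vs) (c + d)))"

text \<open>At a call, \<open>vc\<close> lets the size bounds of the arguments be assumed:
  \<open>computes_list\<close> already guarantees them, so they need not be proved at every call
  site.\<close>

lemma vc_sound:
  "vc P B env e Q \<Longrightarrow> \<forall>v\<in>set env. size v \<le> B \<Longrightarrow> \<exists>v c. computes P B env e v c \<and> Q v c"
  "vcs P B env es Q' \<Longrightarrow> \<forall>v\<in>set env. size v \<le> B \<Longrightarrow>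
     \<exists>vs c. computes_list P B env es vs c \<and> Q' vs c"
proof (induction P B env e Q and P B env es Q' rule: vc_vcs.induct)
  case (1 P B env i Q)
  then show ?case using computes_Arg[of i env B P] by auto
next
  case (2 P B env Q)
  then show ?case using computes_Empty[of P B env] by auto
next
  case (3 P B env a b Q)
  then show ?case using computes_Join[of P B env a _ _ b] by simp (meson Suc_leI)
next
  case (4 P B env a Q)
  then show ?case using computes_Left[of P B env a] by fastforce
next
  case (5 P B env a Q)
  then show ?case using computes_Right[of P B env a] by fastforce
next
  case (6 P B env a b Q)
  from 6(3) have "vc P B env a (\<lambda>v c. vc P B env b (\<lambda>w d.
     0 < B \<and> (v = w \<longrightarrow> Q (Node Leaf Leaf) (c + d)) \<and> (v \<noteq> w \<longrightarrow> Q Leaf (c + d))))" by simp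
  from 6(2)[OF this 6(4)] obtain v c where 1: "computes P B env a v c" and
    "vc P B env b (\<lambda>w d.
     0 < B \<and> (v = w \<longrightarrow> Q (Node Leaf Leaf) (c + d)) \<and> (v \<noteq> w \<longrightarrow> Q Leaf (c + d)))" by blast
  from 6(1)[OF this(2) 6(4)] obtain w d where 2: "computes P B env b w d" and
    "0 < B \<and> (v = w \<longrightarrow> Q (Node Leaf Leaf) (c + d)) \<and> (v \<noteq> w \<longrightarrow> Q Leaf (c + d))"
    by blast
  then show ?case using computes_Equal[OF 1 2] by (cases "v = w") auto
next
  case (7 P B env e a b Q)
  from 7(4) have "vc P B env e (\<lambda>u c.
     (u \<noteq> Leaf \<longrightarrow> vc P B env a (\<lambda>v d. Q v (c + d))) \<and>
     (u = Leaf \<longrightarrow> vc P B env b (\<lambda>v d. Q v (c + d))))" by simp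
  from 7(3)[OF this 7(5)] obtain u c where 1: "computes P B env e u c" and
    2: "u \<noteq> Leaf \<longrightarrow> vc P B env a (\<lambda>v d. Q v (c + d))"
     "u = Leaf \<longrightarrow> vc P B env b (\<lambda>v d. Q v (c + d))" by blast
  show ?case
  proof (cases "u = Leaf")
    case True
    then show ?thesis using 7(2)[of u c] 7(5) 2(2) computes_Cond[OF 1, of b a] by fastforce
  next
    case False
    then show ?thesis using 7(1)[of u c] 7(5) 2(1) computes_Cond[OF 1, of b a] by fastforce
  qed
next
  case (8 P B env k es Q)
  from 8(2) have "vcs P B env es (\<lambda>vs c.
     (\<forall>v\<in>set vs. size v \<le> B) \<longrightarrow> (\<exists>v d. fn P B k vs v d \<and> Q v (c + d + 1)))" by simp
  from 8(1)[OF this 8(3)] obtain vs c where 1: "computes_list P B env es vs c" and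
    2: "(\<forall>v\<in>set vs. size v \<le> B) \<longrightarrow> (\<exists>v d. fn P B k vs v d \<and> Q v (c + d + 1))" by blast
  from 1 2 obtain v d where "fn P B k vs v d" "Q v (c + d + 1)"
    unfolding computes_list_def by blast
  then show ?case using computes_Call[OF 1] by blast
next
  case (9 P B env Q)
  then show ?case using computes_list_Nil[of P B env] by auto
next
  case (10 P B env e es Q)
  from 10(3) have "vc P B env e (\<lambda>v c. vcs P B env es (\<lambda>vs d. Q (v # vs) (c + d)))" by simp
  from 10(2)[OF this 10(4)] obtain v c where 1: "computes P B env e v c" and
    2: "vcs P B env es (\<lambda>vs d. Q (v # vs) (c + d))" by blast
  from 10(1)[OF 2 10(4)] computes_list_Cons[OF 1] show ?case by blast
qed

lemma fnI:
  assumes "k < length P" "\<forall>v\<in>set vs. size v \<le> B" "vc P B vs (P ! k) (\<lambda>v c. v = r \<and> c \<le> d)"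
  shows "fn P B k vs r d"
  using vc_sound(1)[OF assms(3,2)] assms(1) computes_mono unfolding fn_def by blast

text \<open>An introduction rule for the existential that \<open>vc\<close> produces at a call: a
  specification of the callee supplies both the value and the cost.\<close>

lemma callI: "fn P B k vs v d \<Longrightarrow> Q v d \<Longrightarrow> \<exists>v d. fn P B k vs v d \<and> Q v d"
  by blast

lemma fn_size: "fn P B k vs v c \<Longrightarrow> size v \<le> B"
  unfolding fn_def computes_def by blast

text \<open>For a fixed program its total number of nodes K is a constant, so polynomial bounds on
  the sizes and on the number of calls give a polynomial cost. The factor \<open>[:1, 1:]\<close> is
  the polynomial X + 1.\<close>

lemma polytime_onI:
  assumes "\<And>a w. a \<in> D \<Longrightarrow> R w a \<Longrightarrow> \<exists>w'. S w' (f a) \<and>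
     fn P (b * (size w + 1) ^ i) 0 [w] w' (c * (size w + 1) ^ j)"
  shows "polytime_on R S D f"
proof -
  let ?K = "sum_list (map nodes P)"
  define p :: "nat poly" where "p = ([:?K:] + [:c:] * [:1, 1:] ^ j * [:?K:]) * ([:b:] * [:1, 1:] ^ i + [:2:])"
  have p: "poly p s = (?K + (c * (s + 1) ^ j) * ?K) * (b * (s + 1) ^ i + 2)" for s
    unfolding p_def by (simp add: algebra_simps)
  show ?thesis
    unfolding polytime_on_def
  proof (intro exI[of _ P] exI[of _ p] ballI allI impI)
    fix a w assume "a \<in> D" "R w a"
    from assms[OF this] obtain w' where w': "S w' (f a)"
      "fn P (b * (size w + 1) ^ i) 0 [w] w' (c * (size w + 1) ^ j)" by blast
    then obtain t where t: "0 < length P" "eval P [w] (P ! 0) w' t"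
      "t \<le> (nodes (P ! 0) + (c * (size w + 1) ^ j) * ?K) * (b * (size w + 1) ^ i + 2)"
      unfolding fn_def computes_def by blast
    have "nodes (P ! 0) \<le> ?K"
      using t(1) by (intro member_le_sum_list) auto
    then have "t \<le> poly p (size w)"
      unfolding p using t(3) by (elim order_trans) (intro mult_right_mono add_right_mono, auto)
    with t w' show "\<exists>w' t. runs P w w' t \<and> t \<le> poly p (size w) \<and> S w' (f a)"
      unfolding runs_def by blast
  qed
qed


section \<open>Walks in the implication digraph\<close>

text \<open>The arc from a to b of the implication digraph. Unit clauses are included, as {- a, b}
  collapses to {b} for a = - b.\<close>

definition step :: "clause_set \<Rightarrow> int \<Rightarrow> int \<Rightarrow> bool" where
  "step F a b \<longleftrightarrow> {- a, b} \<in> F"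

text \<open>Every walk from a reaches r for the first time after exactly k steps. Quantifying over
  all successors lets a program choose any of them; demanding that a successor exists keeps the
  condition from holding vacuously at a dead end.\<close>

fun hits :: "clause_set \<Rightarrow> int \<Rightarrow> int \<Rightarrow> nat \<Rightarrow> bool" where
  "hits F r a 0 \<longleftrightarrow> a = r"
| "hits F r a (Suc k) \<longleftrightarrow> a \<noteq> r \<and> (\<exists>b. step F a b) \<and> (\<forall>b. step F a b \<longrightarrow> hits F r b k)"

text \<open>As \<open>step F (- r) b\<close> means {r, b} in F, the first alternative is the unit
  clause {r}, and in the second b and c give two different clauses containing r.\<close>

definition root :: "clause_set \<Rightarrow> int \<Rightarrow> bool" where
  "root F r \<longleftrightarrow> step F (- r) r \<or> (\<exists>b c. b \<noteq> c \<and> step F (- r) b \<and> step F (- r) c)"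

section \<open>The programs\<close>

subsection \<open>Trees for literals and lists\<close>

abbreviation truth :: tree where "truth \<equiv> Node Leaf Leaf"

definition ints_tree :: "int list \<Rightarrow> tree" where
  "ints_tree xs = list_tree (map int_tree xs)"

definition cls_tree :: "int list list \<Rightarrow> tree" where
  "cls_tree Fs = list_tree (map ints_tree Fs)"

text \<open>Programs count in unary, where successor, comparison and truncated subtraction are
  recursions on lists; binary numbers are produced only when literals or parameters are
  written.\<close>

definition unary :: "nat \<Rightarrow> tree" where
  "unary n = list_tree (replicate n Leaf)"

lemma unary_simps [simp]: "unary 0 = Leaf" "unary (Suc n) = Node Leaf (unary n)"
  by (auto simp: unary_def)

lemma size_unary [simp]: "size (unary n) = n"
  by (induction n) auto

lemma ints_tree_simps [simp]:
  "ints_tree [] = Leaf" "ints_tree (x # xs) = Node (int_tree x) (ints_tree xs)"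
  by (auto simp: ints_tree_def)

lemma cls_tree_simps [simp]:
  "cls_tree [] = Leaf" "cls_tree (C # Fs) = Node (ints_tree C) (cls_tree Fs)"
  by (auto simp: cls_tree_def)

lemma ints_tree_Leaf [simp]: "ints_tree xs = Leaf \<longleftrightarrow> xs = []"
  by (cases xs) auto

lemma cls_tree_Leaf [simp]: "cls_tree xs = Leaf \<longleftrightarrow> xs = []"
  by (cases xs) auto

lemma nat_tree_0 [simp]: "nat_tree 0 = Leaf"
  by (simp add: nat_tree.simps)

lemma nat_tree_1: "nat_tree 1 = Node truth Leaf"
  by (simp add: nat_tree.simps)

lemma nat_tree_Leaf [simp]: "nat_tree n = Leaf \<longleftrightarrow> n = 0"
  by (subst nat_tree.simps) simp

lemma nat_tree_inj: "nat_tree m = nat_tree n \<Longrightarrow> m = n"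
proof (induction m arbitrary: n rule: less_induct)
  case (less m)
  show ?case
  proof (cases "m = 0 \<or> n = 0")
    case True
    then show ?thesis using less.prems by (metis nat_tree_Leaf nat_tree_0)
  next
    case False
    then have "(odd m \<longleftrightarrow> odd n) \<and> nat_tree (m div 2) = nat_tree (n div 2)"
      using less.prems by (subst (asm) (1 2) nat_tree.simps) (auto split: if_splits)
    moreover have "m div 2 < m" using False by simp
    ultimately have "m div 2 = n div 2" "m mod 2 = n mod 2"
      using less.IH by (auto simp: odd_iff_mod_2_eq_one)
    then show ?thesis by (metis div_mult_mod_eq)
  qed
qed

lemma nat_tree_eq_iff [simp]: "nat_tree m = nat_tree n \<longleftrightarrow> m = n"
  using nat_tree_inj by blast

lemma int_tree_Leaf [simp]: "int_tree x \<noteq> Leaf" "Leaf \<noteq> int_tree x"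
  by (auto simp: int_tree_def)

lemma int_tree_eq_iff [simp]: "int_tree x = int_tree y \<longleftrightarrow> x = y"
  by (auto simp: int_tree_def split: if_splits)

lemma ints_tree_eq_iff [simp]: "ints_tree xs = ints_tree ys \<longleftrightarrow> xs = ys"
  by (induction xs arbitrary: ys; case_tac ys) auto

lemma right_int_tree [simp]: "right (int_tree x) = nat_tree (nat \<bar>x\<bar>)"
  by (simp add: int_tree_def)

lemma left_int_tree_Leaf [simp]: "left (int_tree x) = Leaf \<longleftrightarrow> \<not> x < 0"
  by (simp add: int_tree_def)

lemma left_int_tree_eq [simp]:
  "left (int_tree x) = left (int_tree y) \<longleftrightarrow> (x < 0 \<longleftrightarrow> y < 0)"
  by (simp add: int_tree_def)

lemma int_tree_pos: "int_tree (int n) = Node Leaf (nat_tree n)"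
  by (simp add: int_tree_def)

lemma int_tree_uminus:
  "x < 0 \<Longrightarrow> int_tree (- x) = Node Leaf (nat_tree (nat \<bar>x\<bar>))"
  "x > 0 \<Longrightarrow> int_tree (- x) = Node truth (nat_tree (nat \<bar>x\<bar>))"
  by (auto simp: int_tree_def)

lemma size_nat_tree: "size (nat_tree n) \<le> 2 * n"
proof (induction n rule: less_induct)
  case (less n)
  show ?case
  proof (cases "n = 0")
    case False
    then have "size (nat_tree (n div 2)) \<le> 2 * (n div 2)" by (intro less) simp
    then show ?thesis using False by (subst nat_tree.simps) auto
  qed simp
qed

lemma size_int_tree: "size (int_tree x) \<le> 2 + size (nat_tree (nat \<bar>x\<bar>))"
  by (simp add: int_tree_def)

lemma length_le_size_ints_tree: "length xs \<le> size (ints_tree xs)"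
  by (induction xs) auto

lemma length_le_size_cls_tree: "length Fs \<le> size (cls_tree Fs)"
  by (induction Fs) auto

lemma size_int_tree_mem: "x \<in> set C \<Longrightarrow> size (int_tree x) < size (ints_tree C)"
  by (induction C) auto

lemma size_ints_tree_mem: "C \<in> set Fs \<Longrightarrow> size (ints_tree C) < size (cls_tree Fs)"
  by (induction Fs) auto

subsection \<open>The function bodies\<close>

text \<open>
  The number in a call is the position of the body in the list prog.  Body 5 lists the literals of
  all clauses, those of unit clauses twice, so that the roots are the literals listed twice.
\<close>

abbreviation neg_exp :: "exp \<Rightarrow> exp" where
  "neg_exp e \<equiv> Join (Cond (Left e) Empty (Join Empty Empty)) (Right e)"

abbreviation true_exp :: exp where "true_exp \<equiv> Join Empty Empty"
abbreviation one_exp :: exp where "one_exp \<equiv> Join true_exp Empty"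
abbreviation pos_exp :: "exp \<Rightarrow> exp" where "pos_exp e \<equiv> Join Empty e"
abbreviation minus_exp :: "exp \<Rightarrow> exp" where "minus_exp e \<equiv> Join true_exp e"
abbreviation pair_exp :: "exp \<Rightarrow> exp \<Rightarrow> exp" where "pair_exp a b \<equiv> Join a (Join b Empty)"
abbreviation pair_or_unit_exp :: "exp \<Rightarrow> exp \<Rightarrow> exp" where
  "pair_or_unit_exp a b \<equiv> Cond (Equal a b) (Join a Empty) (pair_exp a b)"

definition solve_body :: exp where
  "solve_body = Call 16 [Arg 0, Call 6 [Call 5 [Arg 0]]]"

text \<open>Arg 1 is the complement -a of the current literal: a clause {-a, b} yields b, and the
  unit clause {-a} yields -a itself. There is no test for the end of the list, so Arg 1 has to occur
  in some clause.\<close>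

definition step_body :: exp where
  "step_body = Cond (Equal (Left (Left (Arg 0))) (Arg 1))
     (Cond (Right (Left (Arg 0))) (Left (Right (Left (Arg 0)))) (Arg 1))
     (Cond (Equal (Left (Right (Left (Arg 0)))) (Arg 1)) (Left (Left (Arg 0)))
        (Call 2 [Right (Arg 0), Arg 1]))"

definition dist_body :: exp where
  "dist_body = Cond (Equal (Arg 2) (Arg 1)) Empty
     (Join Empty (Call 3 [Arg 0, Arg 1, Call 2 [Arg 0, neg_exp (Arg 2)]]))"

definition mem_body :: exp where
  "mem_body = Cond (Arg 1)
     (Cond (Equal (Left (Arg 1)) (Arg 0)) true_exp (Call 4 [Arg 0, Right (Arg 1)])) Empty"

definition occ_body :: exp where
  "occ_body = Cond (Arg 0)
     (Join (Left (Left (Arg 0)))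
       (Join (Cond (Right (Left (Arg 0))) (Left (Right (Left (Arg 0)))) (Left (Left (Arg 0))))
         (Call 5 [Right (Arg 0)]))) Empty"

definition dups_body :: exp where
  "dups_body = Cond (Arg 0)
     (Cond (Call 4 [Left (Arg 0), Right (Arg 0)])
       (Join (Left (Arg 0)) (Call 6 [Right (Arg 0)])) (Call 6 [Right (Arg 0)])) Empty"

definition other_body :: exp where
  "other_body = Cond (Equal (Left (Arg 0)) (Arg 1)) (Call 7 [Right (Arg 0), Arg 1]) (Left (Arg 0))"

definition le_body :: exp where
  "le_body = Cond (Arg 0) (Cond (Arg 1) (Call 8 [Right (Arg 0), Right (Arg 1)]) Empty) true_exp"

definition drop_body :: exp where
  "drop_body = Cond (Arg 0) (Call 9 [Right (Arg 0), Right (Arg 1)]) (Arg 1)"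

definition inc_body :: exp where
  "inc_body = Cond (Left (Arg 0)) (Join Empty (Call 10 [Right (Arg 0)]))
     (Join true_exp (Right (Arg 0)))"

text \<open>Only the spine of the argument is inspected, so this converts the length of an arbitrary
  list to binary, not just a unary number.\<close>

definition bin_body :: exp where
  "bin_body = Cond (Arg 0) (Call 10 [Call 11 [Right (Arg 0)]]) Empty"

definition chain_body :: exp where
  "chain_body = Cond (Right (Arg 0))
     (Join (pair_exp (minus_exp (Call 11 [Right (Arg 0)])) (pos_exp (Call 11 [Arg 0])))
       (Call 12 [Right (Arg 0)])) Empty"

definition build_body :: exp where
  "build_body = Join (pair_or_unit_exp (pos_exp one_exp) (pos_exp (Arg 1)))
     (Join (pair_or_unit_exp (minus_exp (Call 11 [Arg 0])) (minus_exp (Arg 2)))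
       (Call 12 [Arg 0]))"

text \<open>The heights are x and n + 1 - y in unknown order, the smaller being x. The clause list
  has n + 1 entries, so dropping as many of them as the larger height leaves a list of length
  y.\<close>

definition solve_ordered_body :: exp where
  "solve_ordered_body = Cond (Call 8 [Arg 1, Arg 2])
     (Join (Call 11 [Arg 1]) (Call 11 [Call 9 [Arg 2, Arg 0]]))
     (Join (Call 11 [Arg 2]) (Call 11 [Call 9 [Arg 1, Arg 0]]))"

definition solve_roots_body :: exp where
  "solve_roots_body = Call 14 [Arg 0,
     Call 3 [Arg 0, Arg 1, neg_exp (Arg 1)], Call 3 [Arg 0, Arg 2, neg_exp (Arg 2)]]"

definition solve_list_body :: exp where
  "solve_list_body = Call 15 [Arg 0, Left (Arg 1), Call 7 [Arg 1, Left (Arg 1)]]"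

definition params_body :: exp where
  "params_body = Cond (Equal (Arg 1) one_exp)
     (Cond (Equal (Arg 2) (Arg 0)) Empty (Join (Arg 2) Empty))
     (Cond (Equal (Arg 1) (Arg 2)) (Join (Arg 1) Empty) (pair_exp (Arg 1) (Arg 2)))"

definition verts_body :: exp where
  "verts_body = Cond (Arg 0)
     (Join (pos_exp (Call 11 [Arg 0])) (Join (minus_exp (Call 11 [Arg 0])) (Call 18 [Right (Arg 0)])))
     Empty"

definition edges_body :: exp where
  "edges_body = Cond (Right (Arg 0))
     (Join (pair_exp (pos_exp (Call 11 [Right (Arg 0)])) (pos_exp (Call 11 [Arg 0])))
       (Join (pair_exp (minus_exp (Call 11 [Right (Arg 0)])) (minus_exp (Call 11 [Arg 0])))
         (Call 19 [Right (Arg 0)]))) Empty"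

text \<open>Sets are represented by enumerations without repetition only, so an edge that arises
  twice has to be listed once.\<close>

definition insert_body :: exp where
  "insert_body = Cond (Call 4 [Arg 0, Arg 1]) (Arg 1) (Join (Arg 0) (Arg 1))"

definition graph_body :: exp where
  "graph_body = Join (Call 18 [Arg 0])
     (Call 20 [pair_exp (pos_exp (Arg 1)) (minus_exp one_exp),
      Call 20 [pair_exp (pos_exp one_exp) (minus_exp (Arg 1)),
      Call 20 [pair_exp (pos_exp (Call 11 [Arg 0])) (minus_exp (Arg 2)),
      Call 20 [pair_exp (pos_exp (Arg 2)) (minus_exp (Call 11 [Arg 0])),
      Call 19 [Arg 0]]]]])"

definition count_body :: exp where
  "count_body = Cond (Arg 0)
     (Cond (Left (Left (Arg 0))) (Call 22 [Right (Arg 0)]) (Join Empty (Call 22 [Right (Arg 0)])))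
     Empty"

text \<open>Looks for an edge at Arg 1 whose other end has the opposite sign. Only the binary
  variable of that end is returned, because the caller knows the sign.\<close>

definition partner_body :: exp where
  "partner_body = Cond (Equal (Left (Left (Arg 0))) (Arg 1))
     (Cond (Equal (Left (Left (Right (Left (Arg 0))))) (Left (Arg 1)))
       (Call 23 [Right (Arg 0), Arg 1]) (Right (Left (Right (Left (Arg 0))))))
     (Cond (Equal (Left (Right (Left (Arg 0)))) (Arg 1))
       (Cond (Equal (Left (Left (Left (Arg 0)))) (Left (Arg 1)))
         (Call 23 [Right (Arg 0), Arg 1]) (Right (Left (Left (Arg 0)))))
       (Call 23 [Right (Arg 0), Arg 1]))"

text \<open>The case y = 1 is separate: the edge {n, -y} is then {n, -1}, a further edge from -1 to
  a positive literal, and the lookup of x would be ambiguous. But x <= y gives x = 1 in this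
  case.\<close>

definition decode_body :: exp where
  "decode_body = Call 13 [Arg 0,
     Cond (Equal (Arg 2) one_exp) one_exp (Call 23 [Arg 1, minus_exp one_exp]), Arg 2]"

definition length_body :: exp where
  "length_body = Cond (Arg 0) (Join Empty (Call 25 [Right (Arg 0)])) Empty"

text \<open>The main expression is a parameter, so that specifications of the other bodies, proved
  for every main expression, serve all four main programs.\<close>

definition prog :: "exp \<Rightarrow> program" where
  "prog main = [main, solve_body, step_body, dist_body, mem_body, occ_body, dups_body, other_body,
     le_body, drop_body, inc_body, bin_body, chain_body, build_body, solve_ordered_body,
     solve_roots_body, solve_list_body, params_body, verts_body, edges_body, insert_body,
     graph_body, count_body, partner_body, decode_body, length_body]"

lemma prog_nth:
  "prog main ! 0 = main"
  "prog main ! Suc 0 = solve_body"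
  "prog main ! 2 = step_body"
  "prog main ! 3 = dist_body"
  "prog main ! 4 = mem_body"
  "prog main ! 5 = occ_body"
  "prog main ! 6 = dups_body"
  "prog main ! 7 = other_body"
  "prog main ! 8 = le_body"
  "prog main ! 9 = drop_body"
  "prog main ! 10 = inc_body"
  "prog main ! 11 = bin_body"
  "prog main ! 12 = chain_body"
  "prog main ! 13 = build_body"
  "prog main ! 14 = solve_ordered_body"
  "prog main ! 15 = solve_roots_body"
  "prog main ! 16 = solve_list_body"
  "prog main ! 17 = params_body"
  "prog main ! 18 = verts_body"
  "prog main ! 19 = edges_body"
  "prog main ! 20 = insert_body"
  "prog main ! 21 = graph_body"
  "prog main ! 22 = count_body"
  "prog main ! 23 = partner_body"
  "prog main ! 24 = decode_body"
  "prog main ! 25 = length_body"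
  by (simp_all add: prog_def)

subsection \<open>Specifications\<close>

context
  fixes main :: exp and B :: nat
begin

abbreviation run :: "nat \<Rightarrow> tree list \<Rightarrow> tree \<Rightarrow> nat \<Rightarrow> bool" where
  "run \<equiv> fn (prog main) B"

text \<open>The variant of \<open>callI\<close> for goals in which simplification has already fixed
  the value, leaving only the cost existential.\<close>

lemma callI2: "fn P b k vs v d \<Longrightarrow> Q d \<Longrightarrow> \<exists>d. fn P b k vs v d \<and> Q d"
  by blast

lemma runI:
  assumes "k < 26" "\<forall>v\<in>set vs. size v \<le> B"
    "vc (prog main) B vs (prog main ! k) (\<lambda>v c. v = r \<and> c \<le> d)"
  shows "run k vs r d"
  using assms by (intro fnI) (simp_all add: prog_def)

section \<open>Finding the roots and their walk lengths\<close>

fun next_lit :: "int list list \<Rightarrow> int \<Rightarrow> int" where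
  "next_lit [] x = x"
| "next_lit ([] # Cs) x = next_lit Cs x"
| "next_lit ([a] # Cs) x = (if a = x then x else next_lit Cs x)"
| "next_lit ((a # b # as) # Cs) x = (if a = x then b else if b = x then a else next_lit Cs x)"

definition two_lists :: "int list list \<Rightarrow> bool" where
  "two_lists Fs \<longleftrightarrow> (\<forall>C\<in>set Fs. (\<exists>a. C = [a]) \<or> (\<exists>a b. C = [a, b]))"

lemma two_lists_Cons:
  "two_lists (C # Fs) \<longleftrightarrow> ((\<exists>a. C = [a]) \<or> (\<exists>a b. C = [a, b])) \<and> two_lists Fs"
  by (auto simp: two_lists_def)

lemma run_step:
  assumes "x \<in> \<Union> (set ` set Fs)" "two_lists Fs" "size (cls_tree Fs) \<le> B" "size (int_tree x) \<le> B"
  shows "run 2 [cls_tree Fs, int_tree x] (int_tree (next_lit Fs x)) (length Fs)"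
  using assms
proof (induction Fs)
  case (Cons C Fs)
  from Cons.prems(2) consider a where "C = [a]" | a b where "C = [a, b]"
    by (auto simp: two_lists_Cons)
  then show ?case
  proof cases
    case 1
    show ?thesis using Cons 1
      by (intro runI) (auto simp: prog_nth step_body_def two_lists_Cons intro!: callI callI2)
  next
    case 2
    show ?thesis using Cons 2
      by (intro runI) (auto simp: prog_nth step_body_def two_lists_Cons intro!: callI callI2)
  qed
qed simp

lemma run_mem:
  assumes "size (list_tree ws) \<le> B" "size w \<le> B" "0 < B"
  shows "run 4 [w, list_tree ws] (if w \<in> set ws then truth else Leaf) (length ws)"
  using assms
proof (induction ws)
  case Nil
  then show ?case by (intro runI) (auto simp: prog_nth mem_body_def)
next
  case (Cons a ws)
  then show ?case
    by (intro runI) (auto simp: prog_nth mem_body_def intro!: callI[of _ _ _ _ _ "length ws"])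
qed


lemma next_lit_mem:
  "x \<in> \<Union> (set ` set Fs) \<Longrightarrow> two_lists Fs \<Longrightarrow> {x, next_lit Fs x} \<in> set ` set Fs"
proof (induction Fs)
  case (Cons C Fs)
  from Cons.prems(2) consider a where "C = [a]" | a b where "C = [a, b]"
    by (auto simp: two_lists_Cons)
  then show ?case
    using Cons by cases (auto simp: two_lists_Cons insert_commute)
qed simp

text \<open>A walk is continued from a complement that need not itself occur in the list, and
  complementing a positive literal enlarges its tree. Sizes are therefore bounded through the
  variable.\<close>

lemma size_neg_bound:
  assumes "C \<in> set Fs" "x \<in> set C \<or> - x \<in> set C"
  shows "size (nat_tree (nat \<bar>x\<bar>)) + 3 \<le> size (cls_tree Fs)" 
proof -
  obtain y where y: "y \<in> set C" "\<bar>y\<bar> = \<bar>x\<bar>" using assms(2) by auto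
  have "size (nat_tree (nat \<bar>x\<bar>)) < size (int_tree y)"
    using y(2) by (simp add: int_tree_def)
  then show ?thesis
    using size_int_tree_mem[OF y(1)] size_ints_tree_mem[OF assms(1)] by linarith
qed

text \<open>The size of the result is part of the induction, because every \<open>Join\<close> has
  to respect B; the factor 2 pays for the literals of unit clauses, which are listed twice.\<close>

lemma run_occ:
  assumes "two_lists Fs" "2 * size (cls_tree Fs) \<le> B"
  shows "run 5 [cls_tree Fs] (ints_tree (concat (map (\<lambda>C. [hd C, last C]) Fs))) (length Fs) \<and>
    size (ints_tree (concat (map (\<lambda>C. [hd C, last C]) Fs))) \<le> 2 * size (cls_tree Fs)"
  using assms
proof (induction Fs)
  case Nil
  then show ?case by (auto simp: prog_nth occ_body_def intro: runI)
next
  case (Cons C Fs)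
  from Cons.prems(1) consider a where "C = [a]" | a b where "C = [a, b]"
    by (auto simp: two_lists_Cons)
  then show ?case
  proof cases
    case 1
    show ?thesis using Cons 1
      by (intro conjI runI) (auto simp: prog_nth occ_body_def two_lists_Cons intro!: callI callI2)
  next
    case 2
    show ?thesis using Cons 2
      by (intro conjI runI) (auto simp: prog_nth occ_body_def two_lists_Cons intro!: callI callI2)
  qed
qed

fun dups :: "'a list \<Rightarrow> 'a list" where
  "dups [] = []"
| "dups (x # xs) = (if x \<in> set xs then x # dups xs else dups xs)"

lemma run_dups:
  assumes "size (ints_tree xs) \<le> B" "0 < B"
  shows "run 6 [ints_tree xs] (ints_tree (dups xs)) (length xs * (length xs + 2)) \<and>
    size (ints_tree (dups xs)) \<le> size (ints_tree xs)"
  using assms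
proof (induction xs)
  case Nil
  then show ?case by (auto simp: prog_nth dups_body_def intro: runI)
next
  case (Cons x xs)
  have *: "run 4 [int_tree x, ints_tree xs] (if x \<in> set xs then truth else Leaf) (length xs)"
    using run_mem[of "map int_tree xs" "int_tree x"] Cons.prems
    by (auto simp: ints_tree_def image_iff)
  show ?case
    using Cons by (intro conjI runI)
      (auto simp: prog_nth dups_body_def intro!: callI[OF *] callI callI2)
qed

text \<open>Only the set of entries of the list of roots is ever established, so the second root is
  searched for rather than taken from the second position.\<close>

fun other :: "'a list \<Rightarrow> 'a \<Rightarrow> 'a" where
  "other [] x = x"
| "other (y # ys) x = (if y = x then other ys x else y)"

lemma other_mem: "\<exists>y\<in>set ys. y \<noteq> x \<Longrightarrow> other ys x \<in> set ys \<and> other ys x \<noteq> x"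
  by (induction ys) auto

lemma other_same: "\<forall>y\<in>set ys. y = x \<Longrightarrow> other ys x = x"
  by (induction ys) auto

lemma run_other:
  assumes "\<exists>y\<in>set ys. y \<noteq> x" "size (ints_tree ys) \<le> B" "size (int_tree x) \<le> B" "0 < B"
  shows "run 7 [ints_tree ys, int_tree x] (int_tree (other ys x)) (length ys)"
  using assms
proof (induction ys)
  case (Cons y ys)
  then show ?case
    by (intro runI) (auto simp: prog_nth other_body_def intro!: callI callI2)
qed simp

lemma run_le:
  assumes "m \<le> B" "n \<le> B" "0 < B"
  shows "run 8 [unary m, unary n] (if m \<le> n then truth else Leaf) m"
  using assms
proof (induction m arbitrary: n)
  case 0
  then show ?case by (intro runI) (auto simp: prog_nth le_body_def)
next
  case (Suc m)
  note IH = Suc.IH[of "n - 1"] and prems = Suc.prems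
  show ?case
  proof (cases n)
    case 0
    then show ?thesis using prems by (intro runI) (auto simp: prog_nth le_body_def)
  next
    case (Suc k)
    have "run 8 [unary m, unary k] (if m \<le> k then truth else Leaf) m"
      using IH prems Suc by simp
    then show ?thesis using prems Suc
      by (intro runI) (auto simp: prog_nth le_body_def intro!: callI2)
  qed
qed

lemma run_drop:
  assumes "m \<le> B" "size (list_tree ws) \<le> B"
  shows "run 9 [unary m, list_tree ws] (list_tree (drop m ws)) m"
  using assms
proof (induction m arbitrary: ws)
  case 0
  then show ?case by (intro runI) (auto simp: prog_nth drop_body_def)
next
  case (Suc m)
  show ?case
    using Suc.prems by (intro runI; cases ws)
      (auto simp: prog_nth drop_body_def intro!: callI2 Suc.IH Suc.IH[of "[]", simplified])
qed

text \<open>The recursion follows the carries and is only logarithmically deep, but the crude bound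
  n is enough and passes directly through the induction on n div 2.\<close>

lemma run_inc:
  assumes "2 * Suc n \<le> B"
  shows "run 10 [nat_tree n] (nat_tree (Suc n)) n"
  using assms
proof (induction n rule: less_induct)
  case (less n)
  have s: "size (nat_tree n) \<le> 2 * n" "size (nat_tree (n div 2)) \<le> 2 * (n div 2)"
    "size (nat_tree (Suc (n div 2))) \<le> 2 * (Suc (n div 2))"
    using size_nat_tree by blast+
  show ?case
  proof (cases "odd n")
    case True
    then have "n \<noteq> 0" by (metis even_zero)
    then have n: "nat_tree n = Node truth (nat_tree (n div 2))"
      using True by (subst nat_tree.simps) simp
    have n1: "nat_tree (Suc n) = Node Leaf (nat_tree (Suc (n div 2)))"
      using True by (subst nat_tree.simps) (auto elim!: oddE)
    have IH: "run 10 [nat_tree (n div 2)] (nat_tree (Suc (n div 2))) (n div 2)"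
      using \<open>n \<noteq> 0\<close> less.prems by (intro less.IH) auto
    have "n div 2 < n" "2 * (n div 2) < n" using True \<open>n \<noteq> 0\<close> by presburger+
    then show ?thesis
      using less.prems s by (intro runI) (auto simp: prog_nth inc_body_def n n1 intro!: callI2[OF IH])
  next
    case False
    have l: "left (nat_tree n) = Leaf" "right (nat_tree n) = nat_tree (n div 2)"
      using False by (subst nat_tree.simps; simp)+
    have n1: "nat_tree (Suc n) = Node truth (nat_tree (n div 2))"
      using False by (subst nat_tree.simps) (auto elim!: evenE)
    show ?thesis
      using less.prems s by (intro runI) (auto simp: prog_nth inc_body_def l n1)
  qed
qed

lemma run_bin_list:
  assumes "size (list_tree ws) \<le> B" "2 * length ws \<le> B"
  shows "run 11 [list_tree ws] (nat_tree (length ws)) (length ws * (length ws + 2))"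
  using assms
proof (induction ws)
  case Nil
  then show ?case by (intro runI) (auto simp: prog_nth bin_body_def)
next
  case (Cons w ws)
  then show ?case
    by (intro runI) (auto simp: prog_nth bin_body_def intro!: callI callI2 run_inc)
qed


lemma run_bin:
  assumes "2 * n \<le> B"
  shows "run 11 [unary n] (nat_tree n) (n * (n + 2))"
  using run_bin_list[of "replicate n Leaf"] assms by (simp flip: unary_def)

text \<open>Since \<open>hits\<close> speaks of every successor, it does not matter which clause
  containing -a the search meets first. Each step costs at most \<open>length Fs\<close> calls
  inside the search, the call of the search and the recursive call.\<close>

lemma run_dist:
  assumes "hits (set ` set Fs) r a k" "two_lists Fs" "size (cls_tree Fs) + 2 \<le> B" "k \<le> B"
    "0 \<notin> \<Union> (set ` set Fs)" "size (int_tree r) \<le> B" "size (int_tree a) \<le> B"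
  shows "run 3 [cls_tree Fs, int_tree r, int_tree a] (unary k) (k * (length Fs + 2))"
  using assms
proof (induction k arbitrary: a)
  case 0
  then show ?case by (intro runI) (auto simp: prog_nth dist_body_def)
next
  case (Suc k)
  from Suc.prems(1) have a: "a \<noteq> r" "\<exists>b. step (set ` set Fs) a b"
    "\<And>b. step (set ` set Fs) a b \<Longrightarrow> hits (set ` set Fs) r b k" by auto
  from a(2) obtain C b where C: "C \<in> set Fs" "{-a, b} = set C" by (auto simp: step_def)
  then have mem: "- a \<in> \<Union> (set ` set Fs)" by auto
  \<comment> \<open>\<open>neg_exp\<close> is correct only on nonzero literals: 0 would become a
    zero carrying the negative sign, which is not of the form \<open>int_tree x\<close>.\<close>
  then have "a \<noteq> 0" using Suc.prems(5) by (metis neg_equal_0_iff_equal)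
  define b' where "b' = next_lit Fs (- a)"
  have st: "{- a, b'} \<in> set ` set Fs" unfolding b'_def using next_lit_mem[OF mem Suc.prems(2)] .
  then obtain D where D: "D \<in> set Fs" "set D = {-a, b'}" by auto
  have sa: "size (nat_tree (nat \<bar>a\<bar>)) + 3 \<le> size (cls_tree Fs)"
    by (rule size_neg_bound[OF C(1)]) (use C(2) in auto)
  have sma: "size (int_tree (- a)) \<le> B"
    using size_int_tree[of "- a"] sa Suc.prems(3) by simp
  have sb: "size (int_tree b') \<le> B"
    using size_int_tree_mem[of b' D] size_ints_tree_mem[OF D(1)] D(2) Suc.prems(3) by auto
  have run1: "run 2 [cls_tree Fs, int_tree (- a)] (int_tree b') (length Fs)"
    unfolding b'_def using run_step[OF mem Suc.prems(2)] Suc.prems(3) sma by simp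
  have run2: "run 3 [cls_tree Fs, int_tree r, int_tree b'] (unary k) (k * (length Fs + 2))"
    using Suc.prems sb a(3)[of b'] st by (intro Suc.IH) (auto simp: step_def)
  show ?case
    using Suc.prems a(1) sa sma sb \<open>a \<noteq> 0\<close> run1
    by (intro runI; cases "a < 0") (auto simp: prog_nth dist_body_def int_tree_uminus
        intro!: callI[of _ _ 2 _ "int_tree b'"] callI[OF run2] callI2[OF run2])
qed

section \<open>Writing down the canonical clause-sets and their graphs\<close>

fun chain_list :: "nat \<Rightarrow> int list list" where
  "chain_list (Suc (Suc m)) = [- int (Suc m), int (Suc (Suc m))] # chain_list (Suc m)"
| "chain_list _ = []"

fun vert_list :: "nat \<Rightarrow> int list" where
  "vert_list 0 = []"
| "vert_list (Suc m) = int (Suc m) # - int (Suc m) # vert_list m"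

fun edge_list :: "nat \<Rightarrow> int list list" where
  "edge_list (Suc (Suc m)) = [int (Suc m), int (Suc (Suc m))] #
     [- int (Suc m), - int (Suc (Suc m))] # edge_list (Suc m)"
| "edge_list _ = []"

lemma int_tree_Suc:
  "int_tree (1 + int n) = Node Leaf (nat_tree (Suc n))"
  "int_tree (2 + int n) = Node Leaf (nat_tree (Suc (Suc n)))"
  "int_tree (int n + 1) = Node Leaf (nat_tree (Suc n))"
  "int_tree (int n + 2) = Node Leaf (nat_tree (Suc (Suc n)))"
  "int_tree (- int n - 1) = Node truth (nat_tree (Suc n))"
  "int_tree (- int n - 2) = Node truth (nat_tree (Suc (Suc n)))"
  "int_tree (- 1 - int n) = Node truth (nat_tree (Suc n))"
  "int_tree (- 2 - int n) = Node truth (nat_tree (Suc (Suc n)))"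
  by (simp_all add: int_tree_def nat_add_distrib)

lemma run_chain:
  assumes "size (cls_tree (chain_list n)) \<le> B" "2 * n \<le> B"
  shows "run 12 [unary n] (cls_tree (chain_list n)) (n * (2 * (n * (n + 2)) + 3))"
  using assms
proof (induction n rule: chain_list.induct)
  case (1 m)
  have r1: "run 11 [Node Leaf (unary m)] (nat_tree (Suc m)) (Suc m * (Suc m + 2))"
    using run_bin[of "Suc m"] 1(3) by simp
  have r2: "run 11 [Node Leaf (Node Leaf (unary m))] (nat_tree (Suc (Suc m)))
      (Suc (Suc m) * (Suc (Suc m) + 2))"
    using run_bin[of "Suc (Suc m)"] 1(3) by simp
  have r3: "run 12 [Node Leaf (unary m)] (cls_tree (chain_list (Suc m)))
     (Suc m * (2 * (Suc m * (Suc m + 2)) + 3))" using 1 by simp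
  show ?case
    using 1(2,3)
    by (intro runI) (auto simp: prog_nth chain_body_def int_tree_Suc algebra_simps
        intro!: callI[OF r1] callI[OF r2] callI2[OF r3])
qed (auto intro!: runI simp: prog_nth chain_body_def)

lemma run_verts:
  assumes "size (ints_tree (vert_list n)) \<le> B" "2 * n \<le> B"
  shows "run 18 [unary n] (ints_tree (vert_list n)) (n * (2 * (n * (n + 2)) + 3))"
  using assms
proof (induction n)
  case (Suc m)
  have r1: "run 11 [Node Leaf (unary m)] (nat_tree (Suc m)) (Suc m * (Suc m + 2))"
    using run_bin[of "Suc m"] Suc.prems by simp
  have r3: "run 18 [unary m] (ints_tree (vert_list m)) (m * (2 * (m * (m + 2)) + 3))"
    using Suc by simp
  show ?case
    using Suc.prems
    by (intro runI) (auto simp: prog_nth verts_body_def int_tree_Suc algebra_simps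
        intro!: callI[OF r1] callI2[OF r3])
qed (auto intro!: runI simp: prog_nth verts_body_def)

lemma run_edges:
  assumes "size (cls_tree (edge_list n)) \<le> B" "2 * n \<le> B"
  shows "run 19 [unary n] (cls_tree (edge_list n)) (n * (4 * (n * (n + 2)) + 5))"
  using assms
proof (induction n rule: edge_list.induct)
  case (1 m)
  have r1: "run 11 [Node Leaf (unary m)] (nat_tree (Suc m)) (Suc m * (Suc m + 2))"
    using run_bin[of "Suc m"] 1(3) by simp
  have r2: "run 11 [Node Leaf (Node Leaf (unary m))] (nat_tree (Suc (Suc m)))
      (Suc (Suc m) * (Suc (Suc m) + 2))"
    using run_bin[of "Suc (Suc m)"] 1(3) by simp
  have r3: "run 19 [Node Leaf (unary m)] (cls_tree (edge_list (Suc m)))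
     (Suc m * (4 * (Suc m * (Suc m + 2)) + 5))" using 1 by simp
  show ?case
    using 1(2,3)
    by (intro runI) (auto simp: prog_nth edges_body_def int_tree_Suc algebra_simps
        intro!: callI[OF r1] callI[OF r2] callI2[OF r3])
qed (auto intro!: runI simp: prog_nth edges_body_def)


definition pair_or_unit :: "int \<Rightarrow> int \<Rightarrow> int list" where
  "pair_or_unit a b = (if a = b then [a] else [a, b])"

definition build_list :: "nat \<Rightarrow> nat \<Rightarrow> nat \<Rightarrow> int list list" where
  "build_list n x y = pair_or_unit 1 (int x) # pair_or_unit (- int n) (- int y) # chain_list n"

lemma run_bin_le:
  assumes "2 * N \<le> B" "n \<le> N"
  shows "run 11 [unary n] (nat_tree n) (N * (N + 2))"
  using assms by (intro fn_mono[OF run_bin] mult_mono) auto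

lemma run_build:
  assumes "1 \<le> n" "1 \<le> x" "1 \<le> y" "size (cls_tree (build_list n x y)) \<le> B" "2 * n \<le> B"
    "size (nat_tree x) \<le> B" "size (nat_tree y) \<le> B"
  shows "run 13 [unary n, nat_tree x, nat_tree y] (cls_tree (build_list n x y))
    ((n + 2) * (2 * (n * (n + 2)) + 3))"
proof -
  have r1: "run 11 [unary n] (nat_tree n) (n * (n + 2))"
    using run_bin assms by simp
  have r2: "run 12 [unary n] (cls_tree (chain_list n)) (n * (2 * (n * (n + 2)) + 3))"
    using run_chain[of n] assms by (simp add: build_list_def)
  have *: "int_tree 1 = Node Leaf (Node truth Leaf)"
    "int_tree (int x) = Node Leaf (nat_tree x)" "int_tree (- int n) = Node truth (nat_tree n)"
    "int_tree (- int y) = Node truth (nat_tree y)"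
    using assms(1-3) by (auto simp: int_tree_def nat_tree_1 simp flip: One_nat_def)
  have **: "Node truth Leaf = nat_tree x \<longleftrightarrow> x = 1"
    by (metis nat_tree_1 nat_tree_eq_iff)
  have x: "1 = int x \<longleftrightarrow> x = 1" "nat_tree n = nat_tree y \<longleftrightarrow> n = y" by auto
  show ?thesis
  proof (cases "n = y")
    case True
    note r1 = r1[unfolded True] and r2 = r2[unfolded True] and * = *[unfolded True]
    show ?thesis
      using assms unfolding True
      by (intro runI; cases "x = 1")
        (auto simp: prog_nth build_body_def build_list_def pair_or_unit_def * ** x algebra_simps
          nat_tree_1[simplified]
          intro!: callI[OF r1] callI2[OF r1] callI2[OF r2])
  next
    case False
    then show ?thesis
      using assms
      by (intro runI; cases "x = 1")
        (auto simp: prog_nth build_body_def build_list_def pair_or_unit_def * ** x algebra_simps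
          nat_tree_1[simplified]
          intro!: callI[OF r1] callI2[OF r2])
  qed
qed

lemma run_solve_ordered:
  assumes "h1 \<le> length Fs" "h2 \<le> length Fs" "size (cls_tree Fs) \<le> B" "4 * length Fs + 2 \<le> B"
  shows "run 14 [cls_tree Fs, unary h1, unary h2]
    (Node (nat_tree (min h1 h2)) (nat_tree (length Fs - max h1 h2)))
    (2 * (length Fs * (length Fs + 2)) + 2 * length Fs + 4)"
proof -
  let ?N = "length Fs"
  have b: "run 11 [unary h] (nat_tree h) (?N * (?N + 2))" if "h \<le> ?N" for h
    using run_bin_le[of ?N h] that assms(4) by simp
  have d: "run 9 [unary h, cls_tree Fs] (list_tree (drop h (map ints_tree Fs))) ?N" if "h \<le> ?N" for h
    using fn_mono[OF run_drop[of h "map ints_tree Fs"]] that assms(3,4) by (simp add: cls_tree_def)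
  have db: "run 11 [list_tree (drop h (map ints_tree Fs))] (nat_tree (?N - h)) (?N * (?N + 2))"
    if "h \<le> ?N" for h
  proof -
    have "size (list_tree (drop h (map ints_tree Fs))) \<le> B"
      using fn_size[OF d[OF that]] .
    then have "run 11 [list_tree (drop h (map ints_tree Fs))] (nat_tree (?N - h))
      ((?N - h) * ((?N - h) + 2))"
      using run_bin_list[of "drop h (map ints_tree Fs)"] assms(4) by simp
    then show ?thesis by (rule fn_mono) (intro mult_mono; simp)
  qed
  have l: "run 8 [unary h1, unary h2] (if h1 \<le> h2 then truth else Leaf) h1"
    using run_le assms by simp
  have s: "size (nat_tree h1) + size (nat_tree (?N - h2)) < B"
    "size (nat_tree h2) + size (nat_tree (?N - h1)) < B"
    using size_nat_tree[of h1] size_nat_tree[of "?N - h2"] size_nat_tree[of h2]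
      size_nat_tree[of "?N - h1"] assms by simp_all
  show ?thesis
    using assms s
    by (intro runI; cases "h1 \<le> h2") (auto simp: prog_nth solve_ordered_body_def min_def max_def
      intro!: callI[OF l] callI[OF b] callI[OF d] callI[OF db] callI2[OF db])
qed

lemma neg_bounds:
  assumes "size (int_tree r) + 2 \<le> B"
  shows "size (int_tree (- r)) \<le> B" "size (nat_tree (nat \<bar>r\<bar>)) + 2 \<le> B"
  using assms by (auto simp: int_tree_def split: if_splits)

lemma run_solve_roots:
  assumes "hits (set ` set Fs) r1 (- r1) h1" "hits (set ` set Fs) r2 (- r2) h2"
    "two_lists Fs" "size (cls_tree Fs) + 2 \<le> B" "4 * length Fs + 2 \<le> B"
    "0 \<notin> \<Union> (set ` set Fs)" "size (int_tree r1) + 2 \<le> B" "size (int_tree r2) + 2 \<le> B"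
    "h1 \<le> length Fs" "h2 \<le> length Fs" "r1 \<noteq> 0" "r2 \<noteq> 0"
  shows "run 15 [cls_tree Fs, int_tree r1, int_tree r2]
    (Node (nat_tree (min h1 h2)) (nat_tree (length Fs - max h1 h2)))
    (4 * (length Fs * (length Fs + 2)) + 2 * length Fs + 7)"
proof -
  let ?N = "length Fs"
  have 1: "run 3 [cls_tree Fs, int_tree r1, int_tree (- r1)] (unary h1) (?N * (?N + 2))"
    using assms neg_bounds[of r1] by (intro fn_mono[OF run_dist] mult_right_mono) auto
  have 2: "run 3 [cls_tree Fs, int_tree r2, int_tree (- r2)] (unary h2) (?N * (?N + 2))"
    using assms neg_bounds[of r2] by (intro fn_mono[OF run_dist] mult_right_mono) auto
  have 3: "run 14 [cls_tree Fs, unary h1, unary h2]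
    (Node (nat_tree (min h1 h2)) (nat_tree (?N - max h1 h2)))
    (2 * (?N * (?N + 2)) + 2 * ?N + 4)"
    using assms by (intro run_solve_ordered) auto
  \<comment> \<open>Complementation is evaluated once for both roots by a case distinction on the
    sign; removing \<open>vc.simps(3)\<close> below makes the simplifier use this equation instead
    of unfolding the \<open>Join\<close> in \<open>neg_exp\<close>.\<close>
  have "vc (prog main) B [cls_tree Fs, int_tree r1, int_tree r2] (neg_exp (Arg i)) Q
      \<longleftrightarrow> Q (int_tree (- ([0, r1, r2] ! i))) 0" if "i = 1 \<or> i = 2" for i Q
    using that assms(11,12) neg_bounds[OF assms(7)] neg_bounds[OF assms(8)]
    by (cases "[0, r1, r2] ! i < 0") (auto simp: int_tree_uminus)
  then show ?thesis
    using assms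
    by (intro runI) (auto simp: prog_nth solve_roots_body_def simp del: vc.simps(3)
      intro!: callI[OF 1] callI[OF 2] callI2[OF 3])
qed

lemma run_solve:
  defines "L \<equiv> \<lambda>Fs. dups (concat (map (\<lambda>C. [hd C, last C]) Fs))"
  assumes Fs: "two_lists Fs" "2 * size (cls_tree Fs) + 4 \<le> B" "4 * length Fs + 2 \<le> B"
    "0 \<notin> \<Union> (set ` set Fs)" and
    L: "r1 = hd (L Fs)" "L Fs \<noteq> []" "r2 = other (L Fs) r1" "r1 \<noteq> r2" "r1 \<noteq> 0" "r2 \<noteq> 0"
    and h: "hits (set ` set Fs) r1 (- r1) h1" "hits (set ` set Fs) r2 (- r2) h2"
    "h1 \<le> length Fs" "h2 \<le> length Fs"
  shows "run (Suc 0) [cls_tree Fs] (Node (nat_tree (min h1 h2)) (nat_tree (length Fs - max h1 h2)))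
    (8 * (length Fs + 2) * (length Fs + 2))"
proof -
  let ?N = "length Fs" and ?O = "concat (map (\<lambda>C. [hd C, last C]) Fs)"
  have lO: "length ?O = 2 * ?N" by (induction Fs) auto
  have lL: "length (dups xs) \<le> length xs" for xs :: "int list" by (induction xs) auto
  have occ: "run 5 [cls_tree Fs] (ints_tree ?O) ?N" "size (ints_tree ?O) \<le> 2 * size (cls_tree Fs)"
    using run_occ[OF Fs(1)] Fs(2) by auto
  have dup: "run 6 [ints_tree ?O] (ints_tree (L Fs)) (2 * ?N * (2 * ?N + 2))"
    "size (ints_tree (L Fs)) \<le> size (ints_tree ?O)"
    using run_dups[of ?O] occ(2) Fs(2) lO by (auto simp: L_def)
  have r1: "r1 \<in> set (L Fs)" using L(1,2) by simp
  have ex: "\<exists>y\<in>set (L Fs). y \<noteq> r1"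
  proof (rule ccontr)
    assume "\<not> ?thesis"
    then have "other (L Fs) r1 = r1" by (intro other_same) blast
    then show False using L(3,4) by simp
  qed
  have r2: "r2 \<in> set (L Fs)" using other_mem[OF ex] L(3) by simp
  have s: "size (int_tree r1) + 2 \<le> B" "size (int_tree r2) + 2 \<le> B" "size (ints_tree (L Fs)) \<le> B"
    using size_int_tree_mem[OF r1] size_int_tree_mem[OF r2] dup(2) occ(2) Fs(2) by linarith+
  have oth: "run 7 [ints_tree (L Fs), int_tree r1] (int_tree r2) (2 * ?N)"
    using s lL[of ?O] lO unfolding L(3)
    by (intro fn_mono[OF run_other[OF ex]]) (auto simp: L_def)
  have left: "left (ints_tree (L Fs)) = int_tree r1"
    using L(1,2) by (cases "L Fs") auto
  have rt: "run 15 [cls_tree Fs, int_tree r1, int_tree r2]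
    (Node (nat_tree (min h1 h2)) (nat_tree (?N - max h1 h2)))
    (4 * (?N * (?N + 2)) + 2 * ?N + 7)"
    using assms s by (intro run_solve_roots) auto
  have lst: "run 16 [cls_tree Fs, ints_tree (L Fs)]
    (Node (nat_tree (min h1 h2)) (nat_tree (?N - max h1 h2)))
    (4 * (?N * (?N + 2)) + 4 * ?N + 9)"
    using s Fs by (intro runI) (auto simp: prog_nth solve_list_body_def left
      intro!: callI[OF oth] callI2[OF rt])
  show ?thesis
    using Fs by (intro runI) (auto simp: prog_nth solve_body_def algebra_simps
      intro!: callI[OF occ(1)] callI[OF dup(1)] callI2[OF lst])
qed

text \<open>The test y = n appears only under x = 1 because x + y <= n + 1 forces x = 1 when y = n.
  The branches correspond to two, one and no unit clauses, the last one split by x = y.\<close>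

definition params_list :: "nat \<Rightarrow> nat \<Rightarrow> nat \<Rightarrow> nat list" where
  "params_list n x y =
     (if x = 1 then (if y = n then [] else [y]) else if x = y then [x] else [x, y])"

lemma run_params:
  assumes "size (nat_tree x) + size (nat_tree y) + 4 \<le> B" "size (nat_tree n) \<le> B"
  shows "run 17 [nat_tree n, nat_tree x, nat_tree y] (list_tree (map nat_tree (params_list n x y))) 0"
proof -
  have **: "nat_tree x = Node truth Leaf \<longleftrightarrow> x = 1"
    by (metis nat_tree_1 nat_tree_eq_iff)
  show ?thesis
    using assms by (intro runI) (auto simp: prog_nth params_body_def params_list_def **)
qed

lemma run_insert:
  assumes "size (ints_tree e) + size (cls_tree Es) < B"
  shows "run 20 [ints_tree e, cls_tree Es] (cls_tree (List.insert e Es)) (length Es + 1)"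
proof -
  have *: "run 4 [ints_tree e, cls_tree Es] (if e \<in> set Es then truth else Leaf) (length Es)"
    using run_mem[of "map ints_tree Es" "ints_tree e"] assms
    by (auto simp: cls_tree_def image_iff)
  show ?thesis
  proof (cases "e \<in> set Es")
    case True
    with * have "run 4 [ints_tree e, cls_tree Es] truth (length Es)" by simp
    with True assms show ?thesis
      by (intro runI) (auto simp: prog_nth insert_body_def intro!: callI)
  next
    case False
    with * have "run 4 [ints_tree e, cls_tree Es] Leaf (length Es)" by simp
    with False assms show ?thesis
      by (intro runI) (auto simp: prog_nth insert_body_def intro!: callI2)
  qed
qed

lemma insert_bounds:
  "size (cls_tree (List.insert e Es)) \<le> size (ints_tree e) + size (cls_tree Es) + 1"
  "length (List.insert e Es) \<le> length Es + 1"
  by (auto simp: List.insert_def)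

lemma length_edge_list: "length (edge_list n) \<le> 2 * n"
  by (induction n rule: edge_list.induct) auto

text \<open>Each of the four closing edges starts with its positive end. Coinciding ones, such as
  the first two for x = 1, are then equal as lists, and \<open>List.insert\<close> merges
  them.\<close>

definition graph_edges :: "nat \<Rightarrow> nat \<Rightarrow> nat \<Rightarrow> int list list" where
  "graph_edges n x y = List.insert [int x, - 1] (List.insert [1, - int x]
     (List.insert [int n, - int y] (List.insert [int y, - int n] (edge_list n))))"

lemma run_graph:
  assumes "1 \<le> n" "1 \<le> x" "1 \<le> y" "x \<le> n" "y \<le> n"
    "size (ints_tree (vert_list n)) + size (cls_tree (edge_list n)) + 16 * n + 60 \<le> B"
  shows "run 21 [unary n, nat_tree x, nat_tree y]
    (Node (ints_tree (vert_list n)) (cls_tree (graph_edges n x y)))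
    ((n + 4) * (8 * (n * (n + 2)) + 20))"
proof -
  let ?e1 = "[int y, - int n]" and ?e2 = "[int n, - int y]"
  and ?e3 = "[1, - int x]" and ?e4 = "[int x, - 1]"
  let ?E1 = "List.insert ?e1 (edge_list n)" let ?E2 = "List.insert ?e2 ?E1"
  let ?E3 = "List.insert ?e3 ?E2" let ?E4 = "List.insert ?e4 ?E3"
  have it: "int_tree 1 = Node Leaf (Node truth Leaf)" "int_tree (- 1) = Node truth (Node truth Leaf)"
    "int_tree (int x) = Node Leaf (nat_tree x)" "int_tree (- int n) = Node truth (nat_tree n)"
    "int_tree (int y) = Node Leaf (nat_tree y)" "int_tree (- int y) = Node truth (nat_tree y)"
    "int_tree (int n) = Node Leaf (nat_tree n)" "int_tree (- int x) = Node truth (nat_tree x)"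
    using assms(1-3) by (auto simp: int_tree_def nat_tree_1 simp flip: One_nat_def)
  have s: "size (nat_tree x) \<le> 2 * n" "size (nat_tree y) \<le> 2 * n" "size (nat_tree n) \<le> 2 * n"
    using size_nat_tree[of x] size_nat_tree[of y] size_nat_tree[of n] assms(4,5) by linarith+
  have se: "size (ints_tree ?e1) \<le> 4 * n + 8" "size (ints_tree ?e2) \<le> 4 * n + 8"
    "size (ints_tree ?e3) \<le> 4 * n + 8" "size (ints_tree ?e4) \<le> 4 * n + 8"
    using s assms(1) by (auto simp: it)
  note b = insert_bounds[of ?e1 "edge_list n"] insert_bounds[of ?e2 ?E1] insert_bounds[of ?e3 ?E2]
    insert_bounds[of ?e4 ?E3] length_edge_list[of n]
  \<comment> \<open>Opaque names keep the simplifier from multiplying out the cost polynomials. In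
    \<open>cost\<close>, the summand 8 counts the calls in \<open>graph_body\<close>: one to each of
    18 and 19, two to 11 and four to 20.\<close>
  define c11 c18 c19 where c: "c11 = n * (n + 2)" "c18 = n * (2 * (n * (n + 2)) + 3)"
    "c19 = n * (4 * (n * (n + 2)) + 5)"
  have cost: "c18 + c19 + 2 * c11 + 4 * (2 * n + 4) + 8 \<le> (n + 4) * (8 * (n * (n + 2)) + 20)"
    by (simp add: c algebra_simps)
  have r11: "run 11 [unary n] (nat_tree n) c11"
    using run_bin assms unfolding c by simp
  have r18: "run 18 [unary n] (ints_tree (vert_list n)) c18"
    using run_verts[of n] assms unfolding c by simp
  have r19: "run 19 [unary n] (cls_tree (edge_list n)) c19"
    using run_edges[of n] assms unfolding c by simp
  \<comment> \<open>At most 2n edges come from the chain and at most three were inserted before, so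
    each insertion costs at most 2n + 3 + 1.\<close>
  have i: "run 20 [ints_tree ?e1, cls_tree (edge_list n)] (cls_tree ?E1) (2 * n + 4)"
    "run 20 [ints_tree ?e2, cls_tree ?E1] (cls_tree ?E2) (2 * n + 4)"
    "run 20 [ints_tree ?e3, cls_tree ?E2] (cls_tree ?E3) (2 * n + 4)"
    "run 20 [ints_tree ?e4, cls_tree ?E3] (cls_tree ?E4) (2 * n + 4)"
    using b se assms(6) by (intro fn_mono[OF run_insert]; linarith)+
  have sz: "size (ints_tree (vert_list n)) + size (cls_tree ?E4) < B"
    using b se assms(6) by linarith
  define T where "T = (n + 4) * (8 * (n * (n + 2)) + 20)"
  have Bn: "16 * n + 60 \<le> B" using assms(6) by simp
  have "run 21 [unary n, nat_tree x, nat_tree y]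
    (Node (ints_tree (vert_list n)) (cls_tree ?E4)) T"
    using Bn s sz cost[folded T_def]
    by (intro runI) (auto simp: prog_nth graph_body_def
      intro!: callI[OF r18] callI[OF r11] callI[OF r19] callI[OF i(1)[unfolded ints_tree_simps it]]
       callI[OF i(2)[unfolded ints_tree_simps it]] callI[OF i(3)[unfolded ints_tree_simps it]]
       callI[OF i(4)[unfolded ints_tree_simps it]] callI2[OF i(4)[unfolded ints_tree_simps it]])
  then show ?thesis unfolding graph_edges_def T_def .
qed

section \<open>Reading the parameters off a graph\<close>

lemma run_count:
  assumes "size (ints_tree V) \<le> B" "0 < B"
  shows "run 22 [ints_tree V] (unary (length (filter (\<lambda>x. \<not> x < 0) V))) (length V)"
  using assms
proof (induction V)
  case Nil
  then show ?case by (intro runI) (auto simp: prog_nth count_body_def)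
next
  case (Cons x V)
  have "length (filter (\<lambda>x. \<not> x < 0) V) \<le> size (ints_tree V)"
    using length_filter_le length_le_size_ints_tree order_trans by blast
  with Cons show ?case
    by (intro runI) (auto simp: prog_nth count_body_def intro!: callI2)
qed

lemma run_length:
  assumes "size (list_tree ws) \<le> B"
  shows "run 25 [list_tree ws] (unary (length ws)) (length ws) \<and> length ws \<le> size (list_tree ws)"
  using assms
proof (induction ws)
  case Nil
  then show ?case by (auto intro!: runI simp: prog_nth length_body_def)
next
  case (Cons w ws)
  then show ?case
    by (intro conjI runI) (auto simp: prog_nth length_body_def intro!: callI2)
qed

fun partner :: "int list list \<Rightarrow> int \<Rightarrow> int" where
  "partner [] x = x"
| "partner ((a # b # _) # Es) x =
    (if a = x then (if b < 0 \<longleftrightarrow> x < 0 then partner Es x else b)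
     else if b = x then (if a < 0 \<longleftrightarrow> x < 0 then partner Es x else a) else partner Es x)"
| "partner (_ # Es) x = partner Es x"

lemma partner_mem:
  assumes "\<forall>e\<in>set Es. \<exists>a b. e = [a, b]" "\<exists>e\<in>set Es. \<exists>b. set e = {x, b} \<and> \<not> (b < 0 \<longleftrightarrow> x < 0)"
  shows "{x, partner Es x} \<in> set ` set Es \<and> \<not> (partner Es x < 0 \<longleftrightarrow> x < 0)"
  using assms
proof (induction Es)
  case (Cons e Es)
  then obtain a b where "e = [a, b]" by auto
  with Cons show ?case by (auto simp: insert_commute doubleton_eq_iff)
qed simp

lemma run_partner:
  assumes "\<forall>e\<in>set Es. \<exists>a b. e = [a, b]" "\<exists>e\<in>set Es. \<exists>b. set e = {x, b} \<and> \<not> (b < 0 \<longleftrightarrow> x < 0)"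
    "size (cls_tree Es) \<le> B" "size (int_tree x) \<le> B"
  shows "run 23 [cls_tree Es, int_tree x] (nat_tree (nat \<bar>partner Es x\<bar>)) (length Es)"
  using assms
proof (induction Es)
  case (Cons e Es)
  then obtain a b where e: "e = [a, b]" by auto
  show ?case
    using Cons e by (intro runI)
     (auto simp: prog_nth partner_body_def doubleton_eq_iff intro!: callI2)
qed simp

lemma run_decode:
  assumes Es: "\<forall>e\<in>set Es. \<exists>a b. e = [a, b]"
    "\<exists>e\<in>set Es. \<exists>b. set e = {- 1, b} \<and> \<not> (b < 0)"
    "size (cls_tree Es) \<le> B" and
    n: "1 \<le> n" "1 \<le> y" "y \<noteq> 1 \<longrightarrow> partner Es (- 1) = int x" "y = 1 \<longrightarrow> x = 1" "1 \<le> x"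
    "size (cls_tree (build_list n x y)) \<le> B" "2 * n \<le> B"
    "size (nat_tree x) \<le> B" "size (nat_tree y) \<le> B" "4 \<le> B"
  shows "run 24 [unary n, cls_tree Es, nat_tree y] (cls_tree (build_list n x y))
    ((n + 2) * (2 * (n * (n + 2)) + 3) + length Es + 2)"
proof -
  have r13: "run 13 [unary n, nat_tree x, nat_tree y] (cls_tree (build_list n x y))
    ((n + 2) * (2 * (n * (n + 2)) + 3))"
    using run_build n by blast
  have it: "int_tree (- 1) = Node truth (Node truth Leaf)"
    by (auto simp: int_tree_def nat_tree_1 simp flip: One_nat_def)
  have r23: "run 23 [cls_tree Es, Node truth (Node truth Leaf)] (nat_tree x) (length Es)" if "y \<noteq> 1"
    using run_partner[of Es "- 1"] that Es n(3) \<open>4 \<le> B\<close> by (simp add: it)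
  have **: "nat_tree y = Node truth Leaf \<longleftrightarrow> y = 1" "Node truth Leaf = nat_tree 1"
    by (metis nat_tree_1 nat_tree_eq_iff, metis nat_tree_1)
  show ?thesis
  proof (cases "y = 1")
    case True
    then have r: "run 13 [unary n, Node truth Leaf, Node truth Leaf] (cls_tree (build_list n 1 1))
      ((n + 2) * (2 * (n * (n + 2)) + 3))" using r13 n(4) nat_tree_1 by simp
    show ?thesis
      using Es n True by (intro runI)
        (auto simp: prog_nth decode_body_def nat_tree_1 simp flip: One_nat_def intro!: callI2[OF r])
  next
    case False
    then show ?thesis
      using Es n by (intro runI)
        (auto simp: prog_nth decode_body_def **(1) intro!: callI[OF r23] callI2[OF r13])
  qed
qed

end


section \<open>Isomorphisms of clause-sets\<close>

lemma lits_altdef: "lits F = {x. x \<in> \<Union>F \<or> - x \<in> \<Union>F}"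
proof (intro set_eqI iffI)
  fix x assume "x \<in> lits F"
  then show "x \<in> {x. x \<in> \<Union>F \<or> - x \<in> \<Union>F}"
    by (auto simp: lits_def vars_def abs_if split: if_splits)
next
  fix x assume "x \<in> {x. x \<in> \<Union>F \<or> - x \<in> \<Union>F}"
  then have "\<bar>x\<bar> \<in> vars F" by (auto simp: vars_def image_iff) (metis abs_minus_cancel)
  then show "x \<in> lits F" by (cases "x \<ge> 0") (auto simp: lits_def image_iff intro!: bexI[of _ "- x"])
qed

lemma lits_uminus [simp]: "- x \<in> lits F \<longleftrightarrow> x \<in> lits F"
  by (auto simp: lits_altdef)

lemma lits_memI: "C \<in> F \<Longrightarrow> x \<in> C \<Longrightarrow> x \<in> lits F"
  by (auto simp: lits_altdef)

lemma clause_subset_lits: "C \<in> F \<Longrightarrow> C \<subseteq> lits F"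
  by (auto simp: lits_altdef)

lemma vars_altdef: "vars F = {x \<in> lits F. 0 \<le> x}"
proof (intro set_eqI iffI)
  fix x assume "x \<in> vars F"
  then show "x \<in> {x \<in> lits F. 0 \<le> x}" by (auto simp: vars_def lits_def)
next
  fix x assume "x \<in> {x \<in> lits F. 0 \<le> x}"
  then have "x = \<bar>x\<bar> \<and> x \<in> \<Union>F \<or> x = \<bar>- x\<bar> \<and> - x \<in> \<Union>F" by (auto simp: lits_altdef)
  then show "x \<in> vars F" unfolding vars_def by blast
qed

definition iso_by :: "(int \<Rightarrow> int) \<Rightarrow> clause_set \<Rightarrow> clause_set \<Rightarrow> bool" where
  "iso_by f F G \<longleftrightarrow> bij_betw f (lits F) (lits G) \<and> (\<forall>x\<in>lits F. f (- x) = - f x) \<and>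
     (\<lambda>C. f ` C) ` F = G"

lemma cls_iso_iff: "F \<cong> G \<longleftrightarrow> (\<exists>f. iso_by f F G)"
  by (simp add: cls_iso_def iso_by_def)

lemma iso_by_inv:
  assumes "iso_by f F G"
  shows "iso_by (inv_into (lits F) f) G F"
proof -
  let ?g = "inv_into (lits F) f"
  have f: "bij_betw f (lits F) (lits G)" "\<And>x. x \<in> lits F \<Longrightarrow> f (- x) = - f x"
    "(\<lambda>C. f ` C) ` F = G" using assms by (auto simp: iso_by_def)
  have inj: "inj_on f (lits F)" using f(1) by (rule bij_betw_imp_inj_on)
  have "?g (- y) = - ?g y" if "y \<in> lits G" for y
  proof -
    have "y \<in> f ` lits F" using that unfolding bij_betw_imp_surj_on[OF f(1)] .
    then obtain x where x: "x \<in> lits F" "y = f x" by blast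
    have "- y = f (- x)" using f(2) x by simp
    then show ?thesis using x inj by simp
  qed
  moreover have "(\<lambda>C. ?g ` C) ` G = F"
  proof -
    have "?g ` (f ` C) = C" if "C \<in> F" for C
      using clause_subset_lits[OF that] inj by (simp add: inv_into_image_cancel)
    then show ?thesis unfolding f(3)[symmetric] by (simp add: image_image)
  qed
  ultimately show ?thesis using bij_betw_inv_into[OF f(1)] by (simp add: iso_by_def)
qed

lemma iso_by_comp:
  assumes "iso_by f F G" "iso_by g G H"
  shows "iso_by (g \<circ> f) F H"
  using assms by (auto simp: iso_by_def image_comp bij_betw_trans bij_betw_apply intro: bij_betw_trans)

lemma cls_iso_sym: "F \<cong> G \<Longrightarrow> G \<cong> F"
  using iso_by_inv by (auto simp: cls_iso_iff)

lemma cls_iso_trans: "F \<cong> G \<Longrightarrow> G \<cong> H \<Longrightarrow> F \<cong> H"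
  using iso_by_comp unfolding cls_iso_iff by blast

context
  fixes f F G
  assumes iso: "iso_by f F G"
begin

lemma iso_inj: "inj_on f (lits F)"
  using iso by (auto simp: iso_by_def bij_betw_def)

lemma iso_mem: "x \<in> lits F \<Longrightarrow> f x \<in> lits G"
  using iso by (auto simp: iso_by_def bij_betw_def)

lemma iso_uminus: "x \<in> lits F \<Longrightarrow> f (- x) = - f x"
  using iso by (auto simp: iso_by_def)

lemma iso_image: "(\<lambda>C. f ` C) ` F = G"
  using iso by (auto simp: iso_by_def)

lemma iso_card_clause: "C \<in> F \<Longrightarrow> card (f ` C) = card C"
  using clause_subset_lits[of C F] inj_on_subset[OF iso_inj] by (intro card_image) auto

lemma iso_inj_clauses: "inj_on (\<lambda>C. f ` C) F"
  using clause_subset_lits iso_inj by (auto simp: inj_on_def inj_on_image_eq_iff)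

lemma iso_mem_clause: "C \<in> F \<Longrightarrow> x \<in> lits F \<Longrightarrow> f x \<in> f ` C \<longleftrightarrow> x \<in> C"
  using inj_on_image_mem_iff[OF iso_inj _ clause_subset_lits] by blast

lemma iso_card: "card G = card F"
  unfolding iso_image[symmetric] by (rule card_image[OF iso_inj_clauses])

lemma iso_nunits: "nunits G = nunits F"
proof -
  have "{C \<in> G. card C = 1} = (\<lambda>C. f ` C) ` {C \<in> F. card C = 1}"
    unfolding iso_image[symmetric] using iso_card_clause by auto
  moreover have "inj_on (\<lambda>C. f ` C) {C \<in> F. card C = 1}"
    using iso_inj_clauses by (rule inj_on_subset) auto
  ultimately show ?thesis unfolding nunits_def by (simp only: card_image)
qed

lemma iso_var_occ:
  assumes "v \<in> lits F"
  shows "var_occ G (f v) = var_occ F v"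
proof -
  have "{C \<in> G. f v \<in> C \<or> - f v \<in> C} = (\<lambda>C. f ` C) ` {C \<in> F. v \<in> C \<or> - v \<in> C}"
    unfolding iso_image[symmetric] iso_uminus[OF assms, symmetric]
    using iso_mem_clause[of _ v] iso_mem_clause[of _ "- v"] assms by auto
  moreover have "inj_on (\<lambda>C. f ` C) {C \<in> F. v \<in> C \<or> - v \<in> C}"
    using iso_inj_clauses by (rule inj_on_subset) auto
  ultimately show ?thesis unfolding var_occ_def by (simp only: card_image)
qed

lemma iso_var_occ_ex:
  assumes "\<exists>v\<in>vars F. var_occ F v = k"
  shows "\<exists>v\<in>vars G. var_occ G v = k"
proof -
  obtain v where v: "v \<in> vars F" "var_occ F v = k" using assms by auto
  then have l: "v \<in> lits F" by (auto simp: vars_altdef)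
  \<comment> \<open>An isomorphism may send a variable to a negative literal; the number of
    occurrences does not depend on the sign.\<close>
  have "var_occ G \<bar>f v\<bar> = var_occ G (f v)"
    by (cases "f v \<ge> 0") (auto simp: var_occ_def intro: arg_cong[where f = card])
  moreover have "\<bar>f v\<bar> \<in> vars G"
    using iso_mem[OF l] by (auto simp: vars_altdef abs_if)
  ultimately show ?thesis using iso_var_occ[OF l] v(2) by auto
qed

text \<open>An assignment is pulled back along f. The literal 0 is excluded because it equals its
  own complement, so \<open>lit_true\<close> cannot change under negation there.\<close>

lemma iso_satisfiable:
  assumes "satisfiable G" "0 \<notin> lits G"
  shows "satisfiable F"
proof -
  obtain \<phi> where \<phi>: "\<And>C. C \<in> G \<Longrightarrow> \<exists>x\<in>C. lit_true \<phi> x"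
    using assms(1) by (auto simp: satisfiable_def)
  define \<psi> where "\<psi> v = lit_true \<phi> (f v)" for v
  have "lit_true \<psi> x \<longleftrightarrow> lit_true \<phi> (f x)" if "x \<in> lits F" for x
  proof -
    have "f x \<noteq> 0" using iso_mem[OF that] assms(2) by metis
    then show ?thesis using iso_uminus[OF that] by (auto simp: \<psi>_def lit_true_def)
  qed
  moreover have "\<exists>x\<in>C. lit_true \<phi> (f x)" if "C \<in> F" for C
    using \<phi>[of "f ` C"] that unfolding iso_image[symmetric] by auto
  ultimately have "\<exists>x\<in>C. lit_true \<psi> x" if "C \<in> F" for C
    using that lits_memI by blast
  then show ?thesis by (auto simp: satisfiable_def)
qed

lemma step_lits: "step F a b \<Longrightarrow> a \<in> lits F \<and> b \<in> lits F"
  using lits_memI[of "{- a, b}" F "- a"] lits_memI[of "{- a, b}" F b] by (simp add: step_def)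

lemma iso_step:
  assumes "step F a b"
  shows "step G (f a) (f b)"
proof -
  have "f ` {- a, b} = {- f a, f b}"
    using step_lits[OF assms] iso_uminus[of a] by simp
  moreover have "f ` {- a, b} \<in> G"
    using assms unfolding iso_image[symmetric] by (auto simp only: step_def)
  ultimately show ?thesis by (simp add: step_def)
qed

text \<open>Steps have to be lifted back as well, because \<open>hits\<close> quantifies over all
  successors in the image.\<close>

lemma iso_step_conv:
  assumes "step G (f a) c" "a \<in> lits F"
  shows "\<exists>b. step F a b \<and> c = f b"
proof -
  obtain C where C: "C \<in> F" "{- f a, c} = f ` C"
    using assms unfolding iso_image[symmetric] by (auto simp: step_def)
  then obtain b where b: "b \<in> C" "c = f b" by auto
  have "b \<in> lits F" using C(1) b(1) lits_memI by blast
  then have "f ` {- a, b} = f ` C" "{- a, b} \<subseteq> lits F"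
    using C b assms iso_uminus by auto
  then have "{- a, b} = C"
    using inj_on_image_eq_iff[OF iso_inj] clause_subset_lits[OF C(1)] by blast
  then show ?thesis using b C(1) by (auto simp: step_def)
qed

lemma iso_hits:
  "hits F r a k \<Longrightarrow> a \<in> lits F \<Longrightarrow> r \<in> lits F \<Longrightarrow> hits G (f r) (f a) k"
proof (induction k arbitrary: a)
  case (Suc k)
  have "f a \<noteq> f r" using Suc.prems iso_inj by (auto simp: inj_on_def)
  moreover have "\<exists>c. step G (f a) c" using Suc.prems iso_step by auto
  moreover have "hits G (f r) c k" if "step G (f a) c" for c
  proof -
    from iso_step_conv[OF that Suc.prems(2)] obtain b where b: "step F a b" "c = f b" by auto
    then show ?thesis using Suc step_lits[OF b(1)] by auto
  qed
  ultimately show ?case by simp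
qed simp

lemma root_lits: "root F r \<Longrightarrow> r \<in> lits F"
  using step_lits by (fastforce simp: root_def)

lemma iso_root:
  assumes "root F r"
  shows "root G (f r)"
proof -
  have r: "- r \<in> lits F" using root_lits[OF assms] by simp
  have u: "f (- r) = - f r" using iso_uminus r by simp
  show ?thesis
    using assms unfolding root_def
  proof (elim disjE exE conjE)
    assume "step F (- r) r"
    then show "step G (- f r) (f r) \<or> (\<exists>b c. b \<noteq> c \<and> step G (- f r) b \<and> step G (- f r) c)"
      using iso_step u by metis
  next
    fix b c assume bc: "b \<noteq> c" "step F (- r) b" "step F (- r) c"
    then have "f b \<noteq> f c" using iso_inj step_lits by (metis inj_onD)
    then show "step G (- f r) (f r) \<or> (\<exists>b c. b \<noteq> c \<and> step G (- f r) b \<and> step G (- f r) c)"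
      using bc iso_step u by metis
  qed
qed

end

text \<open>The walk has not met r before arrival, and a successor always exists, so two lengths can
  be compared along one common walk.\<close>

lemma hits_unique: "hits F r a k \<Longrightarrow> hits F r a k' \<Longrightarrow> k = k'"
proof (induction k arbitrary: a k')
  case (Suc k)
  then show ?case by (cases k') auto
next
  case 0
  then show ?case by (cases k') auto
qed

section \<open>The canonical clause-sets\<close>

text \<open>With x = 1 or y = n the clauses collapse to units, so U0' covers all four families.\<close>

lemma U2_eq: "U2 n = U0' n 1 n" and U1_eq: "U1 n i = U0' n 1 i" and U0_eq: "U0 n i = U0' n i i"
  by (auto simp: U2_def U1_def U0_def U0'_def)

context
  fixes n x y :: nat
  assumes xy: "1 \<le> x" "x \<le> n" "1 \<le> y" "y \<le> n"
begin

lemma lits_U: "lits (U0' n x y) = {z. z \<noteq> 0 \<and> \<bar>z\<bar> \<le> int n}"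
proof (intro set_eqI iffI)
  fix z assume "z \<in> lits (U0' n x y)"
  then show "z \<in> {z. z \<noteq> 0 \<and> \<bar>z\<bar> \<le> int n}"
    using xy by (auto simp: lits_altdef U0'_def chain_clauses_def)
next
  fix z assume z: "z \<in> {z. z \<noteq> 0 \<and> \<bar>z\<bar> \<le> int n}"
  define j where "j = nat \<bar>z\<bar>"
  have j: "1 \<le> j" "j \<le> n" "z = int j \<or> z = - int j" using z by (auto simp: j_def)
  have "int j \<in> \<Union> (U0' n x y)"
  proof (cases "j = 1")
    case False
    then have "{- int (j - 1), int (j - 1 + 1)} \<in> chain_clauses n"
      unfolding chain_clauses_def using j(1,2) by (intro CollectI exI[of _ "j - 1"]) auto
    then show ?thesis using j(1) by (force simp: U0'_def)
  qed (auto simp: U0'_def)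
  then show "z \<in> lits (U0' n x y)" using j(3) by (auto simp: lits_altdef)
qed

lemma vars_U: "vars (U0' n x y) = {1..int n}"
  by (auto simp: vars_altdef lits_U)

lemma step_U_pos:
  assumes "1 \<le> j" "j \<le> n"
  shows "step (U0' n x y) (int j) b \<longleftrightarrow>
    j < n \<and> b = int j + 1 \<or> j = n \<and> b = - int y \<or> j = y \<and> b = - int n"
proof -
  have "step (U0' n x y) (int j) b \<longleftrightarrow>
    (\<exists>i. 1 \<le> i \<and> i < n \<and> {- int j, b} = {- int i, int i + 1}) \<or>
    {- int j, b} = {1, int x} \<or> {- int j, b} = {- int n, - int y}"
    by (auto simp: step_def U0'_def chain_clauses_def ac_simps)
  then show ?thesis
    using assms xy by (auto simp: doubleton_eq_iff)
qed

lemma step_U_neg: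
  assumes "1 \<le> j" "j \<le> n"
  shows "step (U0' n x y) (- int j) b \<longleftrightarrow>
    1 < j \<and> b = 1 - int j \<or> j = 1 \<and> b = int x \<or> j = x \<and> b = 1"
proof -
  have "step (U0' n x y) (- int j) b \<longleftrightarrow>
    (\<exists>i. 1 \<le> i \<and> i < n \<and> {int j, b} = {- int i, int i + 1}) \<or>
    {int j, b} = {1, int x} \<or> {int j, b} = {- int n, - int y}"
    by (auto simp: step_def U0'_def chain_clauses_def ac_simps)
  moreover have "(\<exists>i. 1 \<le> i \<and> i < n \<and> {int j, b} = {- int i, int i + 1}) \<longleftrightarrow> 1 < j \<and> b = 1 - int j"
    using assms by (auto simp: doubleton_eq_iff intro!: exI[of _ "j - 1"])
  ultimately show ?thesis
    using assms xy by (auto simp: doubleton_eq_iff)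
qed

lemma root_U: "root (U0' n x y) r \<longleftrightarrow> r = int x \<or> r = - int y"
proof
  assume r: "root (U0' n x y) r"
  \<comment> \<open>\<open>root_lits\<close> was stated relative to an isomorphism; the identity is
    supplied for it.\<close>
  obtain f where "iso_by f (U0' n x y) (U0' n x y)"
    using that[of id] by (simp add: iso_by_def)
  then have "r \<in> lits (U0' n x y)" using root_lits r by blast
  then obtain j where j: "1 \<le> j" "j \<le> n" "r = int j \<or> r = - int j"
    unfolding lits_U by (intro that[of "nat \<bar>r\<bar>"]) auto
  then show "r = int x \<or> r = - int y"
    using r step_U_neg[OF j(1,2)] step_U_pos[OF j(1,2)] by (auto simp: root_def)
next
  have "root (U0' n x y) (int x)"
  proof (cases "x = 1")
    case True
    then show ?thesis using step_U_neg[OF xy(1,2)] by (simp add: root_def)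
  next
    case False
    then have "step (U0' n x y) (- int x) 1" "step (U0' n x y) (- int x) (1 - int x)"
      using step_U_neg[OF xy(1,2)] xy by auto
    moreover have "1 \<noteq> 1 - int x" using xy by simp
    ultimately show ?thesis unfolding root_def by blast
  qed
  moreover have "root (U0' n x y) (- int y)"
  proof (cases "y = n")
    case True
    then show ?thesis using step_U_pos[OF xy(3,4)] by (simp add: root_def)
  next
    case False
    then have "step (U0' n x y) (- (- int y)) (int y + 1)" "step (U0' n x y) (- (- int y)) (- int n)"
      using step_U_pos[OF xy(3,4)] xy by auto
    moreover have "int y + 1 \<noteq> - int n" using xy by simp
    ultimately show ?thesis unfolding root_def by blast
  qed
  moreover assume "r = int x \<or> r = - int y"
  ultimately show "root (U0' n x y) r" by blast
qed

text \<open>From -x there are at most two ways. One goes to 1 and up the chain 1, 2, ..., x, taking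
  1 + (x - 1) steps. The other, present for x > 1, goes down -(x - 1), ..., -1 and then to x, taking
  (x - 1) + 1 steps. The hypothesis x <= y ensures that no j < x has a successor other than j +
  1.\<close>

lemma hits_U:
  assumes "x \<le> y"
  shows "hits (U0' n x y) (int x) (- int x) x"
proof -
  have pos: "hits (U0' n x y) (int x) (int x - int k) k" if "k < x" for k
    using that
  proof (induction k)
    case (Suc k)
    have j: "int x - int (Suc k) = int (x - Suc k)" using Suc.prems by simp
    have "step (U0' n x y) (int x - int (Suc k)) b \<longleftrightarrow> b = int x - int k" for b
      unfolding j using Suc.prems xy assms step_U_pos[of "x - Suc k"] by auto
    then have "step (U0' n x y) (int x - int (Suc k)) = (\<lambda>b. b = int x - int k)" by blast
    then show ?case unfolding hits.simps using Suc by simp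
  qed simp
  have neg: "hits (U0' n x y) (int x) (- int j) j" if "1 \<le> j" "j < x" for j
    using that
  proof (induction j)
    case (Suc j)
    have "step (U0' n x y) (- int (Suc j)) b \<longleftrightarrow> b = (if j = 0 then int x else - int j)" for b
      using Suc.prems xy step_U_neg[of "Suc j"] by auto
    then show ?case using Suc by (cases "j = 0") auto
  qed simp
  obtain k where k: "x = Suc k" using xy by (cases x) auto
  have "step (U0' n x y) (- int x) b \<longleftrightarrow> b = 1 \<or> (1 < x \<and> b = - int k)" for b
    using xy step_U_neg[of x] k by auto
  then show ?thesis
    using pos[of k] neg[of k] k by auto
qed

end

text \<open>The map sends j to -(n + 1 - j), which reads the chain backwards by contraposition:
  clause j of the chain goes to clause n - j, and the two closing clauses change places.\<close>

lemma iso_U_reverse: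
  assumes xy: "1 \<le> x" "x \<le> n" "1 \<le> y" "y \<le> n"
  shows "iso_by (\<lambda>z. if z > 0 then z - (int n + 1) else z + (int n + 1))
    (U0' n x y) (U0' n (n + 1 - y) (n + 1 - x))"
proof -
  let ?f = "\<lambda>z. if z > 0 then z - (int n + 1) else z + (int n + 1)"
  have l: "lits (U0' n (n + 1 - y) (n + 1 - x)) = {z. z \<noteq> 0 \<and> \<bar>z\<bar> \<le> int n}"
    using xy by (intro lits_U) auto
  have "bij_betw ?f {z. z \<noteq> 0 \<and> \<bar>z\<bar> \<le> int n} {z. z \<noteq> 0 \<and> \<bar>z\<bar> \<le> int n}"
    by (rule bij_betw_byWitness[of _ ?f]) auto
  moreover have "(\<lambda>C. ?f ` C) ` chain_clauses n = chain_clauses n"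
  proof (intro set_eqI iffI)
    fix C assume "C \<in> (\<lambda>C. ?f ` C) ` chain_clauses n"
    then obtain j where j: "1 \<le> j" "j < n" "C = ?f ` {- int j, int (j + 1)}"
      by (auto simp: chain_clauses_def)
    then have "C = {- int (n - j), int (n - j + 1)}" by (auto simp: of_nat_diff)
    then show "C \<in> chain_clauses n"
      unfolding chain_clauses_def using j by (intro CollectI exI[of _ "n - j"]) auto
  next
    fix C assume "C \<in> chain_clauses n"
    then obtain j where j: "1 \<le> j" "j < n" "C = {- int j, int (j + 1)}"
      by (auto simp: chain_clauses_def)
    then have "C = ?f ` {- int (n - j), int (n - j + 1)}" by (auto simp: of_nat_diff)
    moreover have "{- int (n - j), int (n - j + 1)} \<in> chain_clauses n"
      unfolding chain_clauses_def using j by (intro CollectI exI[of _ "n - j"]) auto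
    ultimately show "C \<in> (\<lambda>C. ?f ` C) ` chain_clauses n" by (rule image_eqI)
  qed
  moreover have e: "?f ` {1, int x} = {- int n, - int (n + 1 - x)}"
    "?f ` {- int n, - int y} = {1, int (n + 1 - y)}"
    using xy by (auto simp: of_nat_diff)
  moreover have "(\<lambda>C. ?f ` C) ` {{1, int x}, {- int n, - int y}} =
      {{1, int (n + 1 - y)}, {- int n, - int (n + 1 - x)}}"
    unfolding image_insert[of _ _ "{{- int n, - int y}}"] image_insert[of _ _ "{}::int set set"] e
    by (simp add: insert_commute)
  ultimately have "(\<lambda>C. ?f ` C) ` U0' n x y = U0' n (n + 1 - y) (n + 1 - x)"
    "bij_betw ?f {z. z \<noteq> 0 \<and> \<bar>z\<bar> \<le> int n} {z. z \<noteq> 0 \<and> \<bar>z\<bar> \<le> int n}"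
    unfolding U0'_def image_Un by simp_all
  then show ?thesis
    unfolding iso_by_def l lits_U[OF xy] by simp
qed

text \<open>Reversal turns the root -y into the root n + 1 - y of the first kind, and x <= y into
  the inequality that \<open>hits_U\<close> requires.\<close>

lemma hits_U':
  assumes xy: "1 \<le> x" "x \<le> y" "y \<le> n"
  shows "hits (U0' n x y) (- int y) (int y) (n + 1 - y)"
proof -
  have r: "1 \<le> n + 1 - y" "n + 1 - y \<le> n + 1 - x" "n + 1 - x \<le> n" using xy by auto
  have h: "hits (U0' n (n + 1 - y) (n + 1 - x)) (int (n + 1 - y)) (- int (n + 1 - y)) (n + 1 - y)"
    using r by (intro hits_U) auto
  have i: "iso_by (\<lambda>z. if z > 0 then z - (int n + 1) else z + (int n + 1))
    (U0' n (n + 1 - y) (n + 1 - x)) (U0' n x y)"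
    using iso_U_reverse[of "n + 1 - y" n "n + 1 - x"] xy by simp
  have m: "int (n + 1 - y) \<in> lits (U0' n (n + 1 - y) (n + 1 - x))"
    using r by (subst lits_U) auto
  have "- int (n + 1 - y) \<in> lits (U0' n (n + 1 - y) (n + 1 - x))" using m by (simp only: lits_uminus)
  from iso_hits[OF i h this m] xy show ?thesis by (simp add: of_nat_diff)
qed

section \<open>The walk lengths at the roots as an invariant\<close>

definition heights :: "clause_set \<Rightarrow> nat set" where
  "heights F = {k. \<exists>r. root F r \<and> hits F r (- r) k}"

lemma heights_U:
  assumes "1 \<le> x" "x \<le> y" "y \<le> n"
  shows "heights (U0' n x y) = {x, n + 1 - y}"
proof -
  have r: "root (U0' n x y) r \<longleftrightarrow> r = int x \<or> r = - int y" for r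
    using assms by (intro root_U) auto
  have "hits (U0' n x y) (int x) (- int x) k \<longleftrightarrow> k = x" for k
    using hits_U[of x n y] assms hits_unique[of _ "int x" "- int x"] by auto
  moreover have "hits (U0' n x y) (- int y) (- (- int y)) k \<longleftrightarrow> k = n + 1 - y" for k
    using hits_U'[OF assms] hits_unique[of _ "- int y" "int y"] by auto
  ultimately show ?thesis unfolding heights_def r by blast
qed

lemma heights_iso:
  assumes "F \<cong> G"
  shows "heights F = heights G"
proof -
  have sub: "heights F \<subseteq> heights G" if "iso_by f F G" for f F G
  proof
    fix k assume "k \<in> heights F"
    then obtain r where r: "root F r" "hits F r (- r) k" by (auto simp: heights_def)
    have l: "r \<in> lits F" using root_lits[OF that r(1)] .
    have "hits G (f r) (- f r) k"
      using iso_hits[OF that r(2)] l iso_uminus[OF that l] by simp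
    then show "k \<in> heights G" using iso_root[OF that r(1)] by (auto simp: heights_def)
  qed
  from assms obtain f where "iso_by f F G" by (auto simp: cls_iso_iff)
  then show ?thesis using sub iso_by_inv by blast
qed

text \<open>Reversal maps (x, y) to (n + 1 - y, n + 1 - x) and so reflects x + y at n + 1; the last
  condition selects one representative from each pair of reversals.\<close>

definition canonical_params :: "nat \<Rightarrow> nat \<Rightarrow> nat \<Rightarrow> bool" where
  "canonical_params n x y \<longleftrightarrow> 1 \<le> x \<and> x \<le> y \<and> y \<le> n \<and> x + y \<le> n + 1"

text \<open>The heights come without labels, so only the set {x, n + 1 - y} is preserved. Canonical
  parameters satisfy x <= n + 1 - y, hence x is its minimum and y is determined by its
  maximum.\<close>

lemma U_params_unique:
  assumes "F \<cong> U0' n x y" "F \<cong> U0' n x' y'" "canonical_params n x y" "canonical_params n x' y'"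
  shows "x = x' \<and> y = y'"
proof -
  have "U0' n x y \<cong> U0' n x' y'" using assms cls_iso_sym cls_iso_trans by blast
  then have "{x, n + 1 - y} = {x', n + 1 - y'}"
    using heights_iso[of "U0' n x y" "U0' n x' y'"] heights_U[of x y n] heights_U[of x' y' n] assms(3,4)
    by (simp add: canonical_params_def)
  then show ?thesis using assms(3,4) unfolding canonical_params_def doubleton_eq_iff by arith
qed


section \<open>Eliminating a singular variable\<close>

definition set_lit :: "(int \<Rightarrow> bool) \<Rightarrow> int \<Rightarrow> int \<Rightarrow> bool" where
  "set_lit \<phi> l = \<phi>(\<bar>l\<bar> := l > 0)"

lemma lit_true_uminus: "x \<noteq> 0 \<Longrightarrow> lit_true \<phi> (- x) \<longleftrightarrow> \<not> lit_true \<phi> x"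
  by (auto simp: lit_true_def)

lemma lit_true_set_lit:
  "x \<noteq> 0 \<Longrightarrow> l \<noteq> 0 \<Longrightarrow> lit_true (set_lit \<phi> l) x \<longleftrightarrow> x = l \<or> x \<noteq> - l \<and> lit_true \<phi> x"
  by (auto simp: lit_true_def set_lit_def)

lemma mu2_def1D:
  assumes "F \<in> mu2_def1"
  shows "finite F" "\<And>C. C \<in> F \<Longrightarrow> finite C" "\<And>C. C \<in> F \<Longrightarrow> 0 \<notin> C"
    "\<And>C x. C \<in> F \<Longrightarrow> x \<in> C \<Longrightarrow> - x \<notin> C" "\<And>C. C \<in> F \<Longrightarrow> card C \<le> 2"
    "\<And>C. C \<in> F \<Longrightarrow> C \<noteq> {}" "\<not> satisfiable F" "\<And>C. C \<in> F \<Longrightarrow> satisfiable (F - {C})"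
    "card F = nvars F + 1"
  using assms by (auto simp: mu2_def1_def two_cnf_def is_clause_set_def is_clause_def
      min_unsat_def deficiency_def)

text \<open>Otherwise take an assignment satisfying F without C and make l true: this satisfies C
  and can spoil no other clause, so F would be satisfiable.\<close>

lemma mu_complement_occurs:
  assumes "F \<in> mu2_def1" "C \<in> F" "l \<in> C"
  shows "\<exists>D\<in>F. - l \<in> D"
proof (rule ccontr)
  assume no: "\<not> ?thesis"
  note F = mu2_def1D[OF assms(1)]
  have l: "l \<noteq> 0" using F(3) assms by blast
  obtain \<phi> where \<phi>: "\<And>E. E \<in> F - {C} \<Longrightarrow> \<exists>x\<in>E. lit_true \<phi> x"
    using F(8)[OF assms(2)] by (auto simp: satisfiable_def)
  have "\<exists>x\<in>E. lit_true (set_lit \<phi> l) x" if "E \<in> F" for E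
  proof (cases "l \<in> E")
    case True
    then show ?thesis using l by (auto simp: lit_true_set_lit intro!: bexI[of _ l])
  next
    case False
    then have "E \<in> F - {C}" using that assms(3) by auto
    from \<phi>[OF this] obtain x where "x \<in> E" "lit_true \<phi> x" by auto
    moreover have "x \<noteq> 0" "x \<noteq> - l" using F(3)[OF that] no that \<open>x \<in> E\<close> by auto
    ultimately show ?thesis using l by (auto simp: lit_true_set_lit intro!: bexI[of _ x])
  qed
  then have "satisfiable F" unfolding satisfiable_def by blast
  then show False using F(7) by simp
qed

context
  fixes F C D v
  assumes mu: "F \<in> mu2_def1" and n2: "2 \<le> nvars F"
    and C: "C \<in> F" "v \<in> C" "\<And>E. E \<in> F \<Longrightarrow> v \<in> E \<Longrightarrow> E = C"
    and D: "D \<in> F" "- v \<in> D" "\<And>E. E \<in> F \<Longrightarrow> - v \<in> E \<Longrightarrow> E = D"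
begin

private abbreviation "R \<equiv> (C - {v}) \<union> (D - {- v})"
private abbreviation "F' \<equiv> insert R (F - {C, D})"

private lemmas F = mu2_def1D[OF mu]

private lemma v: "v \<noteq> 0" "- v \<notin> C" "v \<notin> D" "C \<noteq> D"
proof -
  show "v \<noteq> 0" using F(3)[OF C(1)] C(2) by blast
  show "- v \<notin> C" using F(4)[OF C(1,2)] .
  show "v \<notin> D" using F(4)[OF D(1,2)] by simp
  then show "C \<noteq> D" using C(2) by blast
qed

private lemma not_v: "E \<in> F - {C, D} \<Longrightarrow> v \<notin> E \<and> - v \<notin> E"
  using C(3) D(3) by auto

text \<open>If a literal x of R were true, then x satisfies one of C and D, and v can be chosen to
  satisfy the other; no remaining clause contains this variable, so F would be satisfiable.
  Unsatisfiability of F' and the absence of complementary pairs in R both follow.\<close>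

private lemma resolvent_true:
  assumes "\<And>E. E \<in> F - {C, D} \<Longrightarrow> \<exists>x\<in>E. lit_true \<phi> x" "x \<in> R"
  shows "\<not> lit_true \<phi> x"
proof
  assume x: "lit_true \<phi> x"
  define l where "l = (if x \<in> C - {v} then - v else v)"
  have l: "l \<noteq> 0" using v(1) by (simp add: l_def)
  have x0: "x \<noteq> 0" "x \<noteq> v" "x \<noteq> - v" using assms(2) F(3)[OF C(1)] F(3)[OF D(1)] v(2,3) by blast+
  have t: "lit_true (set_lit \<phi> l) x" "lit_true (set_lit \<phi> l) l"
    using lit_true_set_lit[OF x0(1) l] lit_true_set_lit[OF l l] x x0 by (auto simp: l_def)
  have "\<exists>x\<in>E. lit_true (set_lit \<phi> l) x" if E: "E \<in> F" for E
  proof -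
    consider "E = C" | "E = D" | "E \<in> F - {C, D}" using E by auto
    then show ?thesis
    proof cases
      case 1
      then show ?thesis using t C(2) by (cases "x \<in> C - {v}") (auto simp: l_def)
    next
      case 2
      then show ?thesis using t D(2) assms(2) by (cases "x \<in> C - {v}") (auto simp: l_def)
    next
      case 3
      then obtain z where z: "z \<in> E" "lit_true \<phi> z" using assms(1) by auto
      moreover have "z \<noteq> 0" "z \<noteq> - l" using z(1) not_v[OF 3] F(3)[OF E] by (auto simp: l_def)
      ultimately show ?thesis using lit_true_set_lit[OF _ l] by auto
    qed
  qed
  then have "satisfiable F" unfolding satisfiable_def by blast
  then show False using F(7) by simp
qed

private lemma sat_rest: "\<exists>\<phi>. \<forall>E\<in>F - {C, D}. \<exists>x\<in>E. lit_true \<phi> x"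
  using F(8)[OF C(1)] unfolding satisfiable_def by blast

private lemma unsat': "\<not> satisfiable F'"
proof
  assume "satisfiable F'"
  then obtain \<phi> where \<phi>: "\<And>E. E \<in> F' \<Longrightarrow> \<exists>x\<in>E. lit_true \<phi> x" unfolding satisfiable_def by blast
  then show False using resolvent_true[of \<phi>] \<phi>[of R] by blast
qed

text \<open>If R were already present, F' would be a subset of F without C and hence satisfiable.
  This is what makes the clause count drop by exactly one.\<close>

lemma resolvent_new: "R \<notin> F - {C, D}"
proof
  assume "R \<in> F - {C, D}"
  then have "F' = F - {C, D}" by auto
  then have "satisfiable F'" using sat_rest by (simp add: satisfiable_def)
  then show False using unsat' by simp
qed

text \<open>R is empty only for C = {v} and D = {- v}. These two clauses are already unsatisfiable,
  so minimality leaves no others, and F would have a single variable.\<close>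

lemma resolvent_nonempty: "R \<noteq> {}"
proof
  assume "R = {}"
  then have CD: "C = {v}" "D = {- v}" using C(2) D(2) by auto
  have "F = {C, D}"
  proof (rule ccontr)
    assume "F \<noteq> {C, D}"
    then obtain E where E: "E \<in> F" "E \<noteq> C" "E \<noteq> D" using C(1) D(1) by blast
    from F(8)[OF E(1)] obtain \<phi> where "\<And>G. G \<in> F - {E} \<Longrightarrow> \<exists>x\<in>G. lit_true \<phi> x"
      unfolding satisfiable_def by blast
    from this[of C] this[of D] show False
      using C(1) D(1) E lit_true_uminus[OF v(1)] by (auto simp: CD)
  qed
  then have "vars F = {\<bar>v\<bar>}" by (auto simp: vars_def CD)
  then show False using n2 by (simp add: nvars_def)
qed

private lemma resolvent_clause: "is_clause R"
proof -
  obtain \<phi> where \<phi>: "\<And>E. E \<in> F - {C, D} \<Longrightarrow> \<exists>x\<in>E. lit_true \<phi> x" using sat_rest by blast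
  have "x \<noteq> 0" if "x \<in> R" for x using that F(3) C(1) D(1) by auto
  then have "- x \<notin> R" if "x \<in> R" for x
    using that resolvent_true[OF \<phi>, of x] resolvent_true[OF \<phi>, of "- x"] lit_true_uminus by metis
  then show ?thesis
    unfolding is_clause_def using F(2,3) C(1) D(1) by blast
qed

private lemma vars_resolvent: "vars F' = vars F - {\<bar>v\<bar>}"
proof (intro set_eqI iffI)
  fix z assume "z \<in> vars F'"
  then obtain E x where E: "E \<in> F'" "x \<in> E" "z = \<bar>x\<bar>" by (auto simp: vars_def)
  have "x \<noteq> v \<and> x \<noteq> - v \<and> x \<in> \<Union>F"
    using E(1,2) not_v v(2,3) C(1) D(1) by blast
  then show "z \<in> vars F - {\<bar>v\<bar>}" using E(3) by (auto simp: vars_def abs_eq_iff)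
next
  fix z assume "z \<in> vars F - {\<bar>v\<bar>}"
  then obtain E x where E: "E \<in> F" "x \<in> E" "z = \<bar>x\<bar>" "x \<noteq> v" "x \<noteq> - v"
    by (auto simp: vars_def)
  then have "x \<in> \<Union>F'" by blast
  then show "z \<in> vars F'" using E(3) by (auto simp: vars_def)
qed

lemma nvars_resolvent: "nvars F' = nvars F - 1"
proof -
  have "\<bar>v\<bar> \<in> vars F" using C by (auto simp: vars_def)
  then show ?thesis unfolding nvars_def vars_resolvent by (simp add: card_Diff_singleton)
qed

lemma mu2_def1_resolvent: "F' \<in> mu2_def1"
proof -
  have "card (C - {v}) \<le> 1" "card (D - {- v}) \<le> 1"
    using F(5)[OF C(1)] F(5)[OF D(1)] C(2) D(2) by (simp_all add: card_Diff_singleton)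
  then have "card R \<le> 2" using card_Un_le[of "C - {v}" "D - {- v}"] by linarith
  then have 1: "two_cnf F'"
    using mu resolvent_clause by (auto simp: two_cnf_def is_clause_set_def mu2_def1_def)
  have 2: "satisfiable (F' - {E})" if "E \<in> F'" for E
  proof (cases "E = R")
    case True
    then show ?thesis using sat_rest unfolding satisfiable_def by blast
  next
    case False
    then have E: "E \<in> F" "E \<noteq> C" "E \<noteq> D" using that by auto
    from F(8)[OF E(1)] obtain \<phi> where \<phi>: "\<And>G. G \<in> F - {E} \<Longrightarrow> \<exists>x\<in>G. lit_true \<phi> x"
      unfolding satisfiable_def by blast
    have "C \<in> F - {E}" "D \<in> F - {E}" using C(1) D(1) E(2,3) by auto
    from \<phi>[OF this(1)] \<phi>[OF this(2)]
    obtain a b where "a \<in> C" "lit_true \<phi> a" "b \<in> D" "lit_true \<phi> b" by auto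
    \<comment> \<open>The literals v and -v are not both true, so C or D is satisfied by a literal
      that survives in R.\<close>
    moreover have "a \<noteq> v \<or> b \<noteq> - v"
      using lit_true_uminus[OF v(1), of \<phi>] calculation(2,4) by blast
    ultimately have "\<exists>x\<in>R. lit_true \<phi> x" by blast
    then have "\<exists>x\<in>G. lit_true \<phi> x" if "G \<in> F' - {E}" for G
      using that \<phi>[of G] by blast
    then show ?thesis unfolding satisfiable_def by blast
  qed
  have "card F' = card F - 2 + 1"
    using resolvent_new F(1) C(1) D(1) v(4) by (simp add: card_Diff_subset)
  then have 3: "deficiency F' = 1"
    using nvars_resolvent F(9) n2 by (simp add: deficiency_def)
  show ?thesis
    using 1 2 3 unsat' resolvent_nonempty F(6) by (auto simp: mu2_def1_def min_unsat_def)
qed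

end

section \<open>A singular variable by double counting\<close>

lemma sum_var_occ:
  assumes "F \<in> mu2_def1"
  shows "(\<Sum>v\<in>vars F. var_occ F v) = (\<Sum>C\<in>F. card C)"
proof -
  note F = mu2_def1D[OF assms]
  have fv: "finite (vars F)" using F(1,2) by (auto simp: vars_def)
  have "card C = (\<Sum>v\<in>vars F. if v \<in> C \<or> - v \<in> C then 1 else 0)" if "C \<in> F" for C
  proof -
    \<comment> \<open>A clause contains no complementary pair, so it meets exactly as many variables
      as it has literals.\<close>
    have "inj_on abs C" using F(4)[OF that] by (auto simp: inj_on_def abs_eq_iff)
    then have "card C = card (abs ` C)" by (simp add: card_image)
    also have "abs ` C = {v \<in> vars F. v \<in> C \<or> - v \<in> C}"
    proof (intro set_eqI iffI)
      fix z assume "z \<in> abs ` C"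
      then show "z \<in> {v \<in> vars F. v \<in> C \<or> - v \<in> C}" using that
        by (auto simp: vars_def abs_if)
    next
      fix z assume z: "z \<in> {v \<in> vars F. v \<in> C \<or> - v \<in> C}"
      then have "z = \<bar>z\<bar> \<and> z = \<bar>- z\<bar>" by (auto simp: vars_def)
      then show "z \<in> abs ` C" using z by blast
    qed
    finally show ?thesis using fv by (simp add: sum.If_cases Int_def)
  qed
  then have "(\<Sum>C\<in>F. card C) = (\<Sum>C\<in>F. \<Sum>v\<in>vars F. if v \<in> C \<or> - v \<in> C then 1 else 0)"
    by (intro sum.cong) auto
  also have "\<dots> = (\<Sum>v\<in>vars F. \<Sum>C\<in>F. if v \<in> C \<or> - v \<in> C then 1 else 0)"
    by (rule sum.swap)
  also have "\<dots> = (\<Sum>v\<in>vars F. var_occ F v)"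
    using F(1) by (simp add: var_occ_def sum.If_cases Int_def)
  finally show ?thesis by simp
qed

text \<open>Three clauses at every variable would give 3n <= 2(n + 1) occurrences, hence n = 2 under
  the hypothesis n >= 2; only this borderline case needs unsatisfiability.\<close>

lemma low_degree_variable:
  assumes "F \<in> mu2_def1" "2 \<le> nvars F"
  shows "\<exists>v\<in>vars F. var_occ F v \<le> 2"
proof (rule ccontr)
  assume "\<not> ?thesis"
  then have ge: "3 \<le> var_occ F v" if "v \<in> vars F" for v using that by fastforce
  note F = mu2_def1D[OF assms(1)]
  have "3 * nvars F \<le> (\<Sum>v\<in>vars F. var_occ F v)"
    using sum_bounded_below[of "vars F" 3 "var_occ F"] ge by (simp add: nvars_def)
  then have low: "3 * nvars F \<le> (\<Sum>C\<in>F. card C)" using sum_var_occ[OF assms(1)] by simp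
  moreover have "(\<Sum>C\<in>F. card C) \<le> card F * 2"
    using sum_bounded_above[of F card 2] F(5) by simp
  ultimately have n: "nvars F = 2" using F(9) assms(2) by linarith
  \<comment> \<open>For n = 2 the lower and the upper bound on the number of occurrences are both 6,
    so no clause can be shorter.\<close>
  have c2: "card C = 2" if "C \<in> F" for C
  proof (rule ccontr)
    assume "card C \<noteq> 2"
    then have "card C < 2" using F(5)[OF that] by linarith
    then have "(\<Sum>C\<in>F. card C) < (\<Sum>C\<in>F. 2)"
      using F(5) that F(1) by (intro sum_strict_mono_ex1) (auto intro!: bexI[of _ C])
    then show False using low n F(9) by simp
  qed
  obtain u w where uw: "vars F = {u, w}" "u \<noteq> w"
    using n by (auto simp: nvars_def card_2_iff)
  have "0 < z" if "z \<in> vars F" for z using that F(3) by (auto simp: vars_def)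
  then have uw0: "0 < u" "0 < w" using uw by auto
  \<comment> \<open>The assignment falsifying a and b falsifies some clause, whose two literals can
    only be a and b. Hence all four sign patterns occur as clauses, although F has only n + 1 =
    3.\<close>
  have mem: "{a, b} \<in> F" if ab: "\<bar>a\<bar> = u" "\<bar>b\<bar> = w" for a b
  proof -
    have ab0: "a \<noteq> 0" "b \<noteq> 0" using uw0 ab by auto
    let ?\<phi> = "set_lit (set_lit (\<lambda>_. True) (- a)) (- b)"
    obtain C where C: "C \<in> F" "\<And>x. x \<in> C \<Longrightarrow> \<not> lit_true ?\<phi> x"
      using F(7) unfolding satisfiable_def by blast
    have "x \<in> {a, b}" if "x \<in> C" for x
    proof -
      have "\<bar>x\<bar> \<in> {u, w}" using that C(1) uw(1) by (auto simp: vars_def)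
      then have "x = a \<or> x = - a \<or> x = b \<or> x = - b" using ab by (auto simp: abs_eq_iff)
      moreover have "lit_true ?\<phi> (- a)" "lit_true ?\<phi> (- b)"
        using ab ab0 uw(2) by (auto simp: lit_true_set_lit)
      ultimately show ?thesis using C(2)[OF that] by auto
    qed
    moreover have "card {a, b} = 2" using ab uw(2) by auto
    ultimately have "C = {a, b}" using c2[OF C(1)] by (intro card_subset_eq) auto
    then show ?thesis using C(1) by simp
  qed
  have "{{u, w}, {u, - w}, {- u, w}, {- u, - w}} \<subseteq> F" using mem uw0 by auto
  then have "card {{u, w}, {u, - w}, {- u, w}, {- u, - w}} \<le> card F" using F(1) card_mono by blast
  moreover have "card {{u, w}, {u, - w}, {- u, w}, {- u, - w}} = 4"
    using uw0 uw(2) by (auto simp: card_insert_if doubleton_eq_iff)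
  ultimately show False using F(9) n by simp
qed

text \<open>Both signs occur by \<open>mu_complement_occurs\<close>, in different clauses; with at
  most two clauses at the variable, each sign has exactly one.\<close>

lemma singular_variable:
  assumes "F \<in> mu2_def1" "2 \<le> nvars F"
  obtains v C D where "C \<in> F" "v \<in> C" "\<And>E. E \<in> F \<Longrightarrow> v \<in> E \<Longrightarrow> E = C"
    "D \<in> F" "- v \<in> D" "\<And>E. E \<in> F \<Longrightarrow> - v \<in> E \<Longrightarrow> E = D"
proof -
  note F = mu2_def1D[OF assms(1)]
  obtain v where v: "v \<in> vars F" "var_occ F v \<le> 2" using low_degree_variable[OF assms] by auto
  obtain E where "E \<in> F" "v \<in> E \<or> - v \<in> E" using v(1) by (auto simp: vars_def abs_if)
  then obtain C D where CD: "C \<in> F" "v \<in> C" "D \<in> F" "- v \<in> D"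
    using mu_complement_occurs[OF assms(1)] by (metis minus_minus)
  have "C \<noteq> D" using F(4) CD by blast
  let ?S = "{C \<in> F. v \<in> C \<or> - v \<in> C}"
  have "{C, D} \<subseteq> ?S" "finite ?S" using CD F(1) by auto
  moreover have "card ?S \<le> card {C, D}" using v(2) \<open>C \<noteq> D\<close> by (simp add: var_occ_def)
  ultimately have S: "?S = {C, D}" using card_seteq by metis
  show thesis
  proof
    show "E = C" if "E \<in> F" "v \<in> E" for E using that S CD F(4) by blast
    show "E = D" if "E \<in> F" "- v \<in> E" for E using that S CD F(4) by blast
  qed (use CD in auto)
qed

section \<open>Presentations by a chain of literals\<close>

fun chain_of :: "int list \<Rightarrow> clause_set" where
  "chain_of (a # b # as) = insert {- a, b} (chain_of (b # as))"
| "chain_of _ = {}"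

definition chain_presentation :: "int list \<Rightarrow> int \<Rightarrow> int \<Rightarrow> clause_set" where
  "chain_presentation as p q = chain_of as \<union> {{hd as, p}, {- last as, - q}}"

text \<open>The list picks one literal of each variable. Requiring p and q themselves to be in it,
  not just their variables, fixes the signs in the closing clauses.\<close>

definition presents :: "int list \<Rightarrow> int \<Rightarrow> int \<Rightarrow> clause_set \<Rightarrow> bool" where
  "presents as p q F \<longleftrightarrow> as \<noteq> [] \<and> distinct (map abs as) \<and> 0 \<notin> set as \<and> p \<in> set as \<and> q \<in> set as \<and>
     F = chain_presentation as p q"

lemma chain_of_append:
  "chain_of (xs @ a # b # ys) = chain_of (xs @ [a]) \<union> {{- a, b}} \<union> chain_of (b # ys)"
proof (induction xs)
  case (Cons c xs)
  then show ?case by (cases xs) auto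
qed simp

lemma chain_of_snoc: "chain_of (xs @ [a, b]) = insert {- a, b} (chain_of (xs @ [a]))"
  using chain_of_append[of xs a b "[]"] by simp

lemma chain_of_memE:
  assumes "C \<in> chain_of as"
  obtains xs a b ys where "as = xs @ a # b # ys" "C = {- a, b}"
  using assms
proof (induction as arbitrary: thesis rule: chain_of.induct)
  case (1 a b as)
  show ?case
  proof (cases "C = {- a, b}")
    case True
    then show ?thesis using 1(2)[of "[]"] by simp
  next
    case False
    then have "C \<in> chain_of (b # as)" using 1(3) by simp
    then obtain xs c d ys where "b # as = xs @ c # d # ys" "C = {- c, d}" using 1(1) by blast
    then show ?thesis using 1(2)[of "a # xs" c d ys] by simp
  qed
qed auto

lemma card_chain_of: "finite (chain_of as) \<and> card (chain_of as) \<le> length as - 1"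
  by (induction as rule: chain_of.induct) (auto simp: card_insert_if)

lemma card_chain_presentation:
  assumes "as \<noteq> []"
  shows "finite (chain_presentation as p q)" "card (chain_presentation as p q) \<le> length as + 1"
proof -
  show "finite (chain_presentation as p q)" using card_chain_of by (simp add: chain_presentation_def)
  have "card {{hd as, p}, {- last as, - q}} \<le> 2" by (simp add: card_insert_if)
  then show "card (chain_presentation as p q) \<le> length as + 1"
    using card_Un_le[of "chain_of as" "{{hd as, p}, {- last as, - q}}"] card_chain_of[of as] assms
    by (cases as) (auto simp: chain_presentation_def)
qed

lemma chain_of_rev: "chain_of (rev (map uminus as)) = chain_of as"
proof (induction as rule: chain_of.induct)
  case (1 a b as)
  have "chain_of (rev (map uminus (a # b # as))) = insert {b, - a} (chain_of (rev (map uminus (b # as))))"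
    using chain_of_snoc[of "rev (map uminus as)" "- b" "- a"] by simp
  then show ?case using 1 by (simp add: insert_commute)
qed auto

text \<open>Contraposition reverses the chain and swaps the two closing clauses, so that an
  insertion at the end reduces to one at the front.\<close>

lemma presents_rev:
  assumes "presents as p q F"
  shows "presents (rev (map uminus as)) (- q) (- p) F"
proof -
  have "as \<noteq> []" using assms by (simp add: presents_def)
  then have "chain_presentation (rev (map uminus as)) (- q) (- p) = chain_presentation as p q"
    unfolding chain_presentation_def chain_of_rev by (auto simp: hd_rev last_rev last_map hd_map)
  moreover have "distinct (map abs (rev (map uminus as))) = distinct (map abs as)"
    by (simp flip: rev_map add: comp_def)
  ultimately show ?thesis using assms by (auto simp: presents_def)
qed

lemma lits_chain_of: "\<Union> (chain_of (a # as)) = uminus ` set (butlast (a # as)) \<union> set as"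
  by (induction as arbitrary: a) auto

lemma lits_presents:
  assumes "presents as p q F"
  shows "lits F = set as \<union> uminus ` set as"
proof -
  obtain a bs where as: "as = a # bs" using assms by (cases as) (auto simp: presents_def)
  have "set as = insert (last as) (set (butlast as))"
    using as by (metis append_butlast_last_id list.set_intros(1) list.simps(3) rotate1.simps(2) set_rotate1
        list.simps(15) butlast_snoc)
  then have "\<Union>F \<union> uminus ` \<Union>F = set as \<union> uminus ` set as"
    using assms lits_chain_of[of a bs]
    by (auto simp: presents_def chain_presentation_def as)
  moreover have "lits F = \<Union>F \<union> uminus ` \<Union>F"
    by (auto simp: lits_altdef image_iff) (metis UnionI minus_minus)
  ultimately show ?thesis by simp
qed

text \<open>A presentation has at most \<open>length as + 1\<close> clauses, so the clause count
  turns one inclusion into equality.\<close>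

lemma presentsI:
  assumes "as \<noteq> []" "distinct (map abs as)" "0 \<notin> set as" "p \<in> set as" "q \<in> set as"
    "F \<subseteq> chain_presentation as p q" "card F = length as + 1"
  shows "presents as p q F"
proof -
  have "F = chain_presentation as p q"
    using card_chain_presentation[OF assms(1), of p q] assms(6,7)
    by (intro card_seteq) auto
  then show ?thesis using assms by (simp add: presents_def)
qed

text \<open>The shape of two parents of a nonempty resolvent {a, b}, up to the sign of v. The choice
  p = w, where {w, p} is a unit clause, arises only for a unit resolvent a = b.\<close>

lemma resolvent_cases:
  fixes v :: int
  assumes "card C \<le> 2" "card D \<le> 2" "v \<in> C" "- v \<in> D" "finite C" "finite D"
    and "(C - {v}) \<union> (D - {- v}) = {a, b}"
  obtains w p where "w = v \<or> w = - v" "p = a \<or> p = w \<and> a = b" "{C, D} = {{w, p}, {- w, b}}"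
  | w p where "w = v \<or> w = - v" "p = b \<or> p = w \<and> a = b" "{C, D} = {{w, p}, {- w, a}}"
proof -
  have C: "C = {v} \<or> (\<exists>c. C = {v, c} \<and> c \<noteq> v)"
  proof -
    have "card (C - {v}) \<le> 1" using assms by (simp add: card_Diff_singleton)
    then have "C - {v} = {} \<or> (\<exists>c. C - {v} = {c})"
      using assms(5) by (metis card_1_singletonE card_0_eq finite_Diff le_eq_less_or_eq less_one)
    then show ?thesis using assms(3) by blast
  qed
  have D: "D = {- v} \<or> (\<exists>d. D = {- v, d} \<and> d \<noteq> - v)"
  proof -
    have "card (D - {- v}) \<le> 1" using assms by (simp add: card_Diff_singleton)
    then have "D - {- v} = {} \<or> (\<exists>c. D - {- v} = {c})"
      using assms(6) by (metis card_1_singletonE card_0_eq finite_Diff le_eq_less_or_eq less_one)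
    then show ?thesis using assms(4) by blast
  qed
  consider (1) "C = {v}" "D = {- v}" | (2) d where "C = {v}" "D = {- v, d}" "d \<noteq> - v"
    | (3) c where "C = {v, c}" "c \<noteq> v" "D = {- v}"
    | (4) c d where "C = {v, c}" "c \<noteq> v" "D = {- v, d}" "d \<noteq> - v" using C D by blast
  then show thesis
  proof cases
    case 1
    then show ?thesis using assms(7) by simp
  next
    case 2
    then have "{d} = {a, b}" using assms(7) by auto
    then have "a = d" "b = d" by (auto simp: doubleton_eq_iff)
    then show ?thesis using that(1)[of v v] 2 by simp
  next
    case 3
    then have "{c} = {a, b}" using assms(7) by auto
    then have ab: "a = c" "b = c" by (auto simp: doubleton_eq_iff)
    then have "{C, D} = {{- v, - v}, {- (- v), b}}" unfolding 3 by (simp add: insert_commute)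
    then show ?thesis using that(1)[of "- v" "- v"] ab by blast
  next
    case 4
    then have "{c, d} = {a, b}" using assms(7) by auto
    then consider "c = a" "d = b" | "c = b" "d = a" by (auto simp: doubleton_eq_iff)
    then show ?thesis
    proof cases
      case 1
      then show ?thesis using that(1)[of v a] 4 by simp
    next
      case 2
      then show ?thesis using that(2)[of v b] 4 by simp
    qed
  qed
qed

text \<open>Undoing a resolution at the closing clause {hd as, p} prepends w: its parent {- w, hd
  as} becomes the first link, and {w, p'} the new closing clause.\<close>

lemma presents_insert_front:
  assumes "presents as p q F'" "R = {hd as, p}" "F - {C, D} \<subseteq> F' - {R}" "card F = length as + 2"
    and CD: "card C \<le> 2" "card D \<le> 2" "v \<in> C" "- v \<in> D" "finite C" "finite D"
      "(C - {v}) \<union> (D - {- v}) = R"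
    and v: "v \<notin> set as" "- v \<notin> set as" "v \<noteq> 0"
  shows "\<exists>as p q. presents as p q F"
proof -
  have as: "as \<noteq> []" "distinct (map abs as)" "0 \<notin> set as" "p \<in> set as" "q \<in> set as"
    "F' = chain_presentation as p q" using assms(1) by (auto simp: presents_def)
  have 1: "\<exists>as p q. presents as p q F"
    if w: "w = v \<or> w = - v" "p' = p \<or> p' = w" "{C, D} = {{w, p'}, {- w, hd as}}" for w p'
  proof -
    have "\<bar>w\<bar> \<notin> abs ` set as" using v w(1) by (auto simp: abs_eq_iff)
    moreover have ch: "chain_of (w # as) = insert {- w, hd as} (chain_of as)"
      using as(1) by (cases as) auto
    have "F \<subseteq> chain_presentation (w # as) p' q"
    proof
      fix E assume "E \<in> F"
      then consider "E \<in> {C, D}" | "E \<in> F' - {R}" using assms(3) by blast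
      then show "E \<in> chain_presentation (w # as) p' q"
        unfolding w(3) as(6) assms(2) chain_presentation_def ch using as(1) by cases auto
    qed
    ultimately have "presents (w # as) p' q F"
      using as(1-5) w(1,2) v assms(4) by (intro presentsI) auto
    then show ?thesis by blast
  qed
  have R: "(C - {v}) \<union> (D - {- v}) = {p, hd as}" using CD(7) assms(2) by auto
  show ?thesis
  proof (rule resolvent_cases[OF CD(1-6) R])
    fix w p' assume w: "w = v \<or> w = - v" "p' = p \<or> p' = w \<and> p = hd as"
      "{C, D} = {{w, p'}, {- w, hd as}}"
    show ?thesis using w(2) by (intro 1[OF w(1) _ w(3)]) blast
  next
    fix w p' assume w: "w = v \<or> w = - v" "p' = hd as \<or> p' = w \<and> p = hd as" "{C, D} = {{w, p'}, {- w, p}}"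
    show ?thesis
    \<comment> \<open>Here the roles are exchanged: w is joined to the old head, so -w becomes the
      new one. In the unit case the parents already have the required form.\<close>
    proof (cases "p' = hd as")
      case True
      have "{C, D} = {{- w, p}, {- (- w), hd as}}"
        unfolding w(3) True by (simp add: insert_commute)
      moreover have "- w = v \<or> - w = - v" using w(1) by auto
      ultimately show ?thesis by (intro 1[of "- w" p]) blast+
    next
      case False
      then have "p' = w" "p = hd as" using w(2) by auto
      then have "{C, D} = {{w, p'}, {- w, hd as}}" unfolding w(3) by simp
      then show ?thesis using w(1) \<open>p' = w\<close> by (intro 1[of w p']) blast+
    qed
  qed
qed

text \<open>Undoing a resolution at a link {- a, b} places w or -w between a and b; both closing
  clauses stay as they are.\<close>

lemma presents_insert_chain:
  assumes "presents as p q F'" "R \<in> chain_of as" "F - {C, D} \<subseteq> F' - {R}" "card F = length as + 2"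
    and CD: "card C \<le> 2" "card D \<le> 2" "v \<in> C" "- v \<in> D" "finite C" "finite D"
      "(C - {v}) \<union> (D - {- v}) = R"
    and v: "v \<notin> set as" "- v \<notin> set as" "v \<noteq> 0"
  shows "\<exists>as p q. presents as p q F"
proof -
  have as: "as \<noteq> []" "distinct (map abs as)" "0 \<notin> set as" "p \<in> set as" "q \<in> set as"
    "F' = chain_presentation as p q" using assms(1) by (auto simp: presents_def)
  obtain xs a b ys where ab: "as = xs @ a # b # ys" "R = {- a, b}" using assms(2) chain_of_memE by blast
  \<comment> \<open>Different entries of the chain have different variables, so the link is no unit
    and the alternative p' = w of \<open>resolvent_cases\<close> cannot arise.\<close>
  have "- a \<noteq> b" using as(2) ab(1) by auto
  have 1: "\<exists>as p q. presents as p q F"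
    if w: "w = v \<or> w = - v" "{C, D} = {{- a, w}, {- w, b}}" for w
  proof -
    have "\<bar>w\<bar> \<notin> abs ` set as" using v w(1) by (auto simp: abs_eq_iff)
    moreover have ch: "chain_of (xs @ a # w # b # ys) =
      chain_of (xs @ [a]) \<union> {{- a, w}, {- w, b}} \<union> chain_of (b # ys)"
      using chain_of_append[of xs a w "b # ys"] by auto
    have hl: "hd (xs @ a # w # b # ys) = hd as" "last (xs @ a # w # b # ys) = last as"
      by (cases xs; simp add: ab(1))+
    have "F \<subseteq> chain_presentation (xs @ a # w # b # ys) p q"
    proof
      fix E assume "E \<in> F"
      then consider "E \<in> {C, D}" | "E \<in> F' - {R}" using assms(3) by blast
      then show "E \<in> chain_presentation (xs @ a # w # b # ys) p q"
      proof cases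
        case 1
        then show ?thesis unfolding w(2) chain_presentation_def ch by blast
      next
        case 2
        then have "E \<in> chain_of as - {{- a, b}} \<or> E \<in> {{hd as, p}, {- last as, - q}}"
          unfolding as(6) ab(2) chain_presentation_def by blast
        then show ?thesis
          unfolding chain_presentation_def ch hl using chain_of_append[of xs a b ys] ab(1) by blast
      qed
    qed
    moreover have "distinct (map abs (xs @ a # w # b # ys)) \<and> 0 \<notin> set (xs @ a # w # b # ys) \<and>
      set as \<subseteq> set (xs @ a # w # b # ys)"
      using as(2,3) w(1) v(3) calculation(1) unfolding ab(1) by auto
    ultimately have "presents (xs @ a # w # b # ys) p q F"
      using as(4,5) assms(4) by (intro presentsI) (auto simp: ab(1))
    then show ?thesis by blast
  qed
  have R: "(C - {v}) \<union> (D - {- v}) = {- a, b}" using CD(7) ab(2) by auto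
  show ?thesis
  proof (rule resolvent_cases[OF CD(1-6) R])
    fix w p' assume w: "w = v \<or> w = - v" "p' = - a \<or> p' = w \<and> - a = b"
      "{C, D} = {{w, p'}, {- w, b}}"
    then have "p' = - a" using \<open>- a \<noteq> b\<close> by blast
    then have "{C, D} = {{- a, w}, {- w, b}}" unfolding w(3) by (simp add: insert_commute)
    then show ?thesis by (rule 1[OF w(1)])
  next
    fix w p' assume w: "w = v \<or> w = - v" "p' = b \<or> p' = w \<and> - a = b" "{C, D} = {{w, p'}, {- w, - a}}"
    then have "p' = b" using \<open>- a \<noteq> b\<close> by blast
    then have "{C, D} = {{- a, - w}, {- (- w), b}}" unfolding w(3) by (simp add: insert_commute)
    moreover have "- w = v \<or> - w = - v" using w(1) by auto
    ultimately show ?thesis by (intro 1)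
  qed
qed

theorem mu2_def1_presentation:
  assumes "F \<in> mu2_def1"
  shows "\<exists>as p q. presents as p q F"
  using assms
proof (induction "nvars F" arbitrary: F rule: less_induct)
  case less
  note F = mu2_def1D[OF less.prems]
  have "F \<noteq> {}" using F(7) by (auto simp: satisfiable_def)
  then obtain C0 x0 where x0: "C0 \<in> F" "x0 \<in> C0" using F(6) by blast
  have fv: "finite (vars F)" using F(1,2) by (auto simp: vars_def)
  have v0: "\<bar>x0\<bar> \<in> vars F" using x0 by (auto simp: vars_def)
  show ?case
  proof (cases "2 \<le> nvars F")
    case False
    then have "card (vars F) \<le> 1" by (simp add: nvars_def)
    then have vars: "vars F = {\<bar>x0\<bar>}" using v0 fv by (intro card_seteq[symmetric]) auto
    have "C \<subseteq> {x0} \<or> C \<subseteq> {- x0}" if "C \<in> F" for C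
    proof -
      have "x = x0 \<or> x = - x0" if "x \<in> C" for x
      proof -
        have "\<bar>x\<bar> \<in> vars F" using that \<open>C \<in> F\<close> by (auto simp: vars_def)
        then show ?thesis unfolding vars by (simp add: abs_eq_iff)
      qed
      then show ?thesis using F(4)[OF that, of x0] by blast
    qed
    then have "F \<subseteq> chain_presentation [x0] x0 x0"
      using F(6) by (fastforce simp: chain_presentation_def)
    moreover have "x0 \<noteq> 0" using F(3) x0 by blast
    ultimately have "presents [x0] x0 x0 F"
      using F(9) vars by (intro presentsI) (auto simp: nvars_def)
    then show ?thesis by blast
  next
    case True
    obtain v C D where CD: "C \<in> F" "v \<in> C" "\<And>E. E \<in> F \<Longrightarrow> v \<in> E \<Longrightarrow> E = C"
      "D \<in> F" "- v \<in> D" "\<And>E. E \<in> F \<Longrightarrow> - v \<in> E \<Longrightarrow> E = D"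
      using singular_variable[OF less.prems True] by metis
    define R where "R = (C - {v}) \<union> (D - {- v})"
    define F' where "F' = insert R (F - {C, D})"
    have F': "F' \<in> mu2_def1" "nvars F' = nvars F - 1" "R \<notin> F - {C, D}"
      unfolding F'_def R_def
      using mu2_def1_resolvent[OF less.prems True CD] nvars_resolvent[OF less.prems True CD]
        resolvent_new[OF less.prems True CD] by auto
    then obtain as p q where pr: "presents as p q F'" using less.hyps[of F'] True by auto
    have "x \<noteq> v \<and> x \<noteq> - v" if x: "x \<in> lits F'" for x
    proof -
      have "v \<notin> E \<and> - v \<notin> E" if "E \<in> F'" for E
      proof -
        have "- v \<notin> C" "v \<notin> D" using F(4)[OF CD(1,2)] F(4)[OF CD(4,5)] by simp_all
        then show ?thesis using that CD(3)[of E] CD(6)[of E] unfolding F'_def R_def by blast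
      qed
      then show ?thesis using x by (auto simp: lits_altdef)
    qed
    then have nv: "v \<notin> set as" "- v \<notin> set as" using lits_presents[OF pr] by auto
    have v0: "v \<noteq> 0" using F(3) CD(1,2) by blast
    have RF: "R \<in> F'" "F - {C, D} \<subseteq> F' - {R}" using F'(3) by (auto simp: F'_def)
    have len: "card F = length as + 2"
    proof -
      have "vars F' = abs ` set as"
        unfolding vars_altdef lits_presents[OF pr] by (auto simp: abs_if image_iff)
      moreover have "card (abs ` set as) = length as"
        using pr distinct_card[of "map abs as"] by (simp add: presents_def)
      ultimately show ?thesis using F'(2) F(9) True by (simp add: nvars_def)
    qed
    have CD': "card C \<le> 2" "card D \<le> 2" "v \<in> C" "- v \<in> D" "finite C" "finite D"
      "(C - {v}) \<union> (D - {- v}) = R"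
      using F(2,5)[OF CD(1)] F(2,5)[OF CD(4)] CD(2,5) by (simp_all add: R_def)
    have "F' = chain_of as \<union> {{hd as, p}, {- last as, - q}}" and ne: "as \<noteq> []"
      using pr by (auto simp: presents_def chain_presentation_def)
    with RF(1) consider "R \<in> chain_of as" | "R = {hd as, p}" | "R = {- last as, - q}" by blast
    then show ?thesis
    proof cases
      case 1
      then show ?thesis using presents_insert_chain[OF pr 1 RF(2) len CD' nv v0] by blast
    next
      case 2
      then show ?thesis using presents_insert_front[OF pr 2 RF(2) len CD' nv v0] by blast
    next
      case 3
      let ?as = "rev (map uminus as)"
      have "R = {hd ?as, - q}" using 3 ne by (simp add: hd_rev last_map)
      moreover have "card F = length ?as + 2" "v \<notin> set ?as" "- v \<notin> set ?as"
        using len nv by (auto simp: image_iff)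
      ultimately show ?thesis
        using presents_insert_front[OF presents_rev[OF pr] _ RF(2) _ CD' _ _ v0] by blast
    qed
  qed
qed

section \<open>From presentations to the canonical clause-sets\<close>

lemma chain_of_nth: "chain_of as = {{- as ! j, as ! Suc j} | j. Suc j < length as}"
proof (induction as rule: chain_of.induct)
  case (1 a b as)
  have "{{- (a # b # as) ! j, (a # b # as) ! Suc j} | j. Suc j < length (a # b # as)} =
    insert {- a, b} {{- (b # as) ! j, (b # as) ! Suc j} | j. Suc j < length (b # as)}" (is "?L = ?R")
  proof (intro set_eqI iffI)
    fix C assume "C \<in> ?L"
    then obtain j where "C = {- (a # b # as) ! j, (a # b # as) ! Suc j}" "Suc j < length (a # b # as)"
      by blast
    then show "C \<in> ?R" by (cases j) auto
  next
    fix C assume "C \<in> ?R"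
    then consider "C = {- a, b}" | j where "C = {- (b # as) ! j, (b # as) ! Suc j}" "Suc j < length (b # as)"
      by blast
    then show "C \<in> ?L"
    proof cases
      case 1
      then show ?thesis by (intro CollectI exI[of _ 0]) auto
    next
      case (2 j)
      then show ?thesis by (intro CollectI exI[of _ "Suc j"]) auto
    qed
  qed
  then show ?case using 1 by simp
qed auto

lemma presents_iso:
  assumes "presents as p q F"
  obtains x y where "1 \<le> x" "x \<le> length as" "1 \<le> y" "y \<le> length as" "U0' (length as) x y \<cong> F"
proof -
  define n where "n = length as"
  have as: "as \<noteq> []" "distinct (map abs as)" "0 \<notin> set as" "p \<in> set as" "q \<in> set as"
    "F = chain_of as \<union> {{hd as, p}, {- last as, - q}}"
    using assms by (auto simp: presents_def chain_presentation_def)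
  obtain i k where ik: "i < n" "as ! i = p" "k < n" "as ! k = q"
    using as(4,5) by (auto simp: in_set_conv_nth n_def)
  \<comment> \<open>Variable j + 1 goes to the entry at position j; hence the parameters below are
    the positions of p and q plus one.\<close>
  define f where "f z = (if z > 0 then as ! (nat z - 1) else - as ! (nat (- z) - 1))" for z
  have fpos: "f (int (Suc j)) = as ! j" and fneg: "f (- int (Suc j)) = - as ! j" for j
    by (auto simp: f_def simp flip: of_nat_Suc)
  have xy: "1 \<le> Suc i" "Suc i \<le> n" "1 \<le> Suc k" "Suc k \<le> n" using ik by auto
  have inj_abs: "j = j'" if "\<bar>as ! j\<bar> = \<bar>as ! j'\<bar>" "j < n" "j' < n" for j j'
    using that as(2) by (auto simp: n_def distinct_conv_nth nth_map)
  have nz: "as ! j \<noteq> 0" if "j < n" for j using that as(3) nth_mem[of j as] by (metis n_def)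
  have lit: "\<exists>j<n. z = int (Suc j) \<or> z = - int (Suc j)" if "z \<noteq> 0" "\<bar>z\<bar> \<le> int n" for z
    using that by (intro exI[of _ "nat \<bar>z\<bar> - 1"]) auto
  have "bij_betw f {z. z \<noteq> 0 \<and> \<bar>z\<bar> \<le> int n} (set as \<union> uminus ` set as)"
    unfolding bij_betw_def
  proof
    show "inj_on f {z. z \<noteq> 0 \<and> \<bar>z\<bar> \<le> int n}"
    proof (rule inj_onI)
      fix z z' assume z: "z \<in> {z. z \<noteq> 0 \<and> \<bar>z\<bar> \<le> int n}" "z' \<in> {z. z \<noteq> 0 \<and> \<bar>z\<bar> \<le> int n}" "f z = f z'"
      obtain j j' where j: "j < n" "z = int (Suc j) \<or> z = - int (Suc j)"
        "j' < n" "z' = int (Suc j') \<or> z' = - int (Suc j')" using lit z(1,2) by blast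
      then have "\<bar>as ! j\<bar> = \<bar>as ! j'\<bar>" using z(3) fpos fneg by (metis abs_minus_cancel)
      then have "j = j'" using inj_abs j by blast
      then show "z = z'" using j z(3) fpos[of j] fneg[of j] nz[of j] by auto
    qed
    show "f ` {z. z \<noteq> 0 \<and> \<bar>z\<bar> \<le> int n} = set as \<union> uminus ` set as"
    proof (intro set_eqI iffI)
      fix a assume "a \<in> f ` {z. z \<noteq> 0 \<and> \<bar>z\<bar> \<le> int n}"
      then obtain z where "z \<noteq> 0" "\<bar>z\<bar> \<le> int n" "a = f z" by auto
      then show "a \<in> set as \<union> uminus ` set as"
        using lit[of z] fpos fneg nth_mem[of _ as] by (auto simp: n_def)
    next
      fix a assume "a \<in> set as \<union> uminus ` set as"
      then obtain j where j: "j < n" "a = as ! j \<or> a = - as ! j" by (auto simp: in_set_conv_nth n_def)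
      then have "a = f (int (Suc j)) \<or> a = f (- int (Suc j))" using fpos fneg by simp
      moreover have "int (Suc j) \<in> {z. z \<noteq> 0 \<and> \<bar>z\<bar> \<le> int n}" "- int (Suc j) \<in> {z. z \<noteq> 0 \<and> \<bar>z\<bar> \<le> int n}"
        using j(1) by auto
      ultimately show "a \<in> f ` {z. z \<noteq> 0 \<and> \<bar>z\<bar> \<le> int n}" by blast
    qed
  qed
  moreover have "f (- z) = - f z" if "z \<noteq> 0" "\<bar>z\<bar> \<le> int n" for z
    using lit[OF that] fpos fneg by (metis minus_minus)
  moreover have "(\<lambda>C. f ` C) ` U0' n (Suc i) (Suc k) = F"
  proof -
    have f1: "f 1 = hd as" using fpos[of 0] as(1) by (simp add: hd_conv_nth)
    have fn: "f (- int n) = - last as"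
      using fneg[of "n - 1"] as(1) by (simp add: last_conv_nth n_def)
    have "chain_clauses n = (\<lambda>j. {- int (Suc j), int (Suc (Suc j))}) ` {j. Suc j < n}"
    proof (intro set_eqI iffI)
      fix C assume "C \<in> chain_clauses n"
      then obtain j where "C = {- int j, int (j + 1)}" "1 \<le> j" "j < n" by (auto simp: chain_clauses_def)
      then show "C \<in> (\<lambda>j. {- int (Suc j), int (Suc (Suc j))}) ` {j. Suc j < n}"
        by (intro image_eqI[of _ _ "j - 1"]) auto
    next
      fix C assume "C \<in> (\<lambda>j. {- int (Suc j), int (Suc (Suc j))}) ` {j. Suc j < n}"
      then obtain j where "C = {- int (Suc j), int (Suc (Suc j))}" "Suc j < n" by blast
      then show "C \<in> chain_clauses n" unfolding chain_clauses_def
        by (intro CollectI exI[of _ "Suc j"]) auto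
    qed
    then have "(\<lambda>C. f ` C) ` chain_clauses n = (\<lambda>j. {- as ! j, as ! Suc j}) ` {j. Suc j < n}"
      by (simp only: image_image image_insert image_empty fpos fneg)
    also have "\<dots> = chain_of as" unfolding chain_of_nth n_def by auto
    finally show ?thesis
      unfolding U0'_def as(6) image_Un image_insert image_empty f1 fn fpos fneg ik by simp
  qed
  ultimately have "iso_by f (U0' n (Suc i) (Suc k)) F"
    unfolding iso_by_def lits_U[OF xy] lits_presents[OF assms] by blast
  then show thesis using that[OF xy[unfolded n_def]] by (auto simp: cls_iso_iff n_def)
qed

text \<open>Making exactly the variables from x on true respects all chain implications; x satisfies
  the first closing clause, and y < x is false and so satisfies the second.\<close>

lemma U_satisfiable:
  assumes "1 \<le> y" "y < x" "x \<le> n"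
  shows "satisfiable (U0' n x y)"
proof -
  have "\<exists>z\<in>C. lit_true (\<lambda>v. v \<ge> int x) z" if C: "C \<in> U0' n x y" for C
  proof -
    consider j where "1 \<le> j" "j < n" "C = {- int j, int (j + 1)}" | "C = {1, int x}" | "C = {- int n, - int y}"
      using C by (auto simp: U0'_def chain_clauses_def)
    then show ?thesis
    proof cases
      case (1 j)
      then show ?thesis by (cases "j < x") (auto simp: lit_true_def)
    qed (use assms in \<open>auto simp: lit_true_def\<close>)
  qed
  then show ?thesis unfolding satisfiable_def by blast
qed

lemma card_U:
  assumes "1 \<le> x" "x \<le> n" "1 \<le> y" "y \<le> n"
  shows "card (U0' n x y) = n + 1"
proof -
  let ?h = "\<lambda>j. {- int j, int (j + 1)}"
  have ch: "chain_clauses n = ?h ` {1..<n}" by (auto simp: chain_clauses_def)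
  have "inj_on ?h {1..<n}" by (auto simp: inj_on_def doubleton_eq_iff)
  then have "card (chain_clauses n) = n - 1" unfolding ch by (simp add: card_image)
  moreover have "finite (chain_clauses n)" unfolding ch by simp
  moreover have "{1, int x} \<notin> chain_clauses n" "{- int n, - int y} \<notin> insert {1, int x} (chain_clauses n)"
    using assms by (auto simp: chain_clauses_def doubleton_eq_iff)
  ultimately show ?thesis
    using assms unfolding U0'_def by (simp add: insert_commute[of "{1, int x}"])
qed

theorem mu2_def1_canonical:
  assumes "F \<in> mu2_def1"
  obtains x y where "canonical_params (nvars F) x y" "F \<cong> U0' (nvars F) x y"
proof -
  note F = mu2_def1D[OF assms]
  obtain as p q where pr: "presents as p q F" using mu2_def1_presentation[OF assms] by blast
  obtain x y where xy: "1 \<le> x" "x \<le> length as" "1 \<le> y" "y \<le> length as" "U0' (length as) x y \<cong> F"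
    using presents_iso[OF pr] by blast
  obtain f where f: "iso_by f (U0' (length as) x y) F" using xy(5) by (auto simp: cls_iso_iff)
  \<comment> \<open>Isomorphism preserves the number of clauses, which is one more than either side:
    by deficiency 1 and by \<open>card_U\<close>.\<close>
  have n: "nvars F = length as" using iso_card[OF f] card_U[OF xy(1-4)] F(9) by simp
  have U: "F \<cong> U0' (nvars F) x y" using xy(5) n cls_iso_sym by simp
  have "x \<le> y"
  proof (rule ccontr)
    assume "\<not> x \<le> y"
    then have "satisfiable (U0' (length as) x y)" using xy by (intro U_satisfiable) auto
    moreover have "0 \<notin> lits (U0' (length as) x y)" using lits_U[OF xy(1-4)] by simp
    ultimately have "satisfiable F" using iso_satisfiable[OF iso_by_inv[OF f]] by simp
    then show False using F(7) by simp
  qed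
  show thesis
  proof (cases "x + y \<le> nvars F + 1")
    case True
    then show thesis using that[of x y] U xy n \<open>x \<le> y\<close> by (auto simp: canonical_params_def)
  next
    case False
    have "U0' (nvars F) x y \<cong> U0' (nvars F) (nvars F + 1 - y) (nvars F + 1 - x)"
      using iso_U_reverse[of x "nvars F" y] xy n unfolding cls_iso_iff by auto
    then have "F \<cong> U0' (nvars F) (nvars F + 1 - y) (nvars F + 1 - x)" using U cls_iso_trans by blast
    moreover have "canonical_params (nvars F) (nvars F + 1 - y) (nvars F + 1 - x)"
      using xy n \<open>x \<le> y\<close> False unfolding canonical_params_def by linarith
    ultimately show thesis using that by blast
  qed
qed


section \<open>The parameters\<close>

lemma U_clauseE:
  assumes "C \<in> U0' n x y"
  obtains j where "1 \<le> j" "j < n" "C = {- int j, int j + 1}"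
  | "C = {1, int x}" | "C = {- int n, - int y}"
  using assms by (auto simp: U0'_def chain_clauses_def ac_simps)

lemma U_chainI: "1 \<le> j \<Longrightarrow> j < n \<Longrightarrow> {- int j, int j + 1} \<in> U0' n x y"
  unfolding U0'_def chain_clauses_def by (intro UnI1 CollectI exI[of _ j]) (simp add: add.commute)

lemma nunits_U:
  assumes "1 \<le> x" "x \<le> n" "1 \<le> y" "y \<le> n"
  shows "nunits (U0' n x y) = (if x = 1 then 1 else 0) + (if y = n then 1 else 0)"
proof -
  have c: "card {a, b} = 1 \<longleftrightarrow> a = b" for a b :: int by (auto simp: card_insert_if)
  have ch: "\<not> (C \<in> chain_clauses n \<and> card C = 1)" for C
  proof
    assume "C \<in> chain_clauses n \<and> card C = 1"
    then obtain j where "C = {- int j, int (j + 1)}" "card C = 1"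
      unfolding chain_clauses_def by blast
    then have "- int j = int (j + 1)" by (simp only: c)
    then show False by simp
  qed
  have "{C \<in> U0' n x y. card C = 1} = {C. C = {1, int x} \<and> x = 1} \<union> {C. C = {- int n, - int y} \<and> y = n}"
    unfolding U0'_def using ch c[of 1 "int x"] c[of "- int n" "- int y"] by auto
  also have "card \<dots> = (if x = 1 then 1 else 0) + (if y = n then 1 else 0)"
  proof -
    have "{1, int x} \<noteq> {- int n, - int y}" using assms by (auto simp: doubleton_eq_iff)
    then show ?thesis by (cases "x = 1"; cases "y = n") (simp_all add: card_insert_if)
  qed
  finally show ?thesis by (simp add: nunits_def)
qed

text \<open>A variable strictly inside the chain lies in two links, and x = y puts it into both
  closing clauses as well.\<close>

lemma var_occ_U_eq:
  assumes "2 \<le> x" "x < n"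
  shows "var_occ (U0' n x x) (int x) = 4"
proof -
  have "{C \<in> U0' n x x. int x \<in> C \<or> - int x \<in> C} =
    {{- int (x - 1), int x}, {- int x, int x + 1}, {1, int x}, {- int n, - int x}}" (is "?L = ?R")
  proof
    show "?L \<subseteq> ?R"
    proof
      fix C assume C: "C \<in> ?L"
      then have C: "C \<in> U0' n x x" "int x \<in> C \<or> - int x \<in> C" by auto
      from C(1) show "C \<in> ?R"
      proof (cases rule: U_clauseE)
        case (1 j)
        then have "j = x \<or> int (x - 1) = int j \<and> int x = int j + 1" using C(2) by auto
        then show ?thesis using 1(3) by (elim disjE conjE) simp_all
      qed simp_all
    qed
    have "{- int (x - 1), int (x - 1) + 1} \<in> U0' n x x" "{- int x, int x + 1} \<in> U0' n x x"
      using assms by (intro U_chainI; simp)+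
    moreover have "int (x - 1) + 1 = int x" using assms by simp
    ultimately have "{- int (x - 1), int x} \<in> U0' n x x" "{- int x, int x + 1} \<in> U0' n x x" by simp_all
    moreover have "{1, int x} \<in> U0' n x x" "{- int n, - int x} \<in> U0' n x x" by (auto simp: U0'_def)
    ultimately show "?R \<subseteq> ?L" by blast
  qed
  moreover have "card ?R = 4" using assms by (simp add: card_insert_if doubleton_eq_iff)
  ultimately show ?thesis by (simp add: var_occ_def)
qed

lemma var_occ_U_neq:
  assumes "2 \<le> x" "x < y" "y < n" "v \<in> vars (U0' n x y)"
  shows "var_occ (U0' n x y) v \<noteq> 4"
proof -
  have v: "v \<in> {1..int n}" using vars_U[of x n y] assms by auto
  \<comment> \<open>The only closing clause that can contain v: because of 1 < x < y < n, the
    variable sets {1, x} and {y, n} are disjoint. With at most two links, v has at most three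
    occurrences.\<close>
  define E where "E = (if v = int y \<or> v = int n then {- int n, - int y} else {1, int x})"
  have "{C \<in> U0' n x y. v \<in> C \<or> - v \<in> C} \<subseteq> {{- (v - 1), v}, {- v, v + 1}, E}"
  proof
    fix C assume "C \<in> {C \<in> U0' n x y. v \<in> C \<or> - v \<in> C}"
    then have C: "C \<in> U0' n x y" "v \<in> C \<or> - v \<in> C" by auto
    from C(1) show "C \<in> {{- (v - 1), v}, {- v, v + 1}, E}"
    proof (cases rule: U_clauseE)
      case (1 j)
      then have "v = int j \<or> v = int j + 1" using C(2) v by auto
      then show ?thesis using 1(3) by auto
    next
      case 2
      then have "v = 1 \<or> v = int x" using C(2) v by auto
      then have "E = {1, int x}" using assms(1-3) unfolding E_def by auto
      then show ?thesis using 2 by simp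
    next
      case 3
      then have "v = int n \<or> v = int y" using C(2) v by auto
      then have "E = {- int n, - int y}" unfolding E_def by auto
      then show ?thesis using 3 by simp
    qed
  qed
  then have "var_occ (U0' n x y) v \<le> card {{- (v - 1), v}, {- v, v + 1}, E}"
    unfolding var_occ_def by (intro card_mono) auto
  also have "\<dots> \<le> 3" by (simp add: card_insert_if)
  finally show ?thesis by simp
qed

context
  fixes F n x y
  assumes F: "F \<in> mu2_def1" and n: "n = nvars F" and can: "canonical_params n x y"
    and iso: "F \<cong> U0' n x y"
begin

private lemma xy: "1 \<le> x" "x \<le> n" "1 \<le> y" "y \<le> n" "x \<le> y" "x + y \<le> n + 1"
  using can by (auto simp: canonical_params_def)

lemma nunits_mu: "nunits F = (if x = 1 then 1 else 0) + (if y = n then 1 else 0)"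
proof -
  obtain f where "iso_by f F (U0' n x y)" using iso by (auto simp: cls_iso_iff)
  then show ?thesis using iso_nunits nunits_U[OF xy(1-4)] by metis
qed

lemma var_occ_mu:
  assumes "nunits F = 0"
  shows "(\<exists>v\<in>vars F. var_occ F v = 4) \<longleftrightarrow> x = y"
proof -
  obtain f where f: "iso_by f F (U0' n x y)" using iso by (auto simp: cls_iso_iff)
  have "x \<noteq> 1" "y \<noteq> n" using assms nunits_mu by (auto split: if_splits)
  then have xy': "2 \<le> x" "y < n" using xy by auto
  have "(\<exists>v\<in>vars F. var_occ F v = 4) \<longleftrightarrow> (\<exists>v\<in>vars (U0' n x y). var_occ (U0' n x y) v = 4)"
    using iso_var_occ_ex[OF f] iso_var_occ_ex[OF iso_by_inv[OF f]] by blast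
  also have "\<dots> \<longleftrightarrow> x = y"
  proof
    assume "\<exists>v\<in>vars (U0' n x y). var_occ (U0' n x y) v = 4"
    then show "x = y" using var_occ_U_neq[of x y n] xy' xy by force
  next
    assume "x = y"
    moreover have "int x \<in> vars (U0' n x y)" using vars_U[OF xy(1-4)] xy by simp
    ultimately show "\<exists>v\<in>vars (U0' n x y). var_occ (U0' n x y) v = 4"
      using var_occ_U_eq[of x n] xy' by auto
  qed
  finally show ?thesis .
qed

text \<open>Every alternative of \<open>is_params\<close> exhibits F as some \<open>U0'\<close> with
  canonical parameters, so \<open>U_params_unique\<close> forces these to be x and y.\<close>

lemma is_params_iff: "is_params F L \<longleftrightarrow> L = params_list n x y"
proof
  assume "is_params F L"
  then consider "L = []" "F \<cong> U0' n 1 n"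
    | i where "L = [i]" "1 \<le> i" "i \<le> n - 1" "F \<cong> U0' n 1 i"
    | i where "L = [i]" "2 \<le> i" "2 * i \<le> n + 1" "F \<cong> U0' n i i"
    | a b where "L = [a, b]" "2 \<le> a" "a < b" "b \<le> n - 1" "a + b \<le> n + 1" "F \<cong> U0' n a b"
    unfolding is_params_def U2_eq U1_eq U0_eq n by blast
  then show "L = params_list n x y"
  proof cases
    case 1
    then show ?thesis using U_params_unique[OF iso 1(2) can] xy
      by (auto simp: canonical_params_def params_list_def)
  next
    case (2 i)
    then show ?thesis using U_params_unique[OF iso 2(4) can] xy
      by (auto simp: canonical_params_def params_list_def)
  next
    case (3 i)
    then show ?thesis using U_params_unique[OF iso 3(4) can] xy
      by (auto simp: canonical_params_def params_list_def)
  next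
    case (4 a b)
    then show ?thesis using U_params_unique[OF iso 4(6) can] xy
      by (auto simp: canonical_params_def params_list_def)
  qed
next
  assume L: "L = params_list n x y"
  consider (1) "x = 1" "y = n" | (2) "x = 1" "y < n" | (3) "2 \<le> x" "x = y" | (4) "2 \<le> x" "x < y"
    using xy by linarith
  then show "is_params F L"
  proof cases
    case 1
    then show ?thesis using nunits_mu L iso n unfolding is_params_def U2_eq by (simp add: params_list_def)
  next
    case 2
    then have "L = [y]" "nunits F = 1" "y \<le> n - 1" using nunits_mu L by (auto simp: params_list_def)
    then show ?thesis using iso xy 2 n unfolding is_params_def U1_eq by auto
  next
    case 3
    then have "L = [x]" "nunits F = 0" using nunits_mu L xy by (auto simp: params_list_def)
    then show ?thesis using iso xy 3 n var_occ_mu unfolding is_params_def U0_eq by auto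
  next
    case 4
    then have "L = [x, y]" "nunits F = 0" "y \<le> n - 1" using nunits_mu L xy by (auto simp: params_list_def)
    then show ?thesis using iso xy 4 n var_occ_mu unfolding is_params_def by auto
  qed
qed

lemma params_mu: "params F = params_list n x y"
  unfolding params_def is_params_iff by simp

lemma canon_mu: "canon F = U0' n x y"
  unfolding canon_def params_mu n[symmetric] nunits_mu
  using xy by (auto simp: params_list_def U_fam_def U2_eq U1_eq U0_eq)

end

section \<open>Implication graphs\<close>

lemma snd_ig: "snd (ig F) = {{a, b} | a b. step F a b}"
proof -
  have "{(- x, x) | x. {x} \<in> F} \<union> {(- x, y) | x y. {x, y} \<in> F \<and> x \<noteq> y} = {(a, b). step F a b}"
  proof (intro set_eqI iffI)
    fix e assume "e \<in> {(- x, x) | x. {x} \<in> F} \<union> {(- x, y) | x y. {x, y} \<in> F \<and> x \<noteq> y}"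
    then show "e \<in> {(a, b). step F a b}" by (auto simp: step_def)
  next
    fix e assume "e \<in> {(a, b). step F a b}"
    then obtain a b where ab: "e = (a, b)" "{- a, b} \<in> F" by (auto simp: step_def)
    show "e \<in> {(- x, x) | x. {x} \<in> F} \<union> {(- x, y) | x y. {x, y} \<in> F \<and> x \<noteq> y}"
    proof (cases "- a = b")
      case True
      then have "e = (- b, b)" "{b} \<in> F" using ab by auto
      then show ?thesis by blast
    next
      case False
      moreover have "e = (- (- a), b)" using ab by simp
      ultimately show ?thesis using ab(2) by blast
    qed
  qed
  then show ?thesis by (simp add: ig_def underlying_graph_def idg_def)
qed

lemma fst_ig: "fst (ig F) = lits F"
  by (simp add: ig_def underlying_graph_def idg_def)

lemma set_edge_list:
  "set (edge_list n) = {[int j, int j + 1] | j. 1 \<le> j \<and> j < n} \<union> {[- int j, - int j - 1] | j. 1 \<le> j \<and> j < n}"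
proof (induction n rule: edge_list.induct)
  case (1 m)
  have split: "{f j | j. 1 \<le> j \<and> j < Suc (Suc m)} = insert (f (Suc m)) {f j | j. 1 \<le> j \<and> j < Suc m}"
    for f :: "nat \<Rightarrow> int list"
    by (auto simp: less_Suc_eq)
  have "int (Suc (Suc m)) = int (Suc m) + 1" "- int (Suc (Suc m)) = - int (Suc m) - 1" by simp_all
  then show ?case unfolding edge_list.simps(1) list.set(2) 1 split by auto
qed auto

lemma set_graph_edges:
  "set (graph_edges n x y) = {[int x, - 1], [1, - int x], [int n, - int y], [int y, - int n]} \<union>
    {[int j, int j + 1] | j. 1 \<le> j \<and> j < n} \<union> {[- int j, - int j - 1] | j. 1 \<le> j \<and> j < n}"
  unfolding graph_edges_def set_insert set_edge_list by blast

lemma distinct_edge_list: "distinct (edge_list n)"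
  by (induction n rule: edge_list.induct) (auto simp: set_edge_list)

context
  fixes n x y :: nat
  assumes xy: "1 \<le> x" "x \<le> y" "y \<le> n" "x + y \<le> n + 1"
begin

private lemma xy': "1 \<le> x" "x \<le> n" "1 \<le> y" "y \<le> n" using xy by auto

lemma graph_edges_distinct: "distinct (map set (graph_edges n x y))"
proof -
  have "distinct (graph_edges n x y)"
    unfolding graph_edges_def by (simp add: distinct_edge_list)
  moreover have "inj_on set (set (graph_edges n x y))"
  proof (rule inj_onI)
    \<comment> \<open>Each edge is listed in the order given by the asymmetric relation Q.\<close>
    define Q where "Q a b \<longleftrightarrow> 0 < a \<and> b < 0 \<or> 0 < a \<and> a < b \<or> b < a \<and> a < 0" for a b :: int
    have Q: "\<exists>a b. e = [a, b] \<and> Q a b" if "e \<in> set (graph_edges n x y)" for e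
      using that xy unfolding set_graph_edges Q_def by auto
    fix d e assume de: "d \<in> set (graph_edges n x y)" "e \<in> set (graph_edges n x y)" "set d = set e"
    obtain a b a' b' where ab: "d = [a, b]" "Q a b" "e = [a', b']" "Q a' b'" using Q de(1,2) by metis
    then have "a = a' \<and> b = b' \<or> a = b' \<and> b = a'" using de(3) by (simp add: doubleton_eq_iff)
    moreover have "\<not> (Q a b \<and> Q b a)" unfolding Q_def by linarith
    ultimately show "d = e" using ab by blast
  qed
  ultimately show ?thesis by (simp add: distinct_map)
qed

lemma graph_edges_pairs: "\<forall>e\<in>set (graph_edges n x y). \<exists>a b. e = [a, b] \<and> a \<noteq> b"
  unfolding set_graph_edges using xy by auto

text \<open>A binary clause contributes two contrapositive arcs, so each chain link gives one edge
  among the positive and one among the negative literals. Only the closing clauses give edges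
  between the two signs.\<close>

lemma edges_ig_U: "snd (ig (U0' n x y)) = set ` set (graph_edges n x y)"
proof -
  have l: "(\<exists>j. 1 \<le> j \<and> j \<le> n \<and> (a = int j \<or> a = - int j))" if "step (U0' n x y) a b" for a b
  proof -
    have "{- a, b} \<subseteq> lits (U0' n x y)"
      using that clause_subset_lits unfolding step_def by blast
    then have "a \<noteq> 0" "\<bar>a\<bar> \<le> int n" unfolding lits_U[OF xy'] by auto
    then show ?thesis by (intro exI[of _ "nat \<bar>a\<bar>"]) auto
  qed
  have "{{a, b} | a b. step (U0' n x y) a b} =
     {{int j, b} | j b. 1 \<le> j \<and> j \<le> n \<and> step (U0' n x y) (int j) b} \<union>
     {{- int j, b} | j b. 1 \<le> j \<and> j \<le> n \<and> step (U0' n x y) (- int j) b}"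
    using l by blast
  also have "\<dots> =
     {{int j, b} | j b. 1 \<le> j \<and> j \<le> n \<and>
        (j < n \<and> b = int j + 1 \<or> j = n \<and> b = - int y \<or> j = y \<and> b = - int n)} \<union>
     {{- int j, b} | j b. 1 \<le> j \<and> j \<le> n \<and>
        (1 < j \<and> b = 1 - int j \<or> j = 1 \<and> b = int x \<or> j = x \<and> b = 1)}"
    using step_U_pos[OF xy'] step_U_neg[OF xy'] by blast
  also have "{{int j, b} | j b. 1 \<le> j \<and> j \<le> n \<and>
        (j < n \<and> b = int j + 1 \<or> j = n \<and> b = - int y \<or> j = y \<and> b = - int n)} =
     {{int j, int j + 1} | j. 1 \<le> j \<and> j < n} \<union> {{int n, - int y}, {int y, - int n}}"
    using xy' by fastforce
  also have "{{- int j, b} | j b. 1 \<le> j \<and> j \<le> n \<and>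
        (1 < j \<and> b = 1 - int j \<or> j = 1 \<and> b = int x \<or> j = x \<and> b = 1)} =
     {{- int j, 1 - int j} | j. 1 < j \<and> j \<le> n} \<union> {{- int 1, int x}, {- int x, 1}}"
    using xy' by fastforce
  also have "{{int j, int j + 1} | j. 1 \<le> j \<and> j < n} \<union> {{int n, - int y}, {int y, - int n}} \<union>
     ({{- int j, 1 - int j} | j. 1 < j \<and> j \<le> n} \<union> {{- int 1, int x}, {- int x, 1}}) =
    {{int x, - 1}, {1, - int x}, {int n, - int y}, {int y, - int n}} \<union>
    {{int j, int j + 1} | j. 1 \<le> j \<and> j < n} \<union> {{- int j, 1 - int j} | j. 1 < j \<and> j \<le> n}"
  proof -
    have c: "{- int 1, int x} = {int x, - 1}" "{- int x, 1} = {1, - int x}" by auto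
    have "A \<union> {c, d} \<union> (B \<union> {a, b}) = {a, b, c, d} \<union> A \<union> B" for A B and a b c d :: "int set" by blast
    then show ?thesis unfolding c .
  qed
  also have "{{- int j, 1 - int j} | j. 1 < j \<and> j \<le> n} = {{- int j, - int j - 1} | j. 1 \<le> j \<and> j < n}"
  proof (intro set_eqI iffI)
    fix C assume "C \<in> {{- int j, 1 - int j} | j. 1 < j \<and> j \<le> n}"
    then obtain j where "C = {- int j, 1 - int j}" "1 < j" "j \<le> n" by blast
    then show "C \<in> {{- int j, - int j - 1} | j. 1 \<le> j \<and> j < n}"
      by (intro CollectI exI[of _ "j - 1"]) (auto simp: of_nat_diff insert_commute)
  next
    fix C assume "C \<in> {{- int j, - int j - 1} | j. 1 \<le> j \<and> j < n}"
    then obtain j where "C = {- int j, - int j - 1}" "1 \<le> j" "j < n" by blast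
    then show "C \<in> {{- int j, 1 - int j} | j. 1 < j \<and> j \<le> n}"
      by (intro CollectI exI[of _ "j + 1"]) (auto simp: insert_commute)
  qed
  also have "{{int x, - 1}, {1, - int x}, {int n, - int y}, {int y, - int n}} \<union>
    {{int j, int j + 1} | j. 1 \<le> j \<and> j < n} \<union> {{- int j, - int j - 1} | j. 1 \<le> j \<and> j < n} =
    set ` set (graph_edges n x y)"
  proof -
    have "set ` {f j | j. P j} = {set (f j) | j. P j}" for f :: "nat \<Rightarrow> int list" and P by blast
    then show ?thesis unfolding set_graph_edges image_Un image_insert image_empty by simp
  qed
  finally show ?thesis unfolding snd_ig .
qed

text \<open>Any other mixed edge at n would require n = x, n = 1 or n = y. The first implies n = 1
  by x <= y and x + y <= n + 1, and in each case the negative end is still -y.\<close>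

lemma edge_last:
  assumes "{int n, b} \<in> snd (ig (U0' n x y))" "b < 0"
  shows "b = - int y"
  using assms xy unfolding edges_ig_U set_graph_edges by (auto simp: doubleton_eq_iff)

lemma edge_first:
  assumes "{- 1, b} \<in> snd (ig (U0' n x y))" "\<not> b < 0" "y \<noteq> 1"
  shows "b = int x"
  using assms xy unfolding edges_ig_U set_graph_edges by (auto simp: doubleton_eq_iff)

lemma edges_mem:
  "{int n, - int y} \<in> snd (ig (U0' n x y))" "{- 1, int x} \<in> snd (ig (U0' n x y))"
  unfolding edges_ig_U set_graph_edges by (auto simp: insert_commute image_iff)

end

lemma ig_U_inj:
  assumes "canonical_params n x y" "canonical_params n' x' y'" "ig (U0' n x y) = ig (U0' n' x' y')"
  shows "n = n' \<and> x = x' \<and> y = y'"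
proof -
  have xy: "1 \<le> x" "x \<le> y" "y \<le> n" "x + y \<le> n + 1" and xy': "1 \<le> x'" "x' \<le> y'" "y' \<le> n'" "x' + y' \<le> n' + 1"
    using assms by (auto simp: canonical_params_def)
  have "lits (U0' n x y) = lits (U0' n' x' y')" using assms(3) by (metis fst_ig)
  moreover have "lits (U0' n x y) = {z. z \<noteq> 0 \<and> \<bar>z\<bar> \<le> int n}" "lits (U0' n' x' y') = {z. z \<noteq> 0 \<and> \<bar>z\<bar> \<le> int n'}"
    using lits_U[of x n y] lits_U[of x' n' y'] xy xy' by auto
  ultimately have eq: "{z. z \<noteq> 0 \<and> \<bar>z\<bar> \<le> int n} = {z. z \<noteq> 0 \<and> \<bar>z\<bar> \<le> int n'}" by simp
  have "int n \<in> {z. z \<noteq> 0 \<and> \<bar>z\<bar> \<le> int n'}" using xy unfolding eq[symmetric] by simp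
  moreover have "int n' \<in> {z. z \<noteq> 0 \<and> \<bar>z\<bar> \<le> int n}" using xy' unfolding eq by simp
  ultimately have n: "n = n'" by simp
  have y: "y = y'"
    using edge_last[OF xy', of "- int y"] edges_mem(1)[OF xy] assms(3) n xy by simp
  have "x = x'"
  proof (cases "y = 1")
    case True
    then show ?thesis using xy xy' y by simp
  next
    case False
    then show ?thesis using edge_first[OF xy', of "int x"] edges_mem(2)[OF xy] assms(3) y by simp
  qed
  then show ?thesis using n y by simp
qed

section \<open>Representations\<close>

lemma set_rep_int_rep:
  "set_rep int_rep w A \<longleftrightarrow> (\<exists>xs. distinct xs \<and> set xs = A \<and> w = ints_tree xs)"
proof -
  have "list_all2 int_rep ws xs \<longleftrightarrow> ws = map int_tree xs" for ws xs
    unfolding int_rep_def by (induction xs arbitrary: ws) (auto simp: list_all2_Cons2)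
  then show ?thesis by (auto simp: set_rep_def ints_tree_def)
qed

lemma set_rep_set_rep:
  "set_rep (set_rep int_rep) w F \<longleftrightarrow> (\<exists>Fs. distinct (map set Fs) \<and> set ` set Fs = F \<and>
     (\<forall>C\<in>set Fs. distinct C) \<and> w = cls_tree Fs)"
proof -
  have *: "list_all2 (set_rep int_rep) ws xs \<longleftrightarrow>
      (\<exists>Fs. xs = map set Fs \<and> ws = map ints_tree Fs \<and> (\<forall>C\<in>set Fs. distinct C))" for ws xs
  proof
    assume "list_all2 (set_rep int_rep) ws xs"
    then show "\<exists>Fs. xs = map set Fs \<and> ws = map ints_tree Fs \<and> (\<forall>C\<in>set Fs. distinct C)"
    proof (induction rule: list_all2_induct)
      case (Cons w ws x xs)
      then obtain Fs C where "xs = map set Fs" "ws = map ints_tree Fs" "\<forall>C\<in>set Fs. distinct C"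
        "distinct C" "set C = x" "w = ints_tree C"
        by (auto simp: set_rep_int_rep)
      then show ?case by (intro exI[of _ "C # Fs"]) auto
    qed simp
  next
    assume "\<exists>Fs. xs = map set Fs \<and> ws = map ints_tree Fs \<and> (\<forall>C\<in>set Fs. distinct C)"
    then show "list_all2 (set_rep int_rep) ws xs"
      by (auto simp: list.rel_map set_rep_int_rep intro!: list.rel_refl_strong)
  qed
  show ?thesis
  proof
    assume "set_rep (set_rep int_rep) w F"
    then show "\<exists>Fs. distinct (map set Fs) \<and> set ` set Fs = F \<and> (\<forall>C\<in>set Fs. distinct C) \<and> w = cls_tree Fs"
      unfolding set_rep_def[of "set_rep int_rep"] * by (auto simp: cls_tree_def)
  next
    assume "\<exists>Fs. distinct (map set Fs) \<and> set ` set Fs = F \<and> (\<forall>C\<in>set Fs. distinct C) \<and> w = cls_tree Fs"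
    then obtain Fs where Fs: "distinct (map set Fs)" "set ` set Fs = F" "\<forall>C\<in>set Fs. distinct C" "w = cls_tree Fs"
      by blast
    then have "list_all2 (set_rep int_rep) (map ints_tree Fs) (map set Fs)" using * by blast
    then show "set_rep (set_rep int_rep) w F"
      unfolding set_rep_def[of "set_rep int_rep"] using Fs
      by (intro exI[of _ "map set Fs"] exI[of _ "map ints_tree Fs"]) (simp add: cls_tree_def)
  qed
qed

lemma two_listsI:
  assumes "F \<in> mu2_def1" "set ` set Fs = F" "\<forall>C\<in>set Fs. distinct C"
  shows "two_lists Fs" "0 \<notin> \<Union> (set ` set Fs)"
proof -
  note F = mu2_def1D[OF assms(1)]
  show "0 \<notin> \<Union> (set ` set Fs)" using F(3) assms(2) by blast
  show "two_lists Fs" unfolding two_lists_def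
  proof
    fix C assume C: "C \<in> set Fs"
    then have "set C \<in> F" using assms(2) by blast
    then have "card (set C) \<le> 2" "C \<noteq> []" using F(5,6) by fastforce+
    moreover have "card (set C) = length C" using assms(3) C distinct_card by blast
    ultimately show "(\<exists>a. C = [a]) \<or> (\<exists>a b. C = [a, b])"
      by (cases C; cases "tl C"; cases "tl (tl C)") auto
  qed
qed

section \<open>Solving from an arbitrary enumeration of the clauses\<close>

lemma set_occ: "two_lists Fs \<Longrightarrow> set (concat (map (\<lambda>C. [hd C, last C]) Fs)) = \<Union> (set ` set Fs)"
  by (induction Fs) (auto simp: two_lists_Cons)

text \<open>Each clause contributes its first and last literal. These agree exactly for a unit
  clause, since clauses are listed without repetition; every other repetition comes from two
  clauses, which are different sets.\<close>

lemma set_dups_occ: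
  assumes "two_lists Fs" "distinct (map set Fs)" "\<forall>C\<in>set Fs. distinct C"
  shows "l \<in> set (dups (concat (map (\<lambda>C. [hd C, last C]) Fs))) \<longleftrightarrow>
    {l} \<in> set ` set Fs \<or> (\<exists>C\<in>set Fs. \<exists>D\<in>set Fs. set C \<noteq> set D \<and> l \<in> set C \<and> l \<in> set D)"
  using assms
proof (induction Fs)
  case (Cons C Fs)
  let ?O = "concat (map (\<lambda>C. [hd C, last C]) Fs)"
  have IH: "l \<in> set (dups ?O) \<longleftrightarrow>
    {l} \<in> set ` set Fs \<or> (\<exists>C\<in>set Fs. \<exists>D\<in>set Fs. set C \<noteq> set D \<and> l \<in> set C \<and> l \<in> set D)"
    using Cons by (simp add: two_lists_Cons)
  have O: "set ?O = \<Union> (set ` set Fs)" using Cons.prems(1) set_occ by (simp add: two_lists_Cons)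
  have new: "\<forall>D\<in>set Fs. set C \<noteq> set D" using Cons.prems(2) by auto
  have rhs: "({l} \<in> set ` set (C # Fs) \<or>
      (\<exists>A\<in>set (C # Fs). \<exists>D\<in>set (C # Fs). set A \<noteq> set D \<and> l \<in> set A \<and> l \<in> set D)) \<longleftrightarrow>
    set C = {l} \<or> l \<in> set C \<and> l \<in> set ?O \<or> l \<in> set (dups ?O)"
  proof -
    have "{l} \<in> set ` set (C # Fs) \<longleftrightarrow> set C = {l} \<or> {l} \<in> set ` set Fs" by auto
    moreover have "(\<exists>A\<in>set (C # Fs). \<exists>D\<in>set (C # Fs). set A \<noteq> set D \<and> l \<in> set A \<and> l \<in> set D) \<longleftrightarrow>
       l \<in> set C \<and> l \<in> \<Union> (set ` set Fs) \<or>
       (\<exists>A\<in>set Fs. \<exists>D\<in>set Fs. set A \<noteq> set D \<and> l \<in> set A \<and> l \<in> set D)" (is "?L \<longleftrightarrow> ?R")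
    proof
      assume ?L
      then obtain A D where AD: "A = C \<or> A \<in> set Fs" "D = C \<or> D \<in> set Fs" "set A \<noteq> set D"
        "l \<in> set A" "l \<in> set D" by (metis set_ConsD)
      then show ?R
      proof (cases "A \<in> set Fs \<and> D \<in> set Fs")
        case True
        then show ?thesis using AD by blast
      next
        case False
        then have "l \<in> set C" "A \<in> set Fs \<or> D \<in> set Fs" using AD by auto
        then show ?thesis using AD by blast
      qed
    next
      assume ?R
      then show ?L
      proof
        assume "l \<in> set C \<and> l \<in> \<Union> (set ` set Fs)"
        then obtain D where "D \<in> set Fs" "l \<in> set D" "l \<in> set C" by blast
        then show ?L using new by (intro bexI[of _ C] bexI[of _ D]) auto
      next
        assume "\<exists>A\<in>set Fs. \<exists>D\<in>set Fs. set A \<noteq> set D \<and> l \<in> set A \<and> l \<in> set D"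
        then show ?L by (meson list.set_intros(2))
      qed
    qed
    ultimately show ?thesis unfolding IH O by (simp only: disj_ac)
  qed
  from Cons.prems(1) consider a where "C = [a]" | a b where "C = [a, b]"
    by (auto simp: two_lists_Cons)
  then show ?case
  proof cases
    case 1
    then show ?thesis unfolding rhs by auto
  next
    case 2
    then have "a \<noteq> b" using Cons.prems(3) by auto
    then show ?thesis unfolding rhs using 2 by auto
  qed
qed simp

lemma root_iff_dups:
  assumes "F \<in> mu2_def1" "set ` set Fs = F" "distinct (map set Fs)" "\<forall>C\<in>set Fs. distinct C"
  shows "l \<in> set (dups (concat (map (\<lambda>C. [hd C, last C]) Fs))) \<longleftrightarrow> root F l"
proof -
  note t = two_listsI[OF assms(1,2,4)]
  have pair: "\<exists>b. C = {l, b}" if "C \<in> F" "l \<in> C" for C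
  proof -
    have "C \<in> set ` set Fs" using that(1) assms(2) by simp
    then obtain Cs where "Cs \<in> set Fs" "C = set Cs" by blast
    then consider a where "C = {a}" | a b where "C = {a, b}"
      using t(1) unfolding two_lists_def by fastforce
    then show ?thesis using that(2) by cases (auto intro: exI[of _ l])
  qed
  have "l \<in> set (dups (concat (map (\<lambda>C. [hd C, last C]) Fs))) \<longleftrightarrow>
     {l} \<in> F \<or> (\<exists>C\<in>F. \<exists>D\<in>F. C \<noteq> D \<and> l \<in> C \<and> l \<in> D)"
    unfolding set_dups_occ[OF t(1) assms(3,4)] using assms(2) by blast
  also have "\<dots> \<longleftrightarrow> root F l"
  proof
    assume "{l} \<in> F \<or> (\<exists>C\<in>F. \<exists>D\<in>F. C \<noteq> D \<and> l \<in> C \<and> l \<in> D)"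
    then show "root F l"
    proof
      assume "{l} \<in> F"
      then show ?thesis by (simp add: root_def step_def)
    next
      assume "\<exists>C\<in>F. \<exists>D\<in>F. C \<noteq> D \<and> l \<in> C \<and> l \<in> D"
      then obtain C D where CD: "C \<in> F" "D \<in> F" "C \<noteq> D" "l \<in> C" "l \<in> D" by blast
      then obtain b c where "C = {l, b}" "D = {l, c}" using pair by metis
      then have "b \<noteq> c" "{- (- l), b} \<in> F" "{- (- l), c} \<in> F" using CD by auto
      then show ?thesis unfolding root_def step_def by blast
    qed
  next
    assume "root F l"
    then consider "{l} \<in> F" | b c where "b \<noteq> c" "{l, b} \<in> F" "{l, c} \<in> F"
      unfolding root_def step_def minus_minus insert_absorb2 by blast
    then show "{l} \<in> F \<or> (\<exists>C\<in>F. \<exists>D\<in>F. C \<noteq> D \<and> l \<in> C \<and> l \<in> D)"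
    proof cases
      case 2
      then have "{l, b} \<noteq> {l, c}" by (auto simp: doubleton_eq_iff)
      then show ?thesis
        using 2(2,3) by (intro disjI2 bexI[of _ "{l, b}"] bexI[of _ "{l, c}"]) simp_all
    qed blast
  qed
  finally show ?thesis .
qed

text \<open>An isomorphism carries the two roots and their walk lengths over to F. The order in
  which the program meets the roots depends on the enumeration; taking minimum and maximum of the
  lengths undoes this.\<close>

lemma run_solve_mu:
  assumes F: "F \<in> mu2_def1" and n: "n = nvars F" and can: "canonical_params n x y"
    and iso: "F \<cong> U0' n x y" and rep: "cls_rep w F"
  obtains Fs where "w = cls_tree Fs" "length Fs = n + 1"
    "\<And>main B. 2 * size w + 4 \<le> B \<Longrightarrow> 4 * n + 6 \<le> B \<Longrightarrow>
       fn (prog main) B (Suc 0) [w] (Node (nat_tree x) (nat_tree y)) (8 * (n + 3) * (n + 3))"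
proof -
  obtain Fs where Fs: "distinct (map set Fs)" "set ` set Fs = F" "\<forall>C\<in>set Fs. distinct C" "w = cls_tree Fs"
    using rep unfolding cls_rep_def set_rep_set_rep by blast
  note t = two_listsI[OF F Fs(2,3)]
  have xy: "1 \<le> x" "x \<le> n" "1 \<le> y" "y \<le> n" "x \<le> y" "x + y \<le> n + 1"
    using can by (auto simp: canonical_params_def)
  have len: "length Fs = n + 1"
    using mu2_def1D(9)[OF F] Fs(1,2) n by (metis distinct_card length_map set_map)
  obtain g where g: "iso_by g (U0' n x y) F" using iso cls_iso_sym by (auto simp: cls_iso_iff)
  have mem: "int x \<in> lits (U0' n x y)" "- int x \<in> lits (U0' n x y)"
    "int y \<in> lits (U0' n x y)" "- int y \<in> lits (U0' n x y)"
    using xy by (simp_all add: lits_U)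
  let ?a = "g (int x)" and ?b = "g (- int y)"
  have "?a \<noteq> ?b" using inj_onD[OF iso_inj[OF g] _ mem(1,4)] xy by auto
  have ha: "hits F ?a (- ?a) x"
    using iso_hits[OF g hits_U[OF xy(1-5)] mem(2,1)] iso_uminus[OF g mem(1)] by simp
  have hb: "hits F ?b (- ?b) (n + 1 - y)"
    using iso_hits[OF g hits_U'[OF xy(1,5,4)] mem(3,4)] iso_uminus[OF g mem(3)] by simp
  have roots: "root F r \<longleftrightarrow> r = ?a \<or> r = ?b" for r
  proof
    assume r: "root F r"
    let ?h = "inv_into (lits (U0' n x y)) g"
    have "root (U0' n x y) (?h r)" using iso_root[OF iso_by_inv[OF g] r] .
    then have "?h r = int x \<or> ?h r = - int y" using root_U[OF xy(1-4)] by blast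
    moreover have "r \<in> lits F" using root_lits[OF iso_by_inv[OF g] r] .
    then have "g (?h r) = r" using g by (metis f_inv_into_f iso_by_def bij_betw_imp_surj_on)
    ultimately show "r = ?a \<or> r = ?b" by metis
  next
    assume "r = ?a \<or> r = ?b"
    then show "root F r" using iso_root[OF g] root_U[OF xy(1-4)] by blast
  qed
  define L where "L = dups (concat (map (\<lambda>C. [hd C, last C]) Fs))"
  have L: "set L = {?a, ?b}"
    using root_iff_dups[OF F Fs(2,1,3)] roots unfolding L_def by blast
  then have "L \<noteq> []" by auto
  define r1 r2 where r: "r1 = hd L" "r2 = other L r1"
  have "r1 \<in> set L" using \<open>L \<noteq> []\<close> r by simp
  then have "\<exists>z\<in>set L. z \<noteq> r1" using L \<open>?a \<noteq> ?b\<close> by auto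
  then have r2: "r2 \<in> set L" "r2 \<noteq> r1" using other_mem r by metis+
  then have cases: "r1 = ?a \<and> r2 = ?b \<or> r1 = ?b \<and> r2 = ?a" using \<open>r1 \<in> set L\<close> L by auto
  have r0: "r1 \<noteq> 0" "r2 \<noteq> 0"
  proof -
    have "0 \<notin> lits F" using t(2) Fs(2) by (auto simp: lits_altdef)
    then show "r1 \<noteq> 0" "r2 \<noteq> 0" using cases iso_mem[OF g mem(1)] iso_mem[OF g mem(4)] by metis+
  qed
  obtain h1 h2 where h: "hits F r1 (- r1) h1" "hits F r2 (- r2) h2"
    "min h1 h2 = x" "max h1 h2 = n + 1 - y"
  proof (cases "r1 = ?a \<and> r2 = ?b")
    case True
    then show ?thesis using that[of x "n + 1 - y"] ha hb xy by auto
  next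
    case False
    then show ?thesis using that[of "n + 1 - y" x] ha hb xy cases by auto
  qed
  have h': "h1 \<le> length Fs" "h2 \<le> length Fs" using h(3,4) len by linarith+
  have y: "length Fs - max h1 h2 = y" using h(4) len xy by simp
  have "fn (prog main) B (Suc 0) [w] (Node (nat_tree x) (nat_tree y)) (8 * (n + 3) * (n + 3))"
    if "2 * size w + 4 \<le> B" "4 * n + 6 \<le> B" for main B
  proof -
    have "fn (prog main) B (Suc 0) [cls_tree Fs]
      (Node (nat_tree (min h1 h2)) (nat_tree (length Fs - max h1 h2)))
      (8 * (length Fs + 2) * (length Fs + 2))"
      using that Fs(4) len r \<open>L \<noteq> []\<close> r2 r0 h h' t unfolding L_def Fs(2)[symmetric]
      by (intro run_solve) auto
    moreover have "length Fs + 2 = n + 3" using len by simp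
    ultimately show ?thesis unfolding h(3) y Fs(4) by (simp only:)
  qed
  then show thesis using that[OF Fs(4) len] by blast
qed

section \<open>The computed lists represent the canonical objects\<close>

lemma set_chain_list: "set (chain_list n) = {[- int j, int j + 1] | j. 1 \<le> j \<and> j < n}"
proof (induction n rule: chain_list.induct)
  case (1 m)
  have split: "{f j | j. 1 \<le> j \<and> j < Suc (Suc m)} = insert (f (Suc m)) {f j | j. 1 \<le> j \<and> j < Suc m}"
    for f :: "nat \<Rightarrow> int list"
    by (auto simp: less_Suc_eq)
  have "int (Suc (Suc m)) = int (Suc m) + 1" by simp
  then show ?case unfolding chain_list.simps(1) list.set(2) 1 split by simp
qed auto

lemma length_chain_list: "length (chain_list n) = n - 1"
  by (induction n rule: chain_list.induct) auto

lemma set_vert_list: "set (vert_list n) = {z. z \<noteq> 0 \<and> \<bar>z\<bar> \<le> int n}"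
proof (induction n)
  case (Suc m)
  have "z \<noteq> 0 \<and> \<bar>z\<bar> \<le> int (Suc m) \<longleftrightarrow>
    z = int (Suc m) \<or> z = - int (Suc m) \<or> z \<noteq> 0 \<and> \<bar>z\<bar> \<le> int m" for z
    by linarith
  then show ?case unfolding vert_list.simps(2) list.set(2) Suc by blast
qed simp

lemma distinct_vert_list: "distinct (vert_list n)"
  by (induction n) (auto simp: set_vert_list)

lemma set_pair_or_unit: "set (pair_or_unit a b) = {a, b}" "distinct (pair_or_unit a b)"
  by (auto simp: pair_or_unit_def)

context
  fixes n x y :: nat
  assumes can: "canonical_params n x y"
begin

private lemma bounds: "1 \<le> x" "x \<le> n" "1 \<le> y" "y \<le> n" "x \<le> y" "x + y \<le> n + 1"
  using can by (auto simp: canonical_params_def)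

lemma cls_rep_build_list: "cls_rep (cls_tree (build_list n x y)) (U0' n x y)"
proof -
  have "set ` {f j | j. P j} = {set (f j) | j. P j}" for f :: "nat \<Rightarrow> int list" and P by blast
  then have U: "set ` set (build_list n x y) = U0' n x y"
    unfolding build_list_def list.set set_chain_list image_insert set_pair_or_unit
    by (simp add: U0'_def chain_clauses_def add.commute insert_commute)
  \<comment> \<open>Distinctness follows from counting: the list has n + 1 entries, as many as
    \<open>U0'\<close> has clauses.\<close>
  have "card (set (map set (build_list n x y))) = length (map set (build_list n x y))"
    unfolding set_map U using card_U[OF bounds(1-4)] bounds by (simp add: build_list_def length_chain_list)
  then have "distinct (map set (build_list n x y))" by (rule card_distinct)
  moreover have "\<forall>C\<in>set (build_list n x y). distinct C"
    by (auto simp: build_list_def set_chain_list set_pair_or_unit)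
  ultimately show ?thesis unfolding cls_rep_def set_rep_set_rep using U by blast
qed

lemma graph_rep_ig:
  "graph_rep (Node (ints_tree (vert_list n)) (cls_tree (graph_edges n x y))) (ig (U0' n x y))"
proof -
  have "set_rep int_rep (ints_tree (vert_list n)) (fst (ig (U0' n x y)))"
    unfolding set_rep_int_rep fst_ig lits_U[OF bounds(1-4)] using set_vert_list distinct_vert_list by blast
  moreover have "\<forall>C\<in>set (graph_edges n x y). distinct C"
    using graph_edges_pairs[OF bounds(1,5,4,6)] by fastforce
  then have "set_rep (set_rep int_rep) (cls_tree (graph_edges n x y)) (snd (ig (U0' n x y)))"
    unfolding set_rep_set_rep edges_ig_U[OF bounds(1,5,4,6)]
    using graph_edges_distinct[OF bounds(1,5,4,6)] by blast
  ultimately show ?thesis unfolding graph_rep_def by blast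
qed

end

subsection \<open>Size bounds\<close>

lemma size_int_tree_le: "size (int_tree z) \<le> 2 + 2 * nat \<bar>z\<bar>"
  using size_int_tree[of z] size_nat_tree[of "nat \<bar>z\<bar>"] by linarith

lemma size_chain_list: "size (cls_tree (chain_list n)) \<le> n * (4 * n + 10)"
proof (induction n rule: chain_list.induct)
  case (1 m)
  show ?case
    using 1 size_int_tree_le[of "- int (Suc m)"] size_int_tree_le[of "int (Suc (Suc m))"]
    by (simp add: algebra_simps)
qed auto

lemma size_vert_list: "size (ints_tree (vert_list n)) \<le> n * (4 * n + 10)"
proof (induction n)
  case (Suc m)
  show ?case
    using Suc size_int_tree_le[of "- int (Suc m)"] size_int_tree_le[of "int (Suc m)"]
    by (simp add: algebra_simps)
qed auto

lemma size_edge_list: "size (cls_tree (edge_list n)) \<le> n * (8 * n + 20)"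
proof (induction n rule: edge_list.induct)
  case (1 m)
  show ?case
    using 1 size_int_tree_le[of "- int (Suc m)"] size_int_tree_le[of "int (Suc (Suc m))"]
      size_int_tree_le[of "int (Suc m)"] size_int_tree_le[of "- int (Suc (Suc m))"]
    by (simp add: algebra_simps)
qed auto

lemma size_build_list:
  assumes "x \<le> n" "y \<le> n"
  shows "size (cls_tree (build_list n x y)) \<le> (n + 2) * (4 * n + 10)"
proof -
  have "size (ints_tree (pair_or_unit a b)) \<le> 2 + size (int_tree a) + size (int_tree b)" for a b
    by (auto simp: pair_or_unit_def)
  from this[of 1 "int x"] this[of "- int n" "- int y"] show ?thesis
    using size_chain_list[of n] size_int_tree_le[of 1] size_int_tree_le[of "int x"]
      size_int_tree_le[of "- int n"] size_int_tree_le[of "- int y"] assms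
    by (simp add: build_list_def algebra_simps)
qed

section \<open>The main programs\<close>

text \<open>By deficiency 1 the clause list without its first entry has length n. Expressions have
  no local bindings, so the solver is called once for each component of its result.\<close>

definition params_main :: exp where
  "params_main = Call 17 [Call 11 [Right (Arg 0)], Left (Call 1 [Arg 0]), Right (Call 1 [Arg 0])]"

definition canon_main :: exp where
  "canon_main = Call 13 [Call 25 [Right (Arg 0)], Left (Call 1 [Arg 0]), Right (Call 1 [Arg 0])]"

definition graph_main :: exp where
  "graph_main = Call 21 [Call 25 [Right (Arg 0)], Left (Call 1 [Arg 0]), Right (Call 1 [Arg 0])]"

definition decode_main :: exp where
  "decode_main = Call 24 [Call 22 [Left (Arg 0)], Right (Arg 0),
     Call 23 [Right (Arg 0), pos_exp (Call 11 [Call 22 [Left (Arg 0)]])]]"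

text \<open>S will be the input size plus one; it dominates n + 2 because the input lists at least n
  + 1 clauses or vertices. Writing S = n + 2 + d reduces everything to comparing coefficients, for
  which 1000 is generous.\<close>

lemma quadratic_bound:
  fixes S :: nat
  assumes "n + 2 \<le> S"
  shows "(n + 2) * (20 * n + 40) + 16 * n + 60 \<le> 1000 * S ^ 2" "2 * S + 4 * n + 60 \<le> 1000 * S ^ 2"
    "S \<le> S ^ 2"
proof -
  obtain d where S: "S = n + 2 + d" using assms le_Suc_ex by blast
  show "(n + 2) * (20 * n + 40) + 16 * n + 60 \<le> 1000 * S ^ 2" "2 * S + 4 * n + 60 \<le> 1000 * S ^ 2"
    "S \<le> S ^ 2"
    unfolding S by (simp_all add: power2_eq_square algebra_simps)
qed

lemma cubic_bound:
  fixes S :: nat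
  assumes "n + 2 \<le> S"
  shows "n + 16 * (n + 3) * (n + 3) + (n + 4) * (8 * (n * (n + 2)) + 20) + 10 \<le> 1000 * S ^ 3"
proof -
  obtain d where S: "S = n + 2 + d" using assms le_Suc_ex by blast
  show ?thesis unfolding S by (simp add: power3_eq_cube algebra_simps)
qed

context
  fixes F n x y w B T
  assumes F: "F \<in> mu2_def1" and n: "n = nvars F" and can: "canonical_params n x y"
    and iso: "F \<cong> U0' n x y" and rep: "cls_rep w F"
    and B: "B = 1000 * (size w + 1) ^ 2" and T: "T = 1000 * (size w + 1) ^ 3"
begin

private lemma solve_facts:
  obtains Fs ws where "w = cls_tree Fs" "right w = list_tree ws" "length ws = n" "n + 2 \<le> size w + 1"
    "\<And>main. fn (prog main) B (Suc 0) [w] (Node (nat_tree x) (nat_tree y)) (8 * (n + 3) * (n + 3))"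
proof -
  obtain Fs where Fs: "w = cls_tree Fs" "length Fs = n + 1"
    "\<And>main B. 2 * size w + 4 \<le> B \<Longrightarrow> 4 * n + 6 \<le> B \<Longrightarrow>
       fn (prog main) B (Suc 0) [w] (Node (nat_tree x) (nat_tree y)) (8 * (n + 3) * (n + 3))"
    using run_solve_mu[OF F n can iso rep] by blast
  have S: "n + 2 \<le> size w + 1" using length_le_size_cls_tree[of Fs] Fs(1,2) by simp
  have r: "right w = list_tree (map ints_tree (tl Fs))"
    using Fs(1,2) by (cases Fs) (auto simp: cls_tree_def)
  have "2 * size w + 4 \<le> B" "4 * n + 6 \<le> B" using quadratic_bound(2)[OF S, folded B] by auto
  from Fs(3)[OF this] show thesis using that[OF Fs(1) r _ S] Fs(2) by simp
qed

private lemma xy_bounds: "1 \<le> x" "x \<le> n" "1 \<le> y" "y \<le> n"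
  using can by (auto simp: canonical_params_def)

lemma run_params_main:
  "fn (prog params_main) B 0 [w] (list_tree (map nat_tree (params_list n x y))) T"
proof -
  \<comment> \<open>With an opaque name, unfolding \<open>params_main_def\<close> exposes the body
    at position 0 but leaves the argument of \<open>prog\<close> alone, so that the specifications
    still match.\<close>
  define M0 where "M0 = params_main"
  have M: "prog M0 ! 0 = params_main"
    by (simp add: M0_def prog_nth)
  note M = M[unfolded params_main_def]
  obtain Fs ws where w: "w = cls_tree Fs" "right w = list_tree ws" "length ws = n" "n + 2 \<le> size w + 1"
    "\<And>main. fn (prog main) B (Suc 0) [w] (Node (nat_tree x) (nat_tree y)) (8 * (n + 3) * (n + 3))"
    by (rule solve_facts) blast
  note b = quadratic_bound[OF w(4), folded B]
  have s: "size (nat_tree x) \<le> 2 * n" "size (nat_tree y) \<le> 2 * n" "size (nat_tree n) \<le> 2 * n"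
    using size_nat_tree[of x] size_nat_tree[of y] size_nat_tree[of n] xy_bounds by linarith+
  have bin: "fn (prog M0) B 11 [right w] (nat_tree n) (n * (n + 2))"
    using run_bin_list[of ws B M0] w b size_right[of w] by auto
  have par: "fn (prog M0) B 17 [nat_tree n, nat_tree x, nat_tree y]
      (list_tree (map nat_tree (params_list n x y))) 0"
    using s b by (intro run_params) auto
  have c: "n * (n + 2) + 16 * (n + 3) * (n + 3) + 10 \<le> T"
  proof -
    have "n * (n + 2) \<le> (n + 4) * (8 * (n * (n + 2)) + 20)"
      by (simp add: algebra_simps)
    then show ?thesis using cubic_bound[OF w(4), folded T] by linarith
  qed
  define c1 c2 where c12: "c1 = n * (n + 2)" "c2 = 8 * (n + 3) * (n + 3)"
  have cT: "c1 + 2 * c2 + 10 \<le> T" using c unfolding c12 by (simp add: algebra_simps)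
  have "fn (prog M0) B 0 [w] (list_tree (map nat_tree (params_list n x y))) T"
    using b w(4) cT by (intro runI) (auto simp: M
      intro!: callI[OF bin[folded c12]] callI[OF w(5)[folded c12]] callI2[OF par])
  then show ?thesis unfolding M0_def .
qed

lemma run_canon_main:
  "fn (prog canon_main) B 0 [w] (cls_tree (build_list n x y)) T"
proof -
  define M0 where "M0 = canon_main"
  have M: "prog M0 ! 0 = canon_main"
    by (simp add: M0_def prog_nth)
  note M = M[unfolded canon_main_def]
  obtain Fs ws where w: "w = cls_tree Fs" "right w = list_tree ws" "length ws = n" "n + 2 \<le> size w + 1"
    "\<And>main. fn (prog main) B (Suc 0) [w] (Node (nat_tree x) (nat_tree y)) (8 * (n + 3) * (n + 3))"
    by (rule solve_facts) blast
  note b = quadratic_bound[OF w(4), folded B]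
  have s: "size (nat_tree x) \<le> 2 * n" "size (nat_tree y) \<le> 2 * n"
    using size_nat_tree[of x] size_nat_tree[of y] xy_bounds by linarith+
  have len: "fn (prog M0) B 25 [right w] (unary n) n"
    using run_length[of ws B M0] w b size_right[of w] by auto
  have "(n + 2) * (4 * n + 10) \<le> (n + 2) * (20 * n + 40)" by (intro mult_mono) auto
  then have "size (cls_tree (build_list n x y)) \<le> B"
    using size_build_list[of x n y] xy_bounds b(1) by linarith
  then have bld: "fn (prog M0) B 13 [unary n, nat_tree x, nat_tree y]
      (cls_tree (build_list n x y)) ((n + 2) * (2 * (n * (n + 2)) + 3))"
    using s b xy_bounds by (intro run_build) auto
  define c1 c2 where c: "c1 = (n + 2) * (2 * (n * (n + 2)) + 3)"
    "c2 = 8 * (n + 3) * (n + 3)"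
  have "c1 \<le> (n + 4) * (8 * (n * (n + 2)) + 20)" unfolding c by (intro mult_mono) auto
  then have cT: "n + c1 + 2 * c2 + 10 \<le> T" using cubic_bound[OF w(4), folded T] unfolding c by linarith
  have "fn (prog M0) B 0 [w] (cls_tree (build_list n x y)) T"
    using b w(4) cT by (intro runI) (auto simp: M
      intro!: callI[OF len] callI[OF w(5)[folded c]] callI2[OF bld[folded c]])
  then show ?thesis unfolding M0_def .
qed

lemma run_graph_main:
  "fn (prog graph_main) B 0 [w]
     (Node (ints_tree (vert_list n)) (cls_tree (graph_edges n x y))) T"
proof -
  define M0 where "M0 = graph_main"
  have M: "prog M0 ! 0 = graph_main"
    by (simp add: M0_def prog_nth)
  note M = M[unfolded graph_main_def]
  obtain Fs ws where w: "w = cls_tree Fs" "right w = list_tree ws" "length ws = n" "n + 2 \<le> size w + 1"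
    "\<And>main. fn (prog main) B (Suc 0) [w] (Node (nat_tree x) (nat_tree y)) (8 * (n + 3) * (n + 3))"
    by (rule solve_facts) blast
  note b = quadratic_bound[OF w(4), folded B]
  have len: "fn (prog M0) B 25 [right w] (unary n) n"
    using run_length[of ws B M0] w b size_right[of w] by auto
  have "n * (4 * n + 10) + n * (8 * n + 20) \<le> (n + 2) * (20 * n + 40)" by (simp add: algebra_simps)
  then have "size (ints_tree (vert_list n)) + size (cls_tree (edge_list n)) + 16 * n + 60 \<le> B"
    using size_vert_list[of n] size_edge_list[of n] b(1) by linarith
  then have gr: "fn (prog M0) B 21 [unary n, nat_tree x, nat_tree y]
      (Node (ints_tree (vert_list n)) (cls_tree (graph_edges n x y)))
      ((n + 4) * (8 * (n * (n + 2)) + 20))"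
    using xy_bounds by (intro run_graph) auto
  define c1 c2 where c: "c1 = (n + 4) * (8 * (n * (n + 2)) + 20)"
    "c2 = 8 * (n + 3) * (n + 3)"
  have cT: "n + c1 + 2 * c2 + 10 \<le> T" using cubic_bound[OF w(4), folded T] unfolding c by linarith
  have "fn (prog M0) B 0 [w]
     (Node (ints_tree (vert_list n)) (cls_tree (graph_edges n x y))) T"
    using b w(4) cT by (intro runI) (auto simp: M
      intro!: callI[OF len] callI[OF w(5)[folded c]] callI2[OF gr[folded c]])
  then show ?thesis unfolding M0_def .
qed

end

lemma run_decode_main:
  assumes can: "canonical_params n x y" and rep: "graph_rep w (ig (U0' n x y))"
    and B: "B = 1000 * (size w + 1) ^ 2" and T: "T = 1000 * (size w + 1) ^ 3"
  shows "fn (prog decode_main) B 0 [w] (cls_tree (build_list n x y)) T"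
proof -
  define M0 where "M0 = decode_main"
  have M: "prog M0 ! 0 = decode_main"
    by (simp add: M0_def prog_nth)
  note M = M[unfolded decode_main_def]
  have xy: "1 \<le> x" "x \<le> y" "y \<le> n" "x + y \<le> n + 1" and xy': "1 \<le> x" "x \<le> n" "1 \<le> y" "y \<le> n"
    using can by (auto simp: canonical_params_def)
  obtain V Es where V: "w = Node (ints_tree V) (cls_tree Es)" "distinct V" "set V = lits (U0' n x y)"
    and Es: "set ` set Es = snd (ig (U0' n x y))" "\<forall>e\<in>set Es. distinct e"
    using rep unfolding graph_rep_def set_rep_int_rep set_rep_set_rep fst_ig by blast
  have V2: "set V = {z. z \<noteq> 0 \<and> \<bar>z\<bar> \<le> int n}" using V(3) lits_U[OF xy'] by simp
  have "length (filter (\<lambda>z. \<not> z < 0) V) = card (set (filter (\<lambda>z. \<not> z < 0) V))"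
    using V(2) by (intro distinct_card[symmetric]) simp
  also have "set (filter (\<lambda>z. \<not> z < 0) V) = {1..int n}" unfolding set_filter V2 by auto
  finally have cnt: "length (filter (\<lambda>z. \<not> z < 0) V) = n" by simp
  have "length V = card (set V)" using V(2) by (simp add: distinct_card)
  \<comment> \<open>One negative vertex besides the n positive ones is enough for the bound n + 2 <=
    size w + 1.\<close>
  moreover have "insert (- 1) {1..int n} \<subseteq> set V" unfolding V2 using xy by auto
  then have "card (insert (- 1) {1..int n}) \<le> card (set V)" by (intro card_mono) simp_all
  then have "n + 1 \<le> card (set V)" by simp
  ultimately have "n + 1 \<le> length V" by simp
  then have S: "n + 2 \<le> size w + 1" using V(1) length_le_size_ints_tree[of V] by simp
  note b = quadratic_bound[OF S, folded B]
  have pairs: "\<forall>e\<in>set Es. \<exists>a b. e = [a, b]"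
  proof
    fix e assume e: "e \<in> set Es"
    then have "set e \<in> set ` set (graph_edges n x y)" using Es(1) edges_ig_U[OF xy] by blast
    then obtain a b where "set e = {a, b}" "a \<noteq> b" using graph_edges_pairs[OF xy] by fastforce
    then have "length e = 2" using distinct_card[of e] Es(2) e by simp
    then show "\<exists>a b. e = [a, b]" by (auto simp: length_Suc_conv numeral_2_eq_2)
  qed
  have ex1: "\<exists>e\<in>set Es. \<exists>b. set e = {int n, b} \<and> \<not> (b < 0 \<longleftrightarrow> int n < 0)"
  proof -
    have "{int n, - int y} \<in> set ` set Es" using edges_mem(1)[OF xy] Es(1) by simp
    then obtain e where "e \<in> set Es" "set e = {int n, - int y}" by force
    then show ?thesis using xy' by (intro bexI[of _ e] exI[of _ "- int y"]) auto
  qed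
  have ex2: "\<exists>e\<in>set Es. \<exists>b. set e = {- 1, b} \<and> \<not> b < 0"
  proof -
    have "{- 1, int x} \<in> set ` set Es" using edges_mem(2)[OF xy] Es(1) by simp
    then obtain e where "e \<in> set Es" "set e = {- 1, int x}" by force
    then show ?thesis by (intro bexI[of _ e] exI[of _ "int x"]) auto
  qed
  have py: "partner Es (int n) = - int y"
    using partner_mem[OF pairs ex1] edge_last[OF xy] Es(1) by simp
  have px: "partner Es (- 1) = int x" if "y \<noteq> 1"
    using partner_mem[OF pairs, of "- 1"] ex2 edge_first[OF xy _ _ that] Es(1) by simp
  have sizes: "size (ints_tree V) + size (cls_tree Es) + 1 = size w" using V(1) by simp
  have sB: "size w \<le> B" using b(2) by simp
  have count: "fn (prog M0) B 22 [ints_tree V] (unary n) (length V)"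
    using run_count[of V B M0] cnt sizes sB by simp
  have bin: "fn (prog M0) B 11 [unary n] (nat_tree n) (n * (n + 2))"
    using b(2) by (intro run_bin) linarith
  have s: "size (nat_tree x) \<le> 2 * n" "size (nat_tree y) \<le> 2 * n" "size (nat_tree n) \<le> 2 * n"
    using size_nat_tree[of x] size_nat_tree[of y] size_nat_tree[of n] xy' by linarith+
  have par: "fn (prog M0) B 23 [cls_tree Es, Node Leaf (nat_tree n)] (nat_tree y) (length Es)"
    using run_partner[OF pairs ex1, of B M0] py sizes sB b(2) s(3) by (simp add: int_tree_pos)
  have "(n + 2) * (4 * n + 10) \<le> (n + 2) * (20 * n + 40)" by (intro mult_mono) auto
  then have "size (cls_tree (build_list n x y)) \<le> B"
    using size_build_list[of x n y] xy' b(1) by linarith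
  then have dec: "fn (prog M0) B 24 [unary n, cls_tree Es, nat_tree y]
      (cls_tree (build_list n x y)) ((n + 2) * (2 * (n * (n + 2)) + 3) + length Es + 2)"
    using pairs ex2 sizes sB xy px s b(2) by (intro run_decode) auto
  have lens: "length V + length Es \<le> size w"
    using sizes length_le_size_ints_tree[of V] length_le_size_cls_tree[of Es] by linarith
  define c1 c2 where c: "c1 = n * (n + 2)"
    "c2 = (n + 2) * (2 * (n * (n + 2)) + 3) + length Es + 2"
  have cT: "2 * length V + length Es + c1 + c2 + 10 \<le> T"
  proof -
    obtain d where d: "size w + 1 = n + 2 + d" using S le_Suc_ex by blast
    have "n * (n + 2) + (n + 2) * (2 * (n * (n + 2)) + 3) + 4 * (n + 2 + d) + 20 \<le> 1000 * (n + 2 + d) ^ 3"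
      by (simp add: power3_eq_cube algebra_simps)
    then have "c1 + (c2 - length Es) + 4 * (size w + 1) + 18 \<le> T" "length Es + 2 \<le> c2"
      unfolding c d[symmetric] T[symmetric] by simp_all
    then show ?thesis using lens by simp
  qed
  have "fn (prog M0) B 0 [w] (cls_tree (build_list n x y)) T"
    using b S s cT sB sizes V(1) by (intro runI) (auto simp: M
      intro!: callI[OF count] callI[OF bin[folded c]] callI[OF par] callI2[OF dec[folded c]])
  then show ?thesis unfolding M0_def .
qed

section \<open>Canonisation\<close>

lemma mu2_def1_normal_form:
  assumes "F \<in> mu2_def1"
  shows "\<exists>x y. canonical_params (nvars F) x y \<and> F \<cong> U0' (nvars F) x y \<and>
    canon F = U0' (nvars F) x y \<and> params F = params_list (nvars F) x y \<and>
    is_params F = (\<lambda>L. L = params_list (nvars F) x y)"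
proof -
  obtain x y where xy: "canonical_params (nvars F) x y" "F \<cong> U0' (nvars F) x y"
    using mu2_def1_canonical[OF assms] .
  then show ?thesis
    using canon_mu[OF assms refl xy] params_mu[OF assms refl xy] is_params_iff[OF assms refl xy]
    by (intro exI[of _ x] exI[of _ y]) (simp add: fun_eq_iff)
qed

lemma iso_canon: "F \<in> mu2_def1 \<Longrightarrow> F \<cong> canon F"
  using mu2_def1_normal_form by metis

lemma nvars_iso:
  assumes "F \<in> mu2_def1" "F' \<in> mu2_def1" "F \<cong> F'"
  shows "nvars F = nvars F'"
proof -
  obtain f where "iso_by f F F'" using assms(3) by (auto simp: cls_iso_iff)
  then show ?thesis using iso_card mu2_def1D(9)[OF assms(1)] mu2_def1D(9)[OF assms(2)] by fastforce
qed

lemma canon_iff: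
  assumes "F \<in> mu2_def1" "F' \<in> mu2_def1"
  shows "F \<cong> F' \<longleftrightarrow> canon F = canon F'"
proof
  assume iso: "F \<cong> F'"
  obtain x y where xy: "canonical_params (nvars F) x y" "F \<cong> U0' (nvars F) x y"
    "canon F = U0' (nvars F) x y" using mu2_def1_normal_form[OF assms(1)] by blast
  have "F' \<cong> U0' (nvars F') x y"
    using iso xy(2) nvars_iso[OF assms iso] cls_iso_sym cls_iso_trans by metis
  then show "canon F = canon F'"
    using canon_mu[OF assms(2) refl, of x y] xy nvars_iso[OF assms iso] by simp
next
  assume "canon F = canon F'"
  then show "F \<cong> F'"
    using iso_canon[OF assms(1)] iso_canon[OF assms(2)] cls_iso_sym cls_iso_trans by metis
qed

lemma canon'_inj:
  assumes "F \<in> mu2_def1" "F' \<in> mu2_def1" "canon' F = canon' F'"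
  shows "canon F = canon F'"
proof -
  obtain x y where xy: "canonical_params (nvars F) x y" "canon F = U0' (nvars F) x y"
    using mu2_def1_normal_form[OF assms(1)] by blast
  obtain x' y' where xy': "canonical_params (nvars F') x' y'" "canon F' = U0' (nvars F') x' y'"
    using mu2_def1_normal_form[OF assms(2)] by blast
  show ?thesis
    using ig_U_inj[OF xy(1) xy'(1)] assms(3) xy(2) xy'(2) by (simp add: canon'_def)
qed

lemma canon'_iff:
  assumes "F \<in> mu2_def1" "F' \<in> mu2_def1"
  shows "F \<cong> F' \<longleftrightarrow> canon' F = canon' F'"
  using canon_iff[OF assms] canon'_inj[OF assms] by (auto simp: canon'_def)

lemma exactly_oneI:
  assumes "a \<or> b \<or> c \<or> d"
    "\<not> (a \<and> b)" "\<not> (a \<and> c)" "\<not> (a \<and> d)" "\<not> (b \<and> c)" "\<not> (b \<and> d)" "\<not> (c \<and> d)"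
  shows "exactly_one [a, b, c, d]"
proof -
  have Q: "k < length [a, b, c, d] \<and> [a, b, c, d] ! k \<longleftrightarrow>
    k = 0 \<and> a \<or> k = 1 \<and> b \<or> k = 2 \<and> c \<or> k = 3 \<and> d" for k
    by (auto simp: less_Suc_eq nth_Cons' numeral_2_eq_2 numeral_3_eq_3 split: if_splits)
  from assms(1) show ?thesis unfolding exactly_one_def Q
  proof (elim disjE)
    assume a
    then show "\<exists>!k. k = 0 \<and> a \<or> k = 1 \<and> b \<or> k = 2 \<and> c \<or> k = 3 \<and> d"
      using assms by (intro ex1I[of _ 0]) auto
  next
    assume b
    then show "\<exists>!k. k = 0 \<and> a \<or> k = 1 \<and> b \<or> k = 2 \<and> c \<or> k = 3 \<and> d"
      using assms by (intro ex1I[of _ 1]) auto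
  next
    assume c
    then show "\<exists>!k. k = 0 \<and> a \<or> k = 1 \<and> b \<or> k = 2 \<and> c \<or> k = 3 \<and> d"
      using assms by (intro ex1I[of _ 2]) auto
  next
    assume d
    then show "\<exists>!k. k = 0 \<and> a \<or> k = 1 \<and> b \<or> k = 2 \<and> c \<or> k = 3 \<and> d"
      using assms by (intro ex1I[of _ 3]) auto
  qed
qed

text \<open>One of the four cases applies because some L satisfies \<open>is_params\<close>; they
  exclude each other by the number of unit clauses and by the existence of a variable in four
  clauses.\<close>

lemma classification:
  assumes "F \<in> mu2_def1"
  shows "nunits F \<in> {0, 1, 2} \<and>
        exactly_one
          [nunits F = 2 \<and> F \<cong> U2 (nvars F),
           nunits F = 1 \<and> (\<exists>i. 1 \<le> i \<and> i \<le> nvars F - 1 \<and> F \<cong> U1 (nvars F) i),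
           nunits F = 0 \<and> (\<exists>v\<in>vars F. var_occ F v = 4) \<and>
             (\<exists>i. 2 \<le> i \<and> 2 * i \<le> nvars F + 1 \<and> F \<cong> U0 (nvars F) i),
           nunits F = 0 \<and> \<not> (\<exists>v\<in>vars F. var_occ F v = 4) \<and>
             (\<exists>x y. 2 \<le> x \<and> x < y \<and> y \<le> nvars F - 1 \<and> x + y \<le> nvars F + 1 \<and>
                    F \<cong> U0' (nvars F) x y)] \<and>
        (\<exists>!L. is_params F L)"
proof -
  obtain x y where xy: "canonical_params (nvars F) x y" "F \<cong> U0' (nvars F) x y"
    and p: "is_params F = (\<lambda>L. L = params_list (nvars F) x y)"
    using mu2_def1_normal_form[OF assms] by blast
  have u: "nunits F \<in> {0, 1, 2}" using nunits_mu[OF assms refl xy] by auto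
  have "is_params F (params_list (nvars F) x y)" using p by simp
  moreover have "\<exists>!L. is_params F L" using p by simp
  ultimately show ?thesis
    using u by (intro conjI exactly_oneI) (simp_all add: is_params_def, blast+)
qed

lemma polytime_params: "polytime_on cls_rep nat_list_rep mu2_def1 params"
proof (rule polytime_onI)
  fix F w assume F: "F \<in> mu2_def1" "cls_rep w F"
  obtain x y where xy: "canonical_params (nvars F) x y" "F \<cong> U0' (nvars F) x y"
    "params F = params_list (nvars F) x y" using mu2_def1_normal_form[OF F(1)] by blast
  show "\<exists>w'. nat_list_rep w' (params F) \<and>
     fn (prog params_main) (1000 * (size w + 1) ^ 2) 0 [w] w' (1000 * (size w + 1) ^ 3)"
    using run_params_main[OF F(1) refl xy(1,2) F(2) refl refl] xy(3) unfolding nat_list_rep_def by auto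
qed

lemma polytime_canon: "polytime_on cls_rep cls_rep mu2_def1 canon"
proof (rule polytime_onI)
  fix F w assume F: "F \<in> mu2_def1" "cls_rep w F"
  obtain x y where xy: "canonical_params (nvars F) x y" "F \<cong> U0' (nvars F) x y"
    "canon F = U0' (nvars F) x y" using mu2_def1_normal_form[OF F(1)] by blast
  show "\<exists>w'. cls_rep w' (canon F) \<and>
     fn (prog canon_main) (1000 * (size w + 1) ^ 2) 0 [w] w' (1000 * (size w + 1) ^ 3)"
    using run_canon_main[OF F(1) refl xy(1,2) F(2) refl refl] cls_rep_build_list[OF xy(1)] xy(3) by auto
qed

lemma polytime_canon': "polytime_on cls_rep graph_rep mu2_def1 canon'"
proof (rule polytime_onI)
  fix F w assume F: "F \<in> mu2_def1" "cls_rep w F"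
  obtain x y where xy: "canonical_params (nvars F) x y" "F \<cong> U0' (nvars F) x y"
    "canon F = U0' (nvars F) x y" using mu2_def1_normal_form[OF F(1)] by blast
  show "\<exists>w'. graph_rep w' (canon' F) \<and>
     fn (prog graph_main) (1000 * (size w + 1) ^ 2) 0 [w] w' (1000 * (size w + 1) ^ 3)"
    using run_graph_main[OF F(1) refl xy(1,2) F(2) refl refl] graph_rep_ig[OF xy(1)] xy(3)
    unfolding canon'_def by auto
qed

text \<open>The choice is harmless: by \<open>canon'_inj\<close> all clause-sets of the class with
  the same graph have the same canonical form, and that form is what the program computes.\<close>

definition uncanon :: "graph \<Rightarrow> clause_set" where
  "uncanon G = canon (SOME F. F \<in> mu2_def1 \<and> canon' F = G)"

lemma uncanon_canon':
  assumes "F \<in> mu2_def1"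
  shows "uncanon (canon' F) = canon F"
proof -
  have "(SOME F'. F' \<in> mu2_def1 \<and> canon' F' = canon' F) \<in> mu2_def1 \<and>
    canon' (SOME F'. F' \<in> mu2_def1 \<and> canon' F' = canon' F) = canon' F"
    by (rule someI[of _ F]) (simp add: assms)
  then show ?thesis unfolding uncanon_def using canon'_inj assms by blast
qed

lemma iso_uncanon: "F \<in> mu2_def1 \<Longrightarrow> F \<cong> uncanon (canon' F)"
  using iso_canon uncanon_canon' by simp

lemma polytime_uncanon: "polytime_on graph_rep cls_rep (canon' ` mu2_def1) uncanon"
proof (rule polytime_onI)
  fix G w assume G: "G \<in> canon' ` mu2_def1" "graph_rep w G"
  then obtain F where F: "F \<in> mu2_def1" "G = canon' F" by blast
  obtain x y where xy: "canonical_params (nvars F) x y" "canon F = U0' (nvars F) x y"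
    using mu2_def1_normal_form[OF F(1)] by blast
  have "graph_rep w (ig (U0' (nvars F) x y))" using G(2) F(2) xy(2) by (simp add: canon'_def)
  from run_decode_main[OF xy(1) this refl refl]
  show "\<exists>w'. cls_rep w' (uncanon G) \<and>
     fn (prog decode_main) (1000 * (size w + 1) ^ 2) 0 [w] w' (1000 * (size w + 1) ^ 3)"
    using cls_rep_build_list[OF xy(1)] uncanon_canon'[OF F(1)] F(2) xy(2) by auto
qed

theorem theorem4p1:
  shows
    "(\<forall>F\<in>mu2_def1.
        nunits F \<in> {0, 1, 2} \<and>
        exactly_one
          [nunits F = 2 \<and> F \<cong> U2 (nvars F),
           nunits F = 1 \<and> (\<exists>i. 1 \<le> i \<and> i \<le> nvars F - 1 \<and> F \<cong> U1 (nvars F) i),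
           nunits F = 0 \<and> (\<exists>v\<in>vars F. var_occ F v = 4) \<and>
             (\<exists>i. 2 \<le> i \<and> 2 * i \<le> nvars F + 1 \<and> F \<cong> U0 (nvars F) i),
           nunits F = 0 \<and> \<not> (\<exists>v\<in>vars F. var_occ F v = 4) \<and>
             (\<exists>x y. 2 \<le> x \<and> x < y \<and> y \<le> nvars F - 1 \<and> x + y \<le> nvars F + 1 \<and>
                    F \<cong> U0' (nvars F) x y)] \<and>
        (\<exists>!L. is_params F L)) \<and>
     polytime_on cls_rep nat_list_rep mu2_def1 params \<and>
     polytime_on cls_rep cls_rep mu2_def1 canon \<and>
     (\<forall>F\<in>mu2_def1. \<forall>F'\<in>mu2_def1. F \<cong> F' \<longleftrightarrow> canon F = canon F') \<and>
     polytime_on cls_rep graph_rep mu2_def1 canon' \<and>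
     (\<forall>F\<in>mu2_def1. \<forall>F'\<in>mu2_def1. F \<cong> F' \<longleftrightarrow> canon' F = canon' F') \<and>
     (\<exists>g. polytime_on graph_rep cls_rep (canon' ` mu2_def1) g \<and>
          (\<forall>F\<in>mu2_def1. F \<cong> g (canon' F)))"
proof (intro conjI exI[of _ uncanon], goal_cases)
  case 1
  show ?case by (rule ballI) (rule classification)
qed (use canon_iff canon'_iff iso_uncanon in
    \<open>simp_all add: polytime_params polytime_canon polytime_canon' polytime_uncanon\<close>)

end
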